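(* Let $\Gamma$ be an equilateral metric graph with $n$ vertices, $N$ edges, common edge length $l_e$ and transition matrix $\mathcal{Z}$. Then the spectrum of the standard Laplace operator $L^{st}(\Gamma)$ is given by $$\sigma(L^{st}(\Gamma))=\{0\}\cup\{\lambda>0:\cos(\sqrt{\lambda}\,l_e)\in\sigma(\mathcal{Z})\}\cup\{\lambda>0:\cos(\sqrt{\lambda}\,l_e)=-1\}.$$ The multiplicities of the eigenvalues are given by $$m(\lambda)=\begin{cases}1, & \text{if } \lambda=0,\\ \dim\ker(\mathcal{Z}-\cos(\sqrt{\lambda}\,l_e)I), & \text{if } \sin(\sqrt{\lambda}\,l_e)\neq 0,\\ N-n+2, & \text{if } \cos(\sqrt{\lambda}\,l_e)=1 \text{ and } \lambda>0,\\ N-n+2, & \text{if } \cos(\sqrt{\lambda}\,l_e)=-1 \text{ and } \Gamma \text{ is bipartite},\\ N-n, & \text{if } \cos(\sqrt{\lambda}\,l_e)=-1 \text{ and } \Gamma \text{ is non-bipartite},\end{cases}$$ where $I$ is an identity matrix.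
   Context: A metric graph $\Gamma$ consists of a finite vertex set $\mathcal{V}=\{v_1,\dots,v_n\}$ and a finite edge set $\mathcal{E}=\{e_1,\dots,e_N\}$; it is connected and simple (no loops, at most one edge between two vertices), and each edge $e_i$ has a length $l_{e_i}\in(0,\infty)$ and is identified with the interval $[0,l_{e_i}]$ (the endpoints $0$ and $l_{e_i}$ corresponding to the two vertices of $e_i$). $\Gamma$ is equilateral if all edges have the same length, denoted $l_e$. $\Gamma$ is bipartite if $\mathcal{V}$ is the disjoint union of two sets such that every edge has one endpoint in each. The adjacency matrix $\mathcal{A}=(a_{ij})_{n\times n}$ has $a_{ij}=1$ if $v_i,v_j$ are joined by an edge and $a_{ij}=0$ otherwise. The transition matrix is $\mathcal{Z}=\mathrm{Diag}(\mathcal{A}e)^{-1}\mathcal{A}$, where $e=(1,\dots,1)^{\top}\in\mathbb{R}^n$; $\sigma(\mathcal{Z})$ is its set of eigenvalues. $L^2(\Gamma)=\bigoplus_i L^2[0,l_{e_i}]$, and $f_i$ denotes the restriction of $f$ to $e_i$. The maximal domain consists of all $f\in L^2(\Gamma)$ with $f_i,f_i'$ (real-valued) absolutely continuous on $[0,l_{e_i}]$ for every $i$ and $-f''\in L^2(\Gamma)$. The standard (Kirchhoff) Laplace operator $L^{st}(\Gamma)$ acts by $f\mapsto -f''$ on each edge, with domain the functions $f$ in the maximal domain such that at every vertex $v$: the values at $v$ of $f$ along all edges incident to $v$ coincide, and the sum over the edges incident to $v$ of the derivatives of $f$ at $v$, taken along each edge in the direction outgoing from $v$, is $0$. Its spectrum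 consists of isolated nonnegative eigenvalues of finite multiplicity; $m(\lambda)$ denotes the multiplicity of $\lambda$.
   Formalization: For non-bipartite graphs with N = n (e.g. the triangle) the printed spectrum is wrong: λ with cos(√λ l_e) = −1 has multiplicity N − n = 0, so the third set is dropped in that case; graphs without edges, for which l_e and Z are undefined, are excluded. *)

theory Defs
  imports "HOL-Analysis.Analysis" "HOL-Library.Function_Algebras"
begin

section \<open>Metric graphs\<close>

text \<open>
  The vertex set is the finite type \<^typ>\<open>'v\<close>. An edge is a pair \<open>(u, v)\<close>, identified with the
  interval \<open>[0, len (u, v)]\<close> in such a way that \<open>0\<close> corresponds to \<open>u\<close> and \<open>len (u, v)\<close> to \<open>v\<close>.
  The orientation only serves as parametrization: every undirected edge is listed in exactly one of
  its two orientations.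
\<close>

definition metric_graph :: "('v::finite \<times> 'v) set \<Rightarrow> ('v \<times> 'v \<Rightarrow> real) \<Rightarrow> bool" where
  "metric_graph E len \<longleftrightarrow>
     (\<forall>u v. (u, v) \<in> E \<longrightarrow> u \<noteq> v \<and> (v, u) \<notin> E) \<and>
     (\<forall>u v. (u, v) \<in> (E \<union> E\<inverse>)\<^sup>*) \<and>
     (\<forall>e\<in>E. 0 < len e)"

definition equilateral :: "('v \<times> 'v) set \<Rightarrow> ('v \<times> 'v \<Rightarrow> real) \<Rightarrow> real \<Rightarrow> bool" where
  "equilateral E len l \<longleftrightarrow> (\<forall>e\<in>E. len e = l)"

definition bipartite :: "('v \<times> 'v) set \<Rightarrow> bool" where
  "bipartite E \<longleftrightarrow> (\<exists>A B. A \<union> B = UNIV \<and> A \<inter> B = {} \<and>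
     (\<forall>(u, v)\<in>E. u \<in> A \<and> v \<in> B \<or> u \<in> B \<and> v \<in> A))"

definition adjacency_matrix :: "('v::finite \<times> 'v) set \<Rightarrow> real^'v^'v" where
  "adjacency_matrix E = (\<chi> i j. if (i, j) \<in> E \<or> (j, i) \<in> E then 1 else 0)"

definition Diag :: "real^'v \<Rightarrow> real^'v^'v::finite" where
  "Diag d = (\<chi> i j. if i = j then d $ i else 0)"

definition transition_matrix :: "('v::finite \<times> 'v) set \<Rightarrow> real^'v^'v" where
  "transition_matrix E =
     matrix_inv (Diag (adjacency_matrix E *v (\<chi> i. 1))) ** adjacency_matrix E"

definition eigenvalues :: "real^'v^'v::finite \<Rightarrow> real set" where
  "eigenvalues M = {\<mu>. \<exists>x. x \<noteq> 0 \<and> M *v x = \<mu> *\<^sub>R x}"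

definition matrix_kernel :: "real^'v^'v::finite \<Rightarrow> (real^'v) set" where
  "matrix_kernel M = {x. M *v x = 0}"


section \<open>Square-integrable functions on a metric graph\<close>

type_synonym 'v edge_fun = "'v \<times> 'v \<Rightarrow> real \<Rightarrow> real"

text \<open>
  \<open>f e\<close> is the restriction of \<open>f\<close> to the edge \<open>e\<close>. Elements of \<open>L\<^sup>2\<close> are represented by functions,
  equality being \<open>ae_equal\<close>; values off the graph (\<open>e \<notin> E\<close> or \<open>x \<notin> [0, len e]\<close>) are irrelevant.
\<close>

definition L2_space :: "('v \<times> 'v) set \<Rightarrow> ('v \<times> 'v \<Rightarrow> real) \<Rightarrow> 'v edge_fun set" where
  "L2_space E len = {f. \<forall>e\<in>E. f e \<in> borel_measurable (lebesgue_on {0..len e}) \<and>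
     integrable (lebesgue_on {0..len e}) (\<lambda>x. (f e x)\<^sup>2)}"

definition L2_norm :: "('v \<times> 'v) set \<Rightarrow> ('v \<times> 'v \<Rightarrow> real) \<Rightarrow> 'v edge_fun \<Rightarrow> real" where
  "L2_norm E len f = sqrt (\<Sum>e\<in>E. \<integral>x. (f e x)\<^sup>2 \<partial>lebesgue_on {0..len e})"

definition ae_equal ::
    "('v \<times> 'v) set \<Rightarrow> ('v \<times> 'v \<Rightarrow> real) \<Rightarrow> 'v edge_fun \<Rightarrow> 'v edge_fun \<Rightarrow> bool" where
  "ae_equal E len f g \<longleftrightarrow> (\<forall>e\<in>E. AE x in lebesgue_on {0..len e}. f e x = g e x)"


section \<open>The standard Laplace operator\<close>

text \<open>\<open>D\<close> is a finite set of non-overlapping compact intervals \<open>k = [Inf k, Sup k]\<close> in \<open>[a, b]\<close>.\<close>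

definition abs_continuous_on :: "real \<Rightarrow> real \<Rightarrow> (real \<Rightarrow> real) \<Rightarrow> bool" where
  "abs_continuous_on a b f \<longleftrightarrow>
     (\<forall>\<epsilon>>0. \<exists>\<delta>>0. \<forall>D. D division_of \<Union>D \<and> \<Union>D \<subseteq> {a..b} \<and> (\<Sum>k\<in>D. Sup k - Inf k) < \<delta> \<longrightarrow>
        (\<Sum>k\<in>D. \<bar>f (Sup k) - f (Inf k)\<bar>) < \<epsilon>)"

text \<open>The derivative along an edge is one-sided at the endpoints.\<close>

definition edge_deriv :: "('v \<times> 'v \<Rightarrow> real) \<Rightarrow> 'v edge_fun \<Rightarrow> 'v edge_fun" where
  "edge_deriv len f e x = vector_derivative (f e) (at x within {0..len e})"

text \<open>
  A member of the maximal domain is an \<open>L\<^sup>2\<close> class with a (unique) continuous representative on the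
  edges, and that representative is used here. The first condition fixes its irrelevant
  values off the graph, so that distinct functions in the domain are distinct elements of \<open>L\<^sup>2\<close>.
  The second derivative exists almost everywhere, because \<open>edge_deriv len f e\<close> is absolutely
  continuous; its arbitrary values on the remaining null set do not matter.
\<close>

definition maximal_domain :: "('v \<times> 'v) set \<Rightarrow> ('v \<times> 'v \<Rightarrow> real) \<Rightarrow> 'v edge_fun set" where
  "maximal_domain E len = {f \<in> L2_space E len.
     (\<forall>e x. e \<notin> E \<or> x \<notin> {0..len e} \<longrightarrow> f e x = 0) \<and>
     (\<forall>e\<in>E. abs_continuous_on 0 (len e) (f e) \<and>
            f e differentiable_on {0..len e} \<and>
            abs_continuous_on 0 (len e) (edge_deriv len f e)) \<and>
     edge_deriv len (edge_deriv len f) \<in> L2_space E len}"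

definition incident_edges :: "('v \<times> 'v) set \<Rightarrow> 'v \<Rightarrow> ('v \<times> 'v) set" where
  "incident_edges E v = {e \<in> E. fst e = v \<or> snd e = v}"

definition vertex_value ::
    "('v \<times> 'v \<Rightarrow> real) \<Rightarrow> 'v edge_fun \<Rightarrow> 'v \<Rightarrow> 'v \<times> 'v \<Rightarrow> real" where
  "vertex_value len f v e = (if fst e = v then f e 0 else f e (len e))"

definition outgoing_deriv ::
    "('v \<times> 'v \<Rightarrow> real) \<Rightarrow> 'v edge_fun \<Rightarrow> 'v \<Rightarrow> 'v \<times> 'v \<Rightarrow> real" where
  "outgoing_deriv len f v e =
     (if fst e = v then edge_deriv len f e 0 else - edge_deriv len f e (len e))"

definition standard_domain :: "('v \<times> 'v) set \<Rightarrow> ('v \<times> 'v \<Rightarrow> real) \<Rightarrow> 'v edge_fun set" where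
  "standard_domain E len = {f \<in> maximal_domain E len. \<forall>v.
     (\<forall>e\<in>incident_edges E v. \<forall>e'\<in>incident_edges E v.
        vertex_value len f v e = vertex_value len f v e') \<and>
     (\<Sum>e\<in>incident_edges E v. outgoing_deriv len f v e) = 0}"

definition laplace :: "('v \<times> 'v \<Rightarrow> real) \<Rightarrow> 'v edge_fun \<Rightarrow> 'v edge_fun" where
  "laplace len f = (\<lambda>e x. - edge_deriv len (edge_deriv len f) e x)"

definition laplace_minus :: "('v \<times> 'v \<Rightarrow> real) \<Rightarrow> real \<Rightarrow> 'v edge_fun \<Rightarrow> 'v edge_fun" where
  "laplace_minus len z f = (\<lambda>e x. laplace len f e x - z * f e x)"


section \<open>Spectrum and multiplicity\<close>

text \<open>
  \<open>L\<^sup>2(\<Gamma>)\<close> is a real Hilbert space here, so the spectrum is taken in the reals. \<open>z\<close> is in the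
  resolvent set if \<open>L - z\<close> is a bijection from the domain onto \<open>L\<^sup>2(\<Gamma>)\<close> with bounded inverse.
\<close>

definition resolvent_set :: "('v \<times> 'v) set \<Rightarrow> ('v \<times> 'v \<Rightarrow> real) \<Rightarrow> real set" where
  "resolvent_set E len = {z.
     (\<forall>g\<in>L2_space E len. \<exists>!f. f \<in> standard_domain E len \<and>
        ae_equal E len (laplace_minus len z f) g) \<and>
     (\<exists>C. \<forall>f\<in>standard_domain E len.
        L2_norm E len f \<le> C * L2_norm E len (laplace_minus len z f))}"

definition laplace_spectrum :: "('v \<times> 'v) set \<Rightarrow> ('v \<times> 'v \<Rightarrow> real) \<Rightarrow> real set" where
  "laplace_spectrum E len = - resolvent_set E len"

definition eigenspace :: "('v \<times> 'v) set \<Rightarrow> ('v \<times> 'v \<Rightarrow> real) \<Rightarrow> real \<Rightarrow> 'v edge_fun set" where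
  "eigenspace E len z = {f \<in> standard_domain E len.
     ae_equal E len (laplace len f) (\<lambda>e x. z * f e x)}"

text \<open>
  The dimension is taken in the real vector space of all edge functions; it is \<open>0\<close> for the zero
  space and, by the library's convention, also for infinite-dimensional spaces.
\<close>

definition laplace_multiplicity :: "('v \<times> 'v) set \<Rightarrow> ('v \<times> 'v \<Rightarrow> real) \<Rightarrow> real \<Rightarrow> nat" where
  "laplace_multiplicity E len z =
     vector_space.dim (\<lambda>c (f :: 'v edge_fun) e x. c * f e x) (eigenspace E len z)"

end

theory Submission
  imports Defs
begin

text \<open>
  On an edge of length \<open>l\<close> every solution of \<open>- f'' - z f = g\<close> is given by variation of constants from
  \<open>f(0)\<close> and \<open>f'(0)\<close>; here the regularity of the maximal domain requires that absolutely continuous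
  functions are differentiable almost everywhere and satisfy the fundamental theorem of calculus,
  which is proved with Vitali coverings and Henstock gauges. The vertex conditions thereby turn
  \<open>(L - z) f = g\<close> into a square linear system for the vertex values and the initial slopes on the
  edges, so that the spectrum consists of the \<open>z\<close> for which the system is singular, and the eigenspace
  is isomorphic to its kernel. If \<open>sin (\<surd>z l) \<noteq> 0\<close>, the slopes can be eliminated and
  Kirchhoff's condition becomes \<open>Z \<phi> = cos (\<surd>z l) \<phi>\<close>. If \<open>cos (\<surd>z l) = \<epsilon> = \<plusminus>1\<close>, the kernel
  splits into the \<open>\<phi>\<close> with \<open>\<phi>(u) = \<epsilon> \<phi>(v)\<close> on all edges and a space of signed flows, whose
  dimension is \<open>N - n\<close> plus that of the former by rank-nullity.
\<close>

section \<open>Absolutely continuous functions\<close>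

text \<open>Two obstacles shape the proof. The edge equation is required only almost everywhere,
  even for eigenfunctions, so a priori f' could grow like Cantor's function without any trace in
  f''; only the fundamental theorem for absolutely continuous functions excludes this and makes
  initial data determine a solution. Secondly, when sin (\<surd>z l) = 0 a multiple of sin (\<surd>z
  x) vanishes at both ends of an edge. Vertex values alone would lose the eigenfunctions that vanish
  at all vertices, so the initial slopes stay unknowns beside them. With the slopes kept, one
  finite-dimensional endomorphism serves every real z, and its injectivity decides solvability,
  uniqueness and boundedness of the inverse together. The point z = 0 belongs to the case in which
  slopes can be eliminated, because the solution with initial data (0, 1) is then x, which equals l
  at the far end. Negative z are excluded because cosh exceeds 1 while no eigenvalue of Z
  does.\<close>

definition ac_modulus :: "real \<Rightarrow> real \<Rightarrow> (real \<Rightarrow> real) \<Rightarrow> real \<Rightarrow> real \<Rightarrow> bool" where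
  "ac_modulus a b F \<epsilon> \<delta> \<longleftrightarrow>
     (\<forall>D. D division_of \<Union>D \<and> \<Union>D \<subseteq> {a..b} \<and> (\<Sum>k\<in>D. Sup k - Inf k) < \<delta> \<longrightarrow>
        (\<Sum>k\<in>D. \<bar>F (Sup k) - F (Inf k)\<bar>) < \<epsilon>)"

lemma ac_modulusD:
  assumes "ac_modulus a b F \<epsilon> \<delta>"
    and "D division_of \<Union>D" "\<Union>D \<subseteq> {a..b}" "(\<Sum>k\<in>D. Sup k - Inf k) < \<delta>"
  shows "(\<Sum>k\<in>D. \<bar>F (Sup k) - F (Inf k)\<bar>) < \<epsilon>"
  using assms unfolding ac_modulus_def by blast

lemma abs_continuous_on_iff:
  "abs_continuous_on a b F \<longleftrightarrow> (\<forall>\<epsilon>>0. \<exists>\<delta>>0. ac_modulus a b F \<epsilon> \<delta>)"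
  unfolding abs_continuous_on_def ac_modulus_def ..

lemma division_of_realE:
  fixes D :: "real set set"
  assumes "D division_of S" "S \<subseteq> {a..b}" "k \<in> D"
  obtains u v where "k = {u..v}" "u \<le> v" "a \<le> u" "v \<le> b" "Inf k = u" "Sup k = v"
proof -
  obtain u v where k: "k = cbox u v"
    using assms division_ofD(4) by blast
  have "k \<noteq> {}" "k \<subseteq> {a..b}"
    using assms division_ofD(2,3) by blast+
  with k show ?thesis
    by (intro that[of u v]) auto
qed

lemma abs_continuous_on_cong:
  assumes "\<And>x. x \<in> {a..b} \<Longrightarrow> F x = G x" "abs_continuous_on a b F"
  shows "abs_continuous_on a b G"
  unfolding abs_continuous_on_iff
proof (intro allI impI)
  fix \<epsilon> :: real assume "0 < \<epsilon>"
  then obtain \<delta> where \<delta>: "0 < \<delta>" "ac_modulus a b F \<epsilon> \<delta>"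
    using assms(2) unfolding abs_continuous_on_iff by blast
  have "(\<Sum>k\<in>D. \<bar>G (Sup k) - G (Inf k)\<bar>) < \<epsilon>"
    if D: "D division_of \<Union>D" "\<Union>D \<subseteq> {a..b}" "(\<Sum>k\<in>D. Sup k - Inf k) < \<delta>" for D
  proof -
    have "(\<Sum>k\<in>D. \<bar>G (Sup k) - G (Inf k)\<bar>) = (\<Sum>k\<in>D. \<bar>F (Sup k) - F (Inf k)\<bar>)"
    proof (rule sum.cong[OF refl])
      fix k assume "k \<in> D"
      then obtain u v where "u \<le> v" "a \<le> u" "v \<le> b" "Inf k = u" "Sup k = v"
        using division_of_realE[OF D(1,2)] by metis
      then have "F (Inf k) = G (Inf k)" "F (Sup k) = G (Sup k)"
        by (auto intro!: assms(1))
      then show "\<bar>G (Sup k) - G (Inf k)\<bar> = \<bar>F (Sup k) - F (Inf k)\<bar>" by simp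
    qed
    with ac_modulusD[OF \<delta>(2) D] show ?thesis by simp
  qed
  with \<delta>(1) show "\<exists>\<delta>>0. ac_modulus a b G \<epsilon> \<delta>" unfolding ac_modulus_def by blast
qed

text \<open>A single closure principle for sums, differences and products: the increments of each
  are controlled by those of the two given functions, with C coming from boundedness in the case of
  the product.\<close>

lemma abs_continuous_on_if_increment_bound:
  assumes F: "abs_continuous_on a b F" and G: "abs_continuous_on a b G" and "0 < C"
    and bound: "\<And>u v. a \<le> u \<Longrightarrow> u \<le> v \<Longrightarrow> v \<le> b \<Longrightarrow> \<bar>H v - H u\<bar> \<le> C * (\<bar>F v - F u\<bar> + \<bar>G v - G u\<bar>)"
  shows "abs_continuous_on a b H"
  unfolding abs_continuous_on_iff
proof (intro allI impI)
  fix \<epsilon> :: real assume "0 < \<epsilon>"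
  then have \<epsilon>: "0 < \<epsilon> / (2 * C)" using \<open>0 < C\<close> by simp
  obtain \<delta>1 where \<delta>1: "0 < \<delta>1"
    "ac_modulus a b F (\<epsilon> / (2 * C)) \<delta>1"
    using F \<epsilon> unfolding abs_continuous_on_iff by blast
  obtain \<delta>2 where \<delta>2: "0 < \<delta>2"
    "ac_modulus a b G (\<epsilon> / (2 * C)) \<delta>2"
    using G \<epsilon> unfolding abs_continuous_on_iff by blast
  have "(\<Sum>k\<in>D. \<bar>H (Sup k) - H (Inf k)\<bar>) < \<epsilon>"
    if D: "D division_of \<Union>D" "\<Union>D \<subseteq> {a..b}" "(\<Sum>k\<in>D. Sup k - Inf k) < min \<delta>1 \<delta>2" for D
  proof -
    have "(\<Sum>k\<in>D. \<bar>H (Sup k) - H (Inf k)\<bar>)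
        \<le> (\<Sum>k\<in>D. C * (\<bar>F (Sup k) - F (Inf k)\<bar> + \<bar>G (Sup k) - G (Inf k)\<bar>))"
    proof (rule sum_mono)
      fix k assume "k \<in> D"
      then obtain u v where "u \<le> v" "a \<le> u" "v \<le> b" "Inf k = u" "Sup k = v"
        using division_of_realE[OF D(1,2)] by metis
      then show "\<bar>H (Sup k) - H (Inf k)\<bar> \<le> C * (\<bar>F (Sup k) - F (Inf k)\<bar> + \<bar>G (Sup k) - G (Inf k)\<bar>)"
        using bound[of u v] by auto
    qed
    also have "\<dots> = C * ((\<Sum>k\<in>D. \<bar>F (Sup k) - F (Inf k)\<bar>) + (\<Sum>k\<in>D. \<bar>G (Sup k) - G (Inf k)\<bar>))"
      by (simp add: sum_distrib_left sum.distrib distrib_left)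
    also have "\<dots> < C * (\<epsilon> / (2 * C) + \<epsilon> / (2 * C))"
      using ac_modulusD[OF \<delta>1(2) D(1,2)] ac_modulusD[OF \<delta>2(2) D(1,2)] D(3) \<open>0 < C\<close>
      by (intro mult_strict_left_mono add_strict_mono) auto
    also have "\<dots> = \<epsilon>" using \<open>0 < C\<close> by (simp add: field_simps)
    finally show ?thesis .
  qed
  with \<delta>1(1) \<delta>2(1) show "\<exists>\<delta>>0. ac_modulus a b H \<epsilon> \<delta>"
    by (intro exI[of _ "min \<delta>1 \<delta>2"]) (auto simp: ac_modulus_def)
qed

lemma abs_continuous_on_imp_continuous_on:
  assumes "abs_continuous_on a b F"
  shows "continuous_on {a..b} F"
  unfolding continuous_on_iff
proof (intro ballI allI impI)
  fix x \<epsilon> :: real assume x: "x \<in> {a..b}" and "0 < \<epsilon>"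
  then obtain \<delta> where \<delta>: "0 < \<delta>" "ac_modulus a b F \<epsilon> \<delta>"
    using assms unfolding abs_continuous_on_iff by blast
  have "dist (F y) (F x) < \<epsilon>" if y: "y \<in> {a..b}" "dist y x < \<delta>" for y
  proof -
    let ?k = "{min x y..max x y}"
    have "{?k} division_of \<Union>{?k}"
      using division_of_self[of "min x y" "max x y"] by auto
    moreover have "Sup ?k = max x y" "Inf ?k = min x y" by auto
    ultimately have "\<bar>F (max x y) - F (min x y)\<bar> < \<epsilon>"
      using ac_modulusD[OF \<delta>(2), of "{?k}"] x y by (auto simp: dist_real_def)
    then show ?thesis by (auto simp: dist_real_def min_def max_def split: if_splits)
  qed
  with \<delta>(1) show "\<exists>d>0. \<forall>x'\<in>{a..b}. dist x' x < d \<longrightarrow> dist (F x') (F x) < \<epsilon>" unfolding ac_modulus_def by blast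
qed

lemma abs_continuous_on_add:
  assumes "abs_continuous_on a b F" "abs_continuous_on a b G"
  shows "abs_continuous_on a b (\<lambda>x. F x + G x)"
  by (rule abs_continuous_on_if_increment_bound[OF assms zero_less_one]) auto

lemma abs_continuous_on_diff:
  assumes "abs_continuous_on a b F" "abs_continuous_on a b G"
  shows "abs_continuous_on a b (\<lambda>x. F x - G x)"
  by (rule abs_continuous_on_if_increment_bound[OF assms zero_less_one]) auto

lemma abs_continuous_on_mult:
  assumes F: "abs_continuous_on a b F" and G: "abs_continuous_on a b G"
  shows "abs_continuous_on a b (\<lambda>x. F x * G x)"
proof -
  have "bounded (F ` {a..b} \<union> G ` {a..b})"
    using assms by (auto intro!: compact_imp_bounded compact_continuous_image
        abs_continuous_on_imp_continuous_on)
  then obtain C where C: "0 < C" "\<And>x. x \<in> {a..b} \<Longrightarrow> \<bar>F x\<bar> \<le> C" "\<And>x. x \<in> {a..b} \<Longrightarrow> \<bar>G x\<bar> \<le> C"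
    by (auto simp: bounded_pos)
  show ?thesis
  proof (rule abs_continuous_on_if_increment_bound[OF F G C(1)])
    fix u v assume "a \<le> u" "u \<le> v" "v \<le> b"
    then have "\<bar>G v\<bar> \<le> C" "\<bar>F u\<bar> \<le> C" using C by auto
    moreover have "F v * G v - F u * G u = G v * (F v - F u) + F u * (G v - G u)"
      by (simp add: algebra_simps)
    then have "\<bar>F v * G v - F u * G u\<bar> \<le> \<bar>G v\<bar> * \<bar>F v - F u\<bar> + \<bar>F u\<bar> * \<bar>G v - G u\<bar>"
      by (metis abs_mult abs_triangle_ineq)
    ultimately show "\<bar>F v * G v - F u * G u\<bar> \<le> C * (\<bar>F v - F u\<bar> + \<bar>G v - G u\<bar>)"
      by (smt (verit) distrib_left mult_right_mono)
  qed
qed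

section \<open>Indefinite integrals of square-integrable functions\<close>

lemma sum_integral_division_le:
  fixes h :: "real \<Rightarrow> real"
  assumes "h integrable_on {a..b}" "\<And>x. x \<in> {a..b} \<Longrightarrow> 0 \<le> h x"
    and D: "D division_of \<Union>D" "\<Union>D \<subseteq> {a..b}"
  shows "(\<Sum>k\<in>D. integral k h) \<le> integral {a..b} h"
proof -
  obtain q where q: "D \<subseteq> q" "q division_of cbox a b"
    using partial_division_extend_interval[of D a b] D by auto
  have "(\<Sum>k\<in>D. integral k h) \<le> (\<Sum>k\<in>q. integral k h)"
  proof (rule sum_mono2)
    fix k assume "k \<in> q - D"
    then have "k \<subseteq> {a..b}" using q by auto
    \<comment> \<open>A non-integrable \<open>h\<close> would have integral 0 on \<open>k\<close> by
      convention, so both cases give nonnegativity.\<close>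
    with assms(2) show "0 \<le> integral k h"
      by (cases "h integrable_on k") (auto intro!: integral_nonneg assms(2) simp: not_integrable_integral)
  qed (use q in auto)
  also have "\<dots> = integral {a..b} h"
    using integral_combine_division_topdown[of h "{a..b}" q] assms(1) q by simp
  finally show ?thesis .
qed

text \<open>Young's inequality \<open>\<bar>h\<bar> \<le> \<tau> h\<^sup>2 + 1 / (4 \<tau>)\<close> takes the place of Cauchy-Schwarz.\<close>

lemma abs_continuous_on_indefinite_integral:
  fixes F h :: "real \<Rightarrow> real"
  assumes F: "\<And>u v. a \<le> u \<Longrightarrow> u \<le> v \<Longrightarrow> v \<le> b \<Longrightarrow> (h has_integral F v - F u) {u..v}"
    and h2: "(\<lambda>x. (h x)\<^sup>2) integrable_on {a..b}"
  shows "abs_continuous_on a b F"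
  unfolding abs_continuous_on_iff
proof (intro allI impI)
  fix \<epsilon> :: real assume "0 < \<epsilon>"
  define I where "I = integral {a..b} (\<lambda>x. (h x)\<^sup>2)"
  have "0 \<le> I" unfolding I_def by (intro integral_nonneg h2) auto
  \<comment> \<open>This makes the square term at most \<epsilon> / 2, the summand 1 guarding
    against I = 0. The length bound 2 \<tau> \<epsilon> below then makes the other term of Young's
    inequality less than \<epsilon> / 2.\<close>
  define \<tau> where "\<tau> = \<epsilon> / (2 * (I + 1))"
  have "0 < \<tau>" "\<tau> * I \<le> \<epsilon> / 2"
    using \<open>0 < \<epsilon>\<close> \<open>0 \<le> I\<close> by (auto simp: \<tau>_def field_simps)
  have "(\<Sum>k\<in>D. \<bar>F (Sup k) - F (Inf k)\<bar>) < \<epsilon>"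
    if D: "D division_of \<Union>D" "\<Union>D \<subseteq> {a..b}" "(\<Sum>k\<in>D. Sup k - Inf k) < 2 * \<tau> * \<epsilon>" for D
  proof -
    have "(\<Sum>k\<in>D. \<bar>F (Sup k) - F (Inf k)\<bar>)
        \<le> (\<Sum>k\<in>D. \<tau> * integral k (\<lambda>x. (h x)\<^sup>2) + (Sup k - Inf k) / (4 * \<tau>))"
    proof (rule sum_mono)
      fix k assume "k \<in> D"
      then obtain u v where k: "k = {u..v}" "u \<le> v" and uv: "a \<le> u" "v \<le> b" and k': "Inf k = u" "Sup k = v"
        using division_of_realE[OF D(1,2)] by metis
      have int2: "(\<lambda>x. (h x)\<^sup>2) integrable_on {u..v}"
        using uv by (auto intro: integrable_on_subinterval[OF h2])
      have young: "\<bar>h x\<bar> \<le> \<tau> * (h x)\<^sup>2 + 1 / (4 * \<tau>)" for x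
      proof -
        have "0 \<le> (2 * \<tau> * \<bar>h x\<bar> - 1)\<^sup>2" by simp
        then show ?thesis using \<open>0 < \<tau>\<close>
          by (simp add: field_simps power2_eq_square)
      qed
      have "norm (integral {u..v} h) \<le> integral {u..v} (\<lambda>x. \<tau> * (h x)\<^sup>2 + 1 / (4 * \<tau>))"
        using F[of u v] uv k(2) young
        by (intro integral_norm_bound_integral integrable_add integrable_on_mult_right int2)
          (auto simp: integrable_on_def)
      also have "\<dots> = \<tau> * integral {u..v} (\<lambda>x. (h x)\<^sup>2) + (v - u) / (4 * \<tau>)"
        using int2 k(2) by (subst integral_add) (auto intro: integrable_on_mult_right)
      finally show "\<bar>F (Sup k) - F (Inf k)\<bar> \<le> \<tau> * integral k (\<lambda>x. (h x)\<^sup>2) + (Sup k - Inf k) / (4 * \<tau>)"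
        using F[of u v] uv k k' by (simp add: integral_unique)
    qed
    also have "\<dots> = \<tau> * (\<Sum>k\<in>D. integral k (\<lambda>x. (h x)\<^sup>2)) + (\<Sum>k\<in>D. Sup k - Inf k) / (4 * \<tau>)"
      by (simp add: sum.distrib sum_distrib_left sum_divide_distrib)
    also have "\<dots> < \<tau> * I + (2 * \<tau> * \<epsilon>) / (4 * \<tau>)"
      using sum_integral_division_le[OF h2 _ D(1,2)] D(3) \<open>0 < \<tau>\<close>
      by (intro add_le_less_mono mult_left_mono divide_strict_right_mono) (auto simp: I_def)
    also have "\<dots> \<le> \<epsilon>" using \<open>\<tau> * I \<le> \<epsilon> / 2\<close> \<open>0 < \<tau>\<close> by simp
    finally show ?thesis .
  qed
  moreover have "0 < 2 * \<tau> * \<epsilon>" using \<open>0 < \<tau>\<close> \<open>0 < \<epsilon>\<close> by simp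
  ultimately show "\<exists>\<delta>>0. ac_modulus a b F \<epsilon> \<delta>" unfolding ac_modulus_def by blast
qed

lemma abs_continuous_on_C1:
  fixes F h :: "real \<Rightarrow> real"
  assumes "\<And>x. (F has_real_derivative h x) (at x)" "continuous_on UNIV h"
  shows "abs_continuous_on a b F"
proof (rule abs_continuous_on_indefinite_integral)
  show "(h has_integral F v - F u) {u..v}" if "u \<le> v" for u v
    using that assms(1)
    by (intro fundamental_theorem_of_calculus)
      (auto simp: has_real_derivative_iff_has_vector_derivative[symmetric] intro: DERIV_subset)
  show "(\<lambda>x. (h x)\<^sup>2) integrable_on {a..b}"
    by (intro integrable_continuous_real continuous_intros continuous_on_subset[OF assms(2)]) auto
qed

lemma lmeasurable_outer_open:
  fixes S :: "real set"
  assumes S: "S \<in> lmeasurable" and "0 < e"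
  obtains G where "open G" "S \<subseteq> G" "G \<in> lmeasurable" "measure lebesgue G < measure lebesgue S + e"
proof -
  obtain T where T: "open T" "S \<subseteq> T" "T - S \<in> lmeasurable" "emeasure lebesgue (T - S) < ennreal e"
    using sets_lebesgue_outer_open[OF fmeasurableD[OF S] assms(2)] by blast
  have TS: "T = S \<union> (T - S)" using T(2) by auto
  then have "T \<in> lmeasurable" using S T(3) by (metis fmeasurable.Un)
  moreover have "measure lebesgue T < measure lebesgue S + e"
  proof -
    have "measure lebesgue T \<le> measure lebesgue S + measure lebesgue (T - S)"
      by (subst TS, rule measure_Un_le) (use S T(3) in auto)
    also have "\<dots> < measure lebesgue S + e"
      using T(4) assms(2) by (simp add: emeasure_eq_measure2 T(3) ennreal_less_iff)
    finally show ?thesis .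
  qed
  ultimately show ?thesis using T that by blast
qed

section \<open>Vitali coverings by intervals\<close>

text \<open>The condition of a Vitali cover at x, with \<open>R\<close> marking the admissible
  intervals [u, v]. The point may lie anywhere in the interval, its ends included, so one-sided
  difference quotients are among those considered.\<close>

definition finely_covered :: "(real \<Rightarrow> real \<Rightarrow> bool) \<Rightarrow> real \<Rightarrow> bool" where
  "finely_covered R x \<longleftrightarrow> (\<forall>d>0. \<exists>u v. R u v \<and> u \<le> x \<and> x \<le> v \<and> u < v \<and> v - u < d)"

text \<open>Vitali's theorem yields a countable disjoint family that misses only a null part of S. A
  finite subfamily carries almost all of its measure, and both the tail and the null part fit into a
  small open W. Finiteness is essential, since moduli of absolute continuity and gauges speak about
  finite families; S itself may be non-measurable.\<close>

lemma vitali_finite_cover: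
  fixes S U :: "real set"
  assumes U: "open U" "U \<in> lmeasurable" "S \<subseteq> U" and "0 < \<eta>"
    and fine: "\<And>x. x \<in> S \<Longrightarrow> finely_covered R x"
  obtains D W where "D division_of \<Union>D" "pairwise disjnt D" "\<Union>D \<subseteq> U"
    "\<forall>k\<in>D. \<exists>u v. k = {u..v} \<and> u < v \<and> R u v"
    "open W" "W \<in> lmeasurable" "measure lebesgue W < \<eta>" "S \<subseteq> \<Union>D \<union> W"
proof -
  define K where "K = {(u, v). R u v \<and> u < v \<and> {u..v} \<subseteq> U}"
  \<comment> \<open>On the line a compact interval is a closed ball about its midpoint, which is the
    form needed for the covering theorem.\<close>
  define m where "m = (\<lambda>(u, v). (u + v) / 2 :: real)"
  define r where "r = (\<lambda>(u, v). (v - u) / 2 :: real)"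
  have cb: "cball (m i) (r i) = {fst i..snd i}" for i
    by (cases i) (auto simp: m_def r_def cball_eq_atLeastAtMost field_simps)
  have rpos: "\<And>i. i \<in> K \<Longrightarrow> 0 < r i" by (auto simp: K_def r_def)
  have ex: "\<exists>i. i \<in> K \<and> x \<in> cball (m i) (r i) \<and> r i < d" if "x \<in> S" "0 < d" for x d
  proof -
    obtain e where e: "0 < e" "cball x e \<subseteq> U"
      using U \<open>x \<in> S\<close> open_contains_cball by blast
    obtain u v where uv: "R u v" "u \<le> x" "x \<le> v" "u < v" "v - u < min e d"
      using fine[OF \<open>x \<in> S\<close>] e(1) \<open>0 < d\<close> unfolding finely_covered_def by (metis min_less_iff_conj)
    then have "{u..v} \<subseteq> cball x e" by (auto simp: dist_real_def)
    with e uv show ?thesis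
      unfolding cb by (intro exI[of _ "(u, v)"]) (auto simp: K_def r_def)
  qed
  obtain C where C: "countable C" "C \<subseteq> K"
    "pairwise (\<lambda>i j. disjnt (cball (m i) (r i)) (cball (m j) (r j))) C"
    "negligible (S - (\<Union>i\<in>C. cball (m i) (r i)))"
    by (rule Vitali_covering_theorem_cballs[OF rpos ex]) auto
  define I where "I = (\<lambda>i. {fst i..snd i :: real})"
  have neg: "negligible (S - \<Union>(I ` C))" using C(4) by (simp add: cb I_def)
  have sub: "J \<subseteq> U" if "J \<in> I ` C" for J using that C(2) unfolding K_def I_def by fastforce
  have meas: "J \<in> lmeasurable" if "J \<in> I ` C" for J using that by (auto simp: I_def)
  have UC: "\<Union>(I ` C) \<in> lmeasurable"
  proof (rule fmeasurableI2[OF U(2)])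
    show "\<Union>(I ` C) \<in> sets lebesgue"
      using C(1) meas by (intro sets.countable_UN'') (auto simp: fmeasurableD)
  qed (use sub in auto)
  have bound: "measure lebesgue (\<Union>D') \<le> measure lebesgue U" if "D' \<subseteq> I ` C" "finite D'" for D'
    using that sub meas U(2) by (intro measure_mono_fmeasurable) (auto simp: fmeasurableD intro!: sets.finite_Union)
  obtain D where D: "D \<subseteq> I ` C" "finite D" "measure lebesgue (\<Union>(I ` C)) - \<eta> / 2 < measure lebesgue (\<Union>D)"
    using measure_countable_Union_approachable[of "I ` C" "\<eta> / 2" "measure lebesgue U"]
      C(1) \<open>0 < \<eta>\<close> meas bound by (metis countable_image half_gt_zero)
  have pw: "pairwise disjnt (I ` C)"
    using C(3) by (auto simp: pairwise_def cb I_def)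
  have UD: "\<Union>D \<in> lmeasurable" using D meas by (intro fmeasurable.finite_Union) auto
  have rest: "measure lebesgue (\<Union>(I ` C) - \<Union>D) < \<eta> / 2"
    using D measurable_measure_Diff[OF UC, of "\<Union>D"] UD by (simp add: Union_mono fmeasurableD)
  have restm: "\<Union>(I ` C) - \<Union>D \<in> lmeasurable" using UC UD by (simp add: fmeasurable.Diff fmeasurableD)
  define M where "M = (S - \<Union>(I ` C)) \<union> (\<Union>(I ` C) - \<Union>D)"
  have M: "M \<in> lmeasurable" "measure lebesgue M < \<eta> / 2"
  proof -
    have n: "S - \<Union>(I ` C) \<in> lmeasurable" "measure lebesgue (S - \<Union>(I ` C)) = 0"
      using neg by (auto simp: negligible_imp_measurable negligible_imp_measure0)
    then show "M \<in> lmeasurable" unfolding M_def using restm by (simp add: fmeasurable.Un)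
    show "measure lebesgue M < \<eta> / 2" unfolding M_def
      using measure_Un_le[of "S - \<Union>(I ` C)" lebesgue "\<Union>(I ` C) - \<Union>D"] n restm rest by (simp add: fmeasurableD)
  qed
  obtain W where W: "open W" "M \<subseteq> W" "W \<in> lmeasurable" "measure lebesgue W < measure lebesgue M + \<eta> / 2"
    using lmeasurable_outer_open[OF M(1), of "\<eta> / 2"] \<open>0 < \<eta>\<close> by auto
  show ?thesis
  proof (rule that[of D W])
    show pD: "pairwise disjnt D" using pw D(1) by (meson pairwise_subset)
    show "D division_of \<Union>D"
      unfolding division_of_def
    proof (intro conjI ballI impI)
      fix k assume "k \<in> D"
      then obtain i where i: "k = I i" "i \<in> C" using D(1) by auto
      then show "k \<noteq> {}" "\<exists>a b. k = cbox a b" using C(2) by (auto simp: I_def K_def)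
      show "k \<subseteq> \<Union>D" using \<open>k \<in> D\<close> by auto
    next
      fix k1 k2 assume "k1 \<in> D" "k2 \<in> D" "k1 \<noteq> k2"
      then have "disjnt k1 k2" using pD by (auto simp: pairwise_def)
      then show "interior k1 \<inter> interior k2 = {}"
        using interior_subset by (auto simp: disjnt_def)
    qed (use D in auto)
    show "\<Union>D \<subseteq> U" using D(1) sub by auto
    show "\<forall>k\<in>D. \<exists>u v. k = {u..v} \<and> u < v \<and> R u v"
      using D(1) C(2) by (force simp: I_def K_def)
    show "S \<subseteq> \<Union>D \<union> W" using W(2) by (auto simp: M_def)
  qed (use W M in auto)
qed

section \<open>Finite divisions: measure, telescoping and leftovers\<close>

lemma division_of_nonempty_cbox:
  assumes "D division_of S" "k \<in> D"
  obtains u v where "k = cbox u v" "k \<noteq> {}"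
  using division_ofD(3,4)[OF assms] by blast

lemma measure_division_real:
  fixes D :: "real set set"
  assumes "D division_of \<Union>D"
  shows "\<Union>D \<in> lmeasurable" "measure lebesgue (\<Union>D) = (\<Sum>k\<in>D. Sup k - Inf k)"
proof -
  show "\<Union>D \<in> lmeasurable"
    using assms by (intro fmeasurable.finite_Union) (auto dest: division_ofD(1,4))
  have "measure lebesgue (\<Union>D) = (\<Sum>k\<in>D. measure lebesgue k)"
  proof (rule measure_negligible_finite_Union)
    show "pairwise (\<lambda>S T. negligible (S \<inter> T)) D"
    proof (rule pairwiseI)
      fix S T assume "S \<in> D" "T \<in> D" "S \<noteq> T"
      have "convex S" "convex T"
        using division_of_nonempty_cbox[OF assms \<open>S \<in> D\<close>] division_of_nonempty_cbox[OF assms \<open>T \<in> D\<close>]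
        by (metis convex_box(1))+
      moreover have "interior (S \<inter> T) = {}"
        using division_ofD(5)[OF assms \<open>S \<in> D\<close> \<open>T \<in> D\<close> \<open>S \<noteq> T\<close>] by (simp add: interior_Int)
      ultimately show "negligible (S \<inter> T)" by (simp add: negligible_convex_interior convex_Int)
    qed
  qed (use assms in \<open>auto dest: division_ofD(1,4)\<close>)
  also have "\<dots> = (\<Sum>k\<in>D. Sup k - Inf k)"
  proof (rule sum.cong[OF refl])
    fix k assume k: "k \<in> D"
    then obtain u v where "k = cbox u v" "k \<noteq> {}" using division_of_nonempty_cbox[OF assms] by blast
    then show "measure lebesgue k = Sup k - Inf k" by auto
  qed
  finally show "measure lebesgue (\<Union>D) = (\<Sum>k\<in>D. Sup k - Inf k)" .
qed

text \<open>The finite family from \<open>vitali_finite_cover\<close> covers S up to a set of small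
  measure, so a length bound for all admissible divisions inside U bounds the outer measure of S.
  The relation \<open>R\<close> may change with \<epsilon>; this allows steepness thresholds and
  gauges to depend on the accuracy.\<close>

lemma negligible_if_finely_covered:
  fixes S U :: "real set"
  assumes U: "open U" "U \<in> lmeasurable" "S \<subseteq> U"
    and fine: "\<And>\<epsilon>. 0 < \<epsilon> \<Longrightarrow> \<exists>R. (\<forall>x\<in>S. finely_covered R x) \<and>
      (\<forall>D. D division_of \<Union>D \<longrightarrow> \<Union>D \<subseteq> U \<longrightarrow> (\<forall>k\<in>D. \<exists>u v. k = {u..v} \<and> u < v \<and> R u v) \<longrightarrow>
        (\<Sum>k\<in>D. Sup k - Inf k) \<le> \<epsilon>)"
  shows "negligible S"
  unfolding negligible_outer_le
proof (intro allI impI)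
  fix e :: real assume "0 < e"
  then obtain R where R: "\<And>x. x \<in> S \<Longrightarrow> finely_covered R x"
    "\<And>D. D division_of \<Union>D \<Longrightarrow> \<Union>D \<subseteq> U \<Longrightarrow> (\<forall>k\<in>D. \<exists>u v. k = {u..v} \<and> u < v \<and> R u v) \<Longrightarrow>
        (\<Sum>k\<in>D. Sup k - Inf k) \<le> e / 2"
    using fine[of "e / 2"] by auto
  obtain D W where D: "D division_of \<Union>D" "\<Union>D \<subseteq> U"
    "\<forall>k\<in>D. \<exists>u v. k = {u..v} \<and> u < v \<and> R u v"
    and W: "W \<in> lmeasurable" "measure lebesgue W < e / 2" "S \<subseteq> \<Union>D \<union> W"
    by (rule vitali_finite_cover[OF U _ R(1), of "e / 2"]) (use \<open>0 < e\<close> in auto)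
  have "measure lebesgue (\<Union>D \<union> W) \<le> measure lebesgue (\<Union>D) + measure lebesgue W"
    using measure_division_real[OF D(1)] W by (intro measure_Un_le) (auto simp: fmeasurableD)
  also have "\<dots> \<le> e"
    using measure_division_real(2)[OF D(1)] R(2)[OF D(1,2)] D(3) W(2) by auto
  finally show "\<exists>T. S \<subseteq> T \<and> T \<in> lmeasurable \<and> measure lebesgue T \<le> e"
    using W measure_division_real(1)[OF D(1)] by (intro exI[of _ "\<Union>D \<union> W"]) (auto simp: fmeasurable.Un)
qed

text \<open>Telescoping; the left endpoints serve as tags so that
  \<open>additive_tagged_division_1\<close> applies.\<close>

lemma division_increments:
  fixes F :: "real \<Rightarrow> real"
  assumes "q division_of {a..b}" "a \<le> b"
  shows "(\<Sum>k\<in>q. F (Sup k) - F (Inf k)) = F b - F a"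
proof -
  have Inf: "Inf k \<in> k" if "k \<in> q" for k
  proof -
    obtain u v where "k = cbox u v" "k \<noteq> {}" using division_of_nonempty_cbox[OF assms(1) \<open>k \<in> q\<close>] by blast
    then show ?thesis by auto
  qed
  define p where "p = (\<lambda>k. (Inf k, k)) ` q"
  have "p tagged_division_of {a..b}"
    unfolding tagged_division_of
  proof (intro conjI allI impI)
    show "finite p" using assms(1) by (auto simp: p_def)
    fix x k assume xk: "(x, k) \<in> p"
    then show "x \<in> k" using Inf by (auto simp: p_def)
    show "k \<subseteq> {a..b}" "\<exists>a b. k = cbox a b"
      using xk division_ofD(2,4)[OF assms(1)] by (auto simp: p_def)
  next
    fix x1 k1 x2 k2 assume "(x1, k1) \<in> p \<and> (x2, k2) \<in> p \<and> (x1, k1) \<noteq> (x2, k2)"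
    then show "interior k1 \<inter> interior k2 = {}"
      using division_ofD(5)[OF assms(1)] by (auto simp: p_def)
  next
    show "\<Union>{k. \<exists>x. (x, k) \<in> p} = {a..b}"
      using division_ofD(6)[OF assms(1)] by (simp add: p_def image_iff)
  qed
  from additive_tagged_division_1[OF assms(2) this, of F]
  show ?thesis
    by (simp add: p_def sum.reindex inj_on_def)
qed

text \<open>Inside each \<open>k\<close> of \<open>D\<close> the members of \<open>D'\<close> are
  completed to a division of \<open>k\<close>; as \<open>D\<close> is disjoint, these divisions do
  not share members. One leftover \<open>r\<close> serves all F, because it is used both for
  lengths, with F the identity, and for the increments of the function studied.\<close>

lemma division_leftover:
  fixes D D' :: "real set set"
  assumes D: "D division_of \<Union>D" "pairwise disjnt D" and D': "D' division_of \<Union>D'"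
    and sub: "\<And>k'. k' \<in> D' \<Longrightarrow> \<exists>k\<in>D. k' \<subseteq> k"
  obtains r where "r division_of \<Union>r" "\<Union>r \<subseteq> \<Union>D"
    "\<forall>F :: real \<Rightarrow> real. (\<Sum>k\<in>D. F (Sup k) - F (Inf k)) =
       (\<Sum>k\<in>D'. F (Sup k) - F (Inf k)) + (\<Sum>k\<in>r. F (Sup k) - F (Inf k))"
proof -
  define P where "P k = {k' \<in> D'. k' \<subseteq> k}" for k
  have "\<exists>q. P k \<subseteq> q \<and> q division_of k" if "k \<in> D" for k
  proof -
    obtain u v where k: "k = cbox u v" using division_of_nonempty_cbox[OF D(1) \<open>k \<in> D\<close>] by blast
    have "P k division_of \<Union>(P k)" by (rule division_of_subset[OF D']) (auto simp: P_def)
    moreover have "\<Union>(P k) \<subseteq> cbox u v" unfolding k[symmetric] by (auto simp: P_def)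
    ultimately obtain q where "P k \<subseteq> q" "q division_of cbox u v"
      by (rule partial_division_extend_interval)
    then show ?thesis unfolding k by blast
  qed
  then obtain q where q: "\<And>k. k \<in> D \<Longrightarrow> P k \<subseteq> q k" "\<And>k. k \<in> D \<Longrightarrow> q k division_of k"
    by metis
  have fin: "finite D" using D by auto
  define Q where "Q = (\<Union>k\<in>D. q k)"
  have disj: "q k \<inter> q k' = {}" if "k \<in> D" "k' \<in> D" "k \<noteq> k'" for k k'
  proof -
    have "k \<inter> k' = {}" using D(2) that by (auto simp: pairwise_def disjnt_def)
    then show ?thesis using division_ofD(2,3)[OF q(2)] that by blast
  qed
  have Q: "Q division_of \<Union>Q"
    unfolding division_of_def
  proof (intro conjI ballI impI)
    show "finite Q" using fin q(2) by (auto simp: Q_def)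
  next
    fix k assume "k \<in> Q"
    then obtain j where "j \<in> D" "k \<in> q j" by (auto simp: Q_def)
    then show "k \<noteq> {}" "\<exists>a b. k = cbox a b" using division_ofD(3,4)[OF q(2)] by blast+
    show "k \<subseteq> \<Union>Q" using \<open>k \<in> Q\<close> by auto
  next
    fix k1 k2 assume "k1 \<in> Q" "k2 \<in> Q" "k1 \<noteq> k2"
    then obtain i j where ij: "i \<in> D" "j \<in> D" "k1 \<in> q i" "k2 \<in> q j" by (auto simp: Q_def)
    show "interior k1 \<inter> interior k2 = {}"
    proof (cases "i = j")
      case True
      then show ?thesis using division_ofD(5)[OF q(2)[OF ij(1)]] ij \<open>k1 \<noteq> k2\<close> by auto
    next
      case False
      then have "i \<inter> j = {}" using D(2) ij by (auto simp: pairwise_def disjnt_def)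
      then show ?thesis
        using division_ofD(2)[OF q(2)] ij interior_subset by blast
    qed
  qed auto
  have "D' \<subseteq> Q" using sub q(1) by (fastforce simp: Q_def P_def)
  show ?thesis
  proof (rule that[of "Q - D'"])
    show "Q - D' division_of \<Union>(Q - D')" by (rule division_of_subset[OF Q]) auto
    show "\<Union>(Q - D') \<subseteq> \<Union>D" using division_ofD(2)[OF q(2)] by (auto simp: Q_def)
    show "\<forall>F :: real \<Rightarrow> real. (\<Sum>k\<in>D. F (Sup k) - F (Inf k)) =
       (\<Sum>k\<in>D'. F (Sup k) - F (Inf k)) + (\<Sum>k\<in>Q - D'. F (Sup k) - F (Inf k))"
    proof
      fix F :: "real \<Rightarrow> real"
      have "(\<Sum>k\<in>D. F (Sup k) - F (Inf k)) = (\<Sum>k\<in>D. \<Sum>k'\<in>q k. F (Sup k') - F (Inf k'))"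
      proof (rule sum.cong[OF refl])
        fix k assume "k \<in> D"
        then obtain u v where k: "k = cbox u v" "k \<noteq> {}" using division_of_nonempty_cbox[OF D(1)] by blast
        then show "F (Sup k) - F (Inf k) = (\<Sum>k'\<in>q k. F (Sup k') - F (Inf k'))"
          using division_increments[of "q k" u v F] q(2)[OF \<open>k \<in> D\<close>] by auto
      qed
      also have "\<dots> = (\<Sum>k'\<in>Q. F (Sup k') - F (Inf k'))"
        unfolding Q_def using fin q(2) disj by (intro sum.UNION_disjoint[symmetric]) auto
      also have "\<dots> = (\<Sum>k\<in>D'. F (Sup k) - F (Inf k)) + (\<Sum>k\<in>Q - D'. F (Sup k) - F (Inf k))"
        using \<open>D' \<subseteq> Q\<close> Q by (subst sum.subset_diff[of D' Q]) auto
      finally show "(\<Sum>k\<in>D. F (Sup k) - F (Inf k)) =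
         (\<Sum>k\<in>D'. F (Sup k) - F (Inf k)) + (\<Sum>k\<in>Q - D'. F (Sup k) - F (Inf k))" .
    qed
  qed
qed

section \<open>Differentiability almost everywhere\<close>

lemma finely_covered_mono:
  assumes "finely_covered R x" "\<And>u v. R u v \<Longrightarrow> u < v \<Longrightarrow> R' u v"
  shows "finely_covered R' x"
  using assms unfolding finely_covered_def by meson

text \<open>On divisions shorter than \<delta> the increments add up to less than 1, so intervals
  with slope above 1 / \<epsilon> have total length at most \<epsilon>.\<close>

lemma negligible_steep_points:
  assumes F: "abs_continuous_on a b F"
  shows "negligible {x \<in> {a<..<b}. \<forall>M. finely_covered (\<lambda>u v. \<bar>F v - F u\<bar> > M * (v - u)) x}"
    (is "negligible ?S")
proof -
  obtain \<delta> where \<delta>: "0 < \<delta>" "ac_modulus a b F 1 \<delta>"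
    using F zero_less_one unfolding abs_continuous_on_iff by blast
  show ?thesis
  proof (subst locally_negligible_alt, rule ballI)
    fix x assume "x \<in> ?S"
    \<comment> \<open>A ball of radius \<delta> / 4 has length \<delta> / 2, so every division
      inside it is short enough for \<delta>. Being negligible is a local property, hence such balls
      suffice.\<close>
    define U where "U = ball x (\<delta> / 4) \<inter> {a<..<b}"
    have "x \<in> U" using \<open>x \<in> ?S\<close> \<delta>(1) by (auto simp: U_def)
    have meas: "measure lebesgue U < \<delta>"
    proof -
      have "measure lebesgue U \<le> measure lebesgue {x - \<delta> / 4..x + \<delta> / 4}"
        by (rule measure_mono_fmeasurable) (auto simp: U_def dist_real_def abs_if split: if_splits)
      then show ?thesis using \<delta>(1) by simp
    qed
    have "negligible (?S \<inter> U)"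
    proof (rule negligible_if_finely_covered[of U])
      show "open U" "U \<in> lmeasurable"
        unfolding U_def by (auto intro!: bounded_set_imp_lmeasurable bounded_Int)
    next
      fix \<epsilon> :: real assume "0 < \<epsilon>"
      show "\<exists>R. (\<forall>x\<in>?S \<inter> U. finely_covered R x) \<and>
        (\<forall>D. D division_of \<Union>D \<longrightarrow> \<Union>D \<subseteq> U \<longrightarrow> (\<forall>k\<in>D. \<exists>u v. k = {u..v} \<and> u < v \<and> R u v) \<longrightarrow>
          (\<Sum>k\<in>D. Sup k - Inf k) \<le> \<epsilon>)"
      proof (intro exI[of _ "\<lambda>u v. \<bar>F v - F u\<bar> > (1 / \<epsilon>) * (v - u)"] conjI allI impI)
        fix D assume D: "D division_of \<Union>D" "\<Union>D \<subseteq> U"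
          "\<forall>k\<in>D. \<exists>u v. k = {u..v} \<and> u < v \<and> \<bar>F v - F u\<bar> > (1 / \<epsilon>) * (v - u)"
        have "(\<Sum>k\<in>D. Sup k - Inf k) \<le> measure lebesgue U"
          unfolding measure_division_real(2)[OF D(1), symmetric]
          using measure_division_real(1)[OF D(1)] D(2)
          by (intro measure_mono_fmeasurable)
            (auto simp: U_def fmeasurableD intro!: bounded_set_imp_lmeasurable bounded_Int)
        then have lt: "(\<Sum>k\<in>D. \<bar>F (Sup k) - F (Inf k)\<bar>) < 1"
          using meas D(2) by (intro ac_modulusD[OF \<delta>(2) D(1)]) (auto simp: U_def)
        have "(\<Sum>k\<in>D. Sup k - Inf k) \<le> (\<Sum>k\<in>D. \<epsilon> * \<bar>F (Sup k) - F (Inf k)\<bar>)"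
        proof (rule sum_mono)
          fix k assume "k \<in> D"
          then obtain u v where "k = {u..v}" "u < v" "\<bar>F v - F u\<bar> > (1 / \<epsilon>) * (v - u)"
            using D(3) by blast
          then show "Sup k - Inf k \<le> \<epsilon> * \<bar>F (Sup k) - F (Inf k)\<bar>"
            using \<open>0 < \<epsilon>\<close> by (simp add: field_simps)
        qed
        also have "\<dots> = \<epsilon> * (\<Sum>k\<in>D. \<bar>F (Sup k) - F (Inf k)\<bar>)" by (simp add: sum_distrib_left)
        also have "\<dots> \<le> \<epsilon>" using lt \<open>0 < \<epsilon>\<close> by simp
        finally show "(\<Sum>k\<in>D. Sup k - Inf k) \<le> \<epsilon>" .
      qed blast
    qed blast
    then show "\<exists>U. openin (top_of_set ?S) U \<and> x \<in> U \<and> negligible U"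
      using \<open>x \<in> U\<close> \<open>x \<in> ?S\<close> by (intro exI[of _ "?S \<inter> U"]) (auto simp: U_def intro!: openin_open_Int)
  qed
qed

text \<open>
  The classical argument for derivates of opposite behaviour: a disjoint family \<open>D\<close> on which \<open>F\<close>
  decreases is refined by a family \<open>D'\<close> on which it has slope at least \<open>q\<close>; both carry almost the
  outer measure \<open>s\<close>, so the leftover of \<open>D\<close> is short and absolute continuity makes the total
  increment over it small.
\<close>

lemma negligible_opposite_slopes:
  assumes F: "abs_continuous_on a b F" and "0 < q" and S: "S \<subseteq> {a<..<b}"
    and down: "\<And>x. x \<in> S \<Longrightarrow> finely_covered (\<lambda>u v. F v - F u \<le> 0) x"
    and up: "\<And>x. x \<in> S \<Longrightarrow> finely_covered (\<lambda>u v. F v - F u \<ge> q * (v - u)) x"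
  shows "negligible S"
proof -
  \<comment> \<open>S is not known to be measurable, so \<open>s\<close> is its outer measure, taken
    over open neighbourhoods inside the interval.\<close>
  define A where "A = {m. \<exists>U. open U \<and> U \<in> lmeasurable \<and> S \<subseteq> U \<and> U \<subseteq> {a<..<b} \<and> m = measure lebesgue U}"
  define s where "s = Inf A"
  have ne: "A \<noteq> {}" using S unfolding A_def by (auto intro!: exI[of _ "{a<..<b}"] bounded_set_imp_lmeasurable)
  have bdd: "bdd_below A" unfolding A_def by (intro bdd_belowI[of _ 0]) auto
  have outer: "s \<le> measure lebesgue M" if M: "M \<in> lmeasurable" "S \<subseteq> M" for M
  proof (rule field_le_epsilon)
    fix e :: real assume "0 < e"
    obtain G where G: "open G" "M \<subseteq> G" "G \<in> lmeasurable" "measure lebesgue G < measure lebesgue M + e"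
      using lmeasurable_outer_open[OF M(1) \<open>0 < e\<close>] by blast
    have GI: "G \<inter> {a<..<b} \<in> lmeasurable" using G by (auto intro!: fmeasurable_Int_fmeasurable)
    then have "measure lebesgue (G \<inter> {a<..<b}) \<in> A"
      unfolding A_def using G S M by (auto intro!: exI[of _ "G \<inter> {a<..<b}"])
    then have "s \<le> measure lebesgue (G \<inter> {a<..<b})" unfolding s_def by (rule cInf_lower[OF _ bdd])
    also have "\<dots> \<le> measure lebesgue G" using G GI by (intro measure_mono_fmeasurable) (auto simp: fmeasurableD)
    finally show "s \<le> measure lebesgue M + e" using G(4) by simp
  qed
  have "q * s \<le> e" if "0 < e" for e
  proof -
    obtain \<delta> where \<delta>: "0 < \<delta>" "ac_modulus a b F (e / 2) \<delta>"
      using F \<open>0 < e\<close> unfolding abs_continuous_on_iff by (meson half_gt_zero)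
    \<comment> \<open>U exceeds s by less than \<eta> and each of the two coverings loses less than
      \<eta>. The leftover of \<open>D\<close> is therefore shorter than 3 \<eta>, which must stay
      below \<delta>, and q s exceeds q times the length of \<open>D'\<close> by at most 2 q \<eta>,
      which must stay below e / 2.\<close>
    define \<eta> where "\<eta> = min (\<delta> / 4) (e / (6 * q))"
    have "0 < \<eta>" using \<delta>(1) \<open>0 < e\<close> \<open>0 < q\<close> by (simp add: \<eta>_def)
    have \<eta>: "4 * \<eta> \<le> \<delta>" "3 * q * \<eta> \<le> e / 2"
    proof -
      show "4 * \<eta> \<le> \<delta>" by (simp add: \<eta>_def)
      have "\<eta> \<le> e / (6 * q)" by (simp add: \<eta>_def)
      then have "3 * q * \<eta> \<le> 3 * q * (e / (6 * q))" using \<open>0 < q\<close> by (intro mult_left_mono) auto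
      then show "3 * q * \<eta> \<le> e / 2" using \<open>0 < q\<close> by simp
    qed
    obtain m where "m \<in> A" "m < s + \<eta>"
      using cInf_lessD[OF ne, of "s + \<eta>"] \<open>0 < \<eta>\<close> unfolding s_def by auto
    then obtain U where U: "open U" "U \<in> lmeasurable" "S \<subseteq> U" "U \<subseteq> {a<..<b}" "measure lebesgue U < s + \<eta>"
      unfolding A_def by auto
    obtain D W where D: "D division_of \<Union>D" "pairwise disjnt D" "\<Union>D \<subseteq> U"
      and Ddown: "\<forall>k\<in>D. \<exists>u v. k = {u..v} \<and> u < v \<and> F v - F u \<le> 0"
      and "open W" and W: "W \<in> lmeasurable" "measure lebesgue W < \<eta>" "S \<subseteq> \<Union>D \<union> W"
      by (rule vitali_finite_cover[OF U(1-3) \<open>0 < \<eta>\<close> down])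
    \<comment> \<open>Covering inside the interiors, and not inside the union of \<open>D\<close>,
      places each interval of \<open>D'\<close> within a single member of \<open>D\<close>.\<close>
    define V where "V = (\<Union>k\<in>D. interior k)"
    have "V \<subseteq> U" unfolding V_def using D(3) interior_subset by blast
    with U(2) have Vm: "V \<in> lmeasurable"
      by (rule fmeasurableI2) (auto simp: V_def intro!: borel_open lborelD)
    have "S \<inter> V \<subseteq> V" "open V" by (auto simp: V_def)
    obtain D' W' where D': "D' division_of \<Union>D'" "pairwise disjnt D'" "\<Union>D' \<subseteq> V"
      and Dup: "\<forall>k\<in>D'. \<exists>u v. k = {u..v} \<and> u < v \<and> F v - F u \<ge> q * (v - u)"
      and "open W'" and W': "W' \<in> lmeasurable" "measure lebesgue W' < \<eta>" "S \<inter> V \<subseteq> \<Union>D' \<union> W'"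
      by (rule vitali_finite_cover[OF \<open>open V\<close> Vm \<open>S \<inter> V \<subseteq> V\<close> \<open>0 < \<eta>\<close> up[OF IntD1]])
    have sub: "\<exists>k\<in>D. k' \<subseteq> k" if "k' \<in> D'" for k'
    proof -
      obtain u v where k': "k' = {u..v}" "u < v" using Dup \<open>k' \<in> D'\<close> by blast
      have "k' \<subseteq> V" using D'(3) that by auto
      then obtain k where k: "k \<in> D" "u \<in> interior k" using k' by (force simp: V_def)
      \<comment> \<open>The interiors are disjoint open sets that together cover the connected
        \<open>k'\<close>, so it cannot leave the one that it meets.\<close>
      have "k' \<subseteq> interior k"
      proof (rule ccontr)
        define Y where "Y = (\<Union>j\<in>D - {k}. interior j)"
        assume "\<not> k' \<subseteq> interior k"
        have "connected k'" unfolding k' by simp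
        moreover have "open (interior k)" "open Y" by (auto simp: Y_def)
        moreover have "k' \<subseteq> interior k \<union> Y" using \<open>k' \<subseteq> V\<close> by (auto simp: V_def Y_def)
        moreover have "interior k \<inter> Y \<inter> k' = {}"
          using division_ofD(5)[OF D(1) k(1)] by (auto simp: Y_def)
        moreover have "interior k \<inter> k' \<noteq> {}" using k k' by auto
        moreover have "Y \<inter> k' \<noteq> {}" using \<open>\<not> k' \<subseteq> interior k\<close> \<open>k' \<subseteq> interior k \<union> Y\<close> by auto
        ultimately show False using connectedD by metis
      qed
      then show ?thesis using k interior_subset by blast
    qed
    obtain r where r: "r division_of \<Union>r" "\<Union>r \<subseteq> \<Union>D"
      "\<forall>F :: real \<Rightarrow> real. (\<Sum>k\<in>D. F (Sup k) - F (Inf k)) =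
         (\<Sum>k\<in>D'. F (Sup k) - F (Inf k)) + (\<Sum>k\<in>r. F (Sup k) - F (Inf k))"
      by (rule division_leftover[OF D(1,2) D'(1) sub])
    \<comment> \<open>The endpoints lost in passing from \<open>D\<close> to the interiors form a
      null set.\<close>
    define B where "B = (\<Union>k\<in>D. k - interior k)"
    have "negligible (k - interior k)" if "k \<in> D" for k
    proof -
      obtain u v where "k = cbox u v" using division_of_nonempty_cbox[OF D(1) \<open>k \<in> D\<close>] by blast
      then show ?thesis using negligible_convex_frontier[of k] by (simp add: frontier_def)
    qed
    then have "negligible B"
      unfolding B_def using D(1) by (intro negligible_Union) auto
    have cover: "S \<subseteq> \<Union>D' \<union> (W \<union> (W' \<union> B))" using W(3) W'(3) by (fastforce simp: V_def B_def)
    have Bm: "B \<in> lmeasurable" "measure lebesgue B = 0"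
      using \<open>negligible B\<close> by (auto simp: negligible_imp_measurable negligible_imp_measure0)
    have "s \<le> measure lebesgue (\<Union>D' \<union> (W \<union> (W' \<union> B)))"
      using measure_division_real(1)[OF D'(1)] W W' Bm cover by (intro outer) (auto intro!: fmeasurable.Un)
    also have "\<dots> \<le> measure lebesgue (\<Union>D') + (measure lebesgue W + (measure lebesgue W' + measure lebesgue B))"
      using measure_division_real(1)[OF D'(1)] W W' Bm
      by (intro order_trans[OF measure_Un_le] add_left_mono) (auto simp: fmeasurableD)
    finally have len': "s - 2 * \<eta> \<le> (\<Sum>k\<in>D'. Sup k - Inf k)"
      using W W' Bm measure_division_real(2)[OF D'(1)] by simp
    have "(\<Sum>k\<in>D. Sup k - Inf k) \<le> measure lebesgue U"
      unfolding measure_division_real(2)[OF D(1), symmetric]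
      using measure_division_real(1)[OF D(1)] D(3) U(2) by (intro measure_mono_fmeasurable) (auto simp: fmeasurableD)
    then have "(\<Sum>k\<in>r. Sup k - Inf k) < \<delta>"
      using r(3)[rule_format, of "\<lambda>x. x"] len' U(5) \<eta>(1) \<open>0 < \<eta>\<close> by simp
    moreover have "\<Union>r \<subseteq> {a..b}" using r(2) D(3) U(4) by fastforce
    ultimately have "(\<Sum>k\<in>r. \<bar>F (Sup k) - F (Inf k)\<bar>) < e / 2" by (intro ac_modulusD[OF \<delta>(2) r(1)])
    moreover have "\<bar>\<Sum>k\<in>r. F (Sup k) - F (Inf k)\<bar> \<le> (\<Sum>k\<in>r. \<bar>F (Sup k) - F (Inf k)\<bar>)" by (rule sum_abs)
    moreover have "(\<Sum>k\<in>D. F (Sup k) - F (Inf k)) \<le> 0"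
    proof (rule sum_nonpos)
      fix k assume "k \<in> D"
      then show "F (Sup k) - F (Inf k) \<le> 0" using Ddown by fastforce
    qed
    moreover have "q * (\<Sum>k\<in>D'. Sup k - Inf k) \<le> (\<Sum>k\<in>D'. F (Sup k) - F (Inf k))"
      unfolding sum_distrib_left
    proof (rule sum_mono)
      fix k assume "k \<in> D'"
      then show "q * (Sup k - Inf k) \<le> F (Sup k) - F (Inf k)" using Dup by fastforce
    qed
    ultimately have "q * (\<Sum>k\<in>D'. Sup k - Inf k) \<le> e / 2" using r(3)[rule_format, of F] by linarith
    moreover have "q * (s - 2 * \<eta>) \<le> q * (\<Sum>k\<in>D'. Sup k - Inf k)" using len' \<open>0 < q\<close> by simp
    moreover have "q * (s - 2 * \<eta>) = q * s - 2 * q * \<eta>" by (simp add: algebra_simps)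
    moreover have "0 < q * \<eta>" using \<open>0 < q\<close> \<open>0 < \<eta>\<close> by simp
    ultimately show "q * s \<le> e" using \<eta>(2) by simp
  qed
  then have "q * s \<le> 0" by (meson field_le_epsilon add_0 dense_ge)
  then have "s \<le> 0" using \<open>0 < q\<close> by (simp add: mult_le_0_iff)
  show ?thesis
    unfolding negligible_outer
  proof (intro allI impI)
    fix e :: real assume "0 < e"
    then obtain m where "m \<in> A" "m < e"
      using cInf_lessD[OF ne, of e] \<open>s \<le> 0\<close> unfolding s_def by auto
    then show "\<exists>T. S \<subseteq> T \<and> T \<in> lmeasurable \<and> measure lebesgue T < e" unfolding A_def by auto
  qed
qed

text \<open>Failure of a Vitali cover at x means that all sufficiently short intervals around x
  avoid the relation. The first hypothesis thus keeps the quotients bounded, and the second leaves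
  no rational gap between their lower and upper limits.\<close>

lemma has_derivative_if_not_finely_covered:
  fixes F :: "real \<Rightarrow> real"
  assumes steep: "\<not> finely_covered (\<lambda>u v. \<bar>F v - F u\<bar> > M * (v - u)) x"
    and slopes: "\<And>p q. p \<in> \<rat> \<Longrightarrow> q \<in> \<rat> \<Longrightarrow> p < q \<Longrightarrow>
      \<not> finely_covered (\<lambda>u v. F v - F u \<le> p * (v - u)) x \<or> \<not> finely_covered (\<lambda>u v. F v - F u \<ge> q * (v - u)) x"
  shows "\<exists>L. (F has_real_derivative L) (at x)"
proof -
  \<comment> \<open>\<open>near P\<close> says that P holds eventually for the difference quotients
    as the intervals around x shrink.\<close>
  define near where "near P \<longleftrightarrow> (\<exists>d>0. \<forall>u v. u \<le> x \<and> x \<le> v \<and> u < v \<and> v - u < d \<longrightarrow> P ((F v - F u) / (v - u)))"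
    for P :: "real \<Rightarrow> bool"
  have nearI: "near (\<lambda>y. \<not> P y)" if "\<not> finely_covered R x" "\<And>u v. u < v \<Longrightarrow> R u v \<longleftrightarrow> P ((F v - F u) / (v - u))" for P R
    using that unfolding finely_covered_def near_def by meson
  have near_conj: "near (\<lambda>y. P y \<and> Q y)" if PQ: "near P" "near Q" for P Q
  proof -
    obtain d e where "0 < d" "0 < e"
      "\<forall>u v. u \<le> x \<and> x \<le> v \<and> u < v \<and> v - u < d \<longrightarrow> P ((F v - F u) / (v - u))"
      "\<forall>u v. u \<le> x \<and> x \<le> v \<and> u < v \<and> v - u < e \<longrightarrow> Q ((F v - F u) / (v - u))"
      using PQ unfolding near_def by blast
    then show ?thesis unfolding near_def by (intro exI[of _ "min d e"]) auto
  qed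
  have near_ex: "\<exists>y. P y" if P: "near P" for P
  proof -
    obtain d where d: "0 < d"
      "\<forall>u v. u \<le> x \<and> x \<le> v \<and> u < v \<and> v - u < d \<longrightarrow> P ((F v - F u) / (v - u))"
      using P unfolding near_def by blast
    from d(2)[rule_format, of x "x + d / 2"] d(1) have "P ((F (x + d / 2) - F x) / (x + d / 2 - x))"
      by simp
    then show ?thesis by blast
  qed
  have near_mono: "near Q" if "near P" "\<And>y. P y \<Longrightarrow> Q y" for P Q
    using that unfolding near_def by blast
  have M: "near (\<lambda>y. \<not> \<bar>y\<bar> > M)"
    by (rule nearI[OF steep]) (auto simp: abs_divide field_simps)
  have pq: "near (\<lambda>y. \<not> y \<le> p) \<or> near (\<lambda>y. \<not> y \<ge> q)" if "p \<in> \<rat>" "q \<in> \<rat>" "p < q" for p q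
    using slopes[OF that]
  proof
    assume "\<not> finely_covered (\<lambda>u v. F v - F u \<le> p * (v - u)) x"
    then have "near (\<lambda>y. \<not> y \<le> p)" by (rule nearI) (simp add: pos_divide_le_eq)
    then show ?thesis ..
  next
    assume "\<not> finely_covered (\<lambda>u v. F v - F u \<ge> q * (v - u)) x"
    then have "near (\<lambda>y. \<not> y \<ge> q)" by (rule nearI) (simp add: pos_le_divide_eq)
    then show ?thesis ..
  qed
  \<comment> \<open>The supremum of the eventual lower bounds is the lower limit of the quotients;
    it will be the derivative.\<close>
  define A where "A = {p. near (\<lambda>y. p \<le> y)}"
  have bdd: "bdd_above A"
  proof (rule bdd_aboveI[of _ M])
    fix p assume "p \<in> A"
    then have "near (\<lambda>y. p \<le> y \<and> \<not> \<bar>y\<bar> > M)" unfolding A_def using M by (intro near_conj) auto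
    then show "p \<le> M" by (auto dest!: near_ex)
  qed
  have "near (\<lambda>y. - M \<le> y)" by (rule near_mono[OF M]) auto
  then have ne: "A \<noteq> {}" unfolding A_def by auto
  define L where "L = Sup A"
  have conv: "near (\<lambda>y. \<bar>y - L\<bar> < e)" if "0 < e" for e
  proof -
    obtain p where p: "p \<in> A" "L - e < p"
      using less_cSupD[OF ne, of "L - e"] \<open>0 < e\<close> unfolding L_def by auto
    \<comment> \<open>Gaps are excluded only between rationals, so two of them are placed between L
      and L + e. As \<open>p'\<close> exceeds L, the quotients are not eventually above
      \<open>p'\<close>; the alternative for \<open>p' < q'\<close> then keeps them eventually below
      \<open>q'\<close>.\<close>
    obtain p' where p': "p' \<in> \<rat>" "L < p'" "p' < L + e / 2" using Rats_dense_in_real[of L "L + e / 2"] \<open>0 < e\<close> by auto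
    obtain q' where q': "q' \<in> \<rat>" "p' < q'" "q' < L + e" using Rats_dense_in_real[of p' "L + e"] p' \<open>0 < e\<close> by auto
    have "p' \<notin> A" using p'(2) cSup_upper[OF _ bdd] unfolding L_def by force
    then have "\<not> near (\<lambda>y. \<not> y \<le> p')" using near_mono[of "\<lambda>y. \<not> y \<le> p'" "\<lambda>y. p' \<le> y"] unfolding A_def by auto
    then have "near (\<lambda>y. \<not> y \<ge> q')" using pq[OF p'(1) q'(1,2)] by blast
    moreover have "near (\<lambda>y. p \<le> y)" using p(1) by (simp add: A_def)
    ultimately have "near (\<lambda>y. \<not> y \<ge> q' \<and> p \<le> y)" by (rule near_conj)
    then show ?thesis by (rule near_mono) (use p(2) q'(3) in auto)
  qed
  have "((\<lambda>h. (F (x + h) - F x) / h) \<longlongrightarrow> L) (at 0)"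
    unfolding LIM_def
  proof (intro allI impI)
    fix e :: real assume "0 < e"
    then obtain d where d: "0 < d"
      "\<And>u v. u \<le> x \<Longrightarrow> x \<le> v \<Longrightarrow> u < v \<Longrightarrow> v - u < d \<Longrightarrow> \<bar>(F v - F u) / (v - u) - L\<bar> < e"
      using conv unfolding near_def by meson
    have "\<bar>(F (x + h) - F x) / h - L\<bar> < e" if "h \<noteq> 0" "\<bar>h\<bar> < d" for h
    proof (cases "0 < h")
      case True then show ?thesis using d(2)[of x "x + h"] that by auto
    next
      case False
      have "(F x - F (x + h)) / (x - (x + h)) = (F (x + h) - F x) / h"
        using that by (simp add: field_simps)
      then show ?thesis using d(2)[of "x + h" x] that False by auto
    qed
    with d(1) show "\<exists>s>0. \<forall>h. h \<noteq> 0 \<and> dist h 0 < s \<longrightarrow> dist ((F (x + h) - F x) / h) L < e"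
      by (auto simp: dist_real_def)
  qed
  then show ?thesis unfolding DERIV_def by blast
qed

text \<open>Subtracting p x turns slopes at most p and at least q into slopes at most 0 and at least
  q - p, the situation of \<open>negligible_opposite_slopes\<close>. Only countably many rational
  pairs occur, and the steep points are null as well.\<close>

theorem abs_continuous_on_differentiable_ae:
  assumes F: "abs_continuous_on a b F"
  shows "negligible {x \<in> {a<..<b}. \<not> (\<exists>L. (F has_real_derivative L) (at x))}"
proof -
  define T where "T = {x \<in> {a<..<b}. \<forall>M. finely_covered (\<lambda>u v. \<bar>F v - F u\<bar> > M * (v - u)) x}"
  define S where "S p q = {x \<in> {a<..<b}. finely_covered (\<lambda>u v. F v - F u \<le> p * (v - u)) x \<and>
      finely_covered (\<lambda>u v. F v - F u \<ge> q * (v - u)) x}" for p q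
  have negS: "negligible (S p q)" if "p < q" for p q
  proof (rule negligible_opposite_slopes[of a b "\<lambda>x. F x - p * x" "q - p"])
    show "abs_continuous_on a b (\<lambda>x. F x - p * x)"
      by (intro abs_continuous_on_diff F abs_continuous_on_C1[of _ "\<lambda>_. p"])
        (auto intro!: derivative_eq_intros)
    show "finely_covered (\<lambda>u v. F v - p * v - (F u - p * u) \<le> 0) x" if "x \<in> S p q" for x
      using that unfolding S_def by (auto elim!: finely_covered_mono simp: algebra_simps)
    show "finely_covered (\<lambda>u v. F v - p * v - (F u - p * u) \<ge> (q - p) * (v - u)) x" if "x \<in> S p q" for x
      using that unfolding S_def by (auto elim!: finely_covered_mono simp: algebra_simps)
  qed (use that in \<open>auto simp: S_def\<close>)
  define P where "P = {(p, q). p \<in> \<rat> \<and> q \<in> \<rat> \<and> p < (q :: real)}"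
  have "countable P" by (rule countable_subset[of _ "\<rat> \<times> \<rat>"]) (auto simp: P_def countable_rat)
  then have "negligible (\<Union>(p, q)\<in>P. S p q)"
    using negS by (intro negligible_countable_Union) (auto simp: P_def)
  then have "negligible (T \<union> (\<Union>(p, q)\<in>P. S p q))"
    using negligible_steep_points[OF F] unfolding T_def by (rule negligible_Un[rotated])
  then show ?thesis
  proof (rule negligible_subset)
    show "{x \<in> {a<..<b}. \<not> (\<exists>L. (F has_real_derivative L) (at x))} \<subseteq> T \<union> (\<Union>(p, q)\<in>P. S p q)"
    proof
      fix x assume x: "x \<in> {x \<in> {a<..<b}. \<not> (\<exists>L. (F has_real_derivative L) (at x))}"
      show "x \<in> T \<union> (\<Union>(p, q)\<in>P. S p q)"
      proof (rule ccontr)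
        assume no: "x \<notin> T \<union> (\<Union>(p, q)\<in>P. S p q)"
        then obtain M where "\<not> finely_covered (\<lambda>u v. \<bar>F v - F u\<bar> > M * (v - u)) x"
          using x unfolding T_def by auto
        then have "\<exists>L. (F has_real_derivative L) (at x)"
          by (rule has_derivative_if_not_finely_covered) (use no x in \<open>auto simp: P_def S_def\<close>)
        with x show False by blast
      qed
    qed
  qed
qed

section \<open>The fundamental theorem of calculus\<close>

text \<open>
  Henstock's gauge argument: tags outside the exceptional null set contribute little by
  differentiability, tags inside it because the intervals carrying them have small total length.
\<close>

theorem abs_continuous_on_has_integral:
  fixes F h :: "real \<Rightarrow> real"
  assumes F: "abs_continuous_on a b F" and "a \<le> b" and N: "negligible N"
    and deriv: "\<And>x. x \<in> {a..b} - N \<Longrightarrow> (F has_real_derivative h x) (at x within {a..b})"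
  shows "(h has_integral F b - F a) {a..b}"
proof -
  \<comment> \<open>With the integrand set to 0 on N, a tag in N contributes only the increment of F
    over its interval.\<close>
  define h0 where "h0 x = (if x \<in> N then 0 else h x)" for x
  have "(h0 has_integral F b - F a) {a..b}"
    unfolding has_integral_real
  proof (intro allI impI)
    fix e :: real assume "0 < e"
    obtain \<delta> where \<delta>: "0 < \<delta>" "ac_modulus a b F (e / 2) \<delta>"
      using F \<open>0 < e\<close> unfolding abs_continuous_on_iff by (meson half_gt_zero)
    obtain G where G: "open G" "N \<subseteq> G" "G \<in> lmeasurable" "measure lebesgue G < \<delta>"
      using lmeasurable_outer_open[of N \<delta>] N \<delta>(1)
      by (auto simp: negligible_imp_measurable negligible_imp_measure0)
    define e' where "e' = e / (2 * (b - a + 1))"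
    have "0 < e'" "e' * (b - a) < e / 2" using \<open>0 < e\<close> \<open>a \<le> b\<close> by (auto simp: e'_def field_simps)
    have "\<exists>d>0. \<forall>y\<in>{a..b}. \<bar>y - x\<bar> < d \<longrightarrow> \<bar>F y - F x - h x * (y - x)\<bar> \<le> e' * \<bar>y - x\<bar>"
      if "x \<in> {a..b} - N" for x
    proof -
      have "(F has_derivative (*) (h x)) (at x within {a..b})"
        using deriv[OF that] by (simp add: has_field_derivative_def)
      then show ?thesis
        using \<open>0 < e'\<close> by (auto simp: has_derivative_within_alt)
    qed
    then obtain d where d: "\<And>x. x \<in> {a..b} - N \<Longrightarrow> 0 < d x"
      "\<And>x y. x \<in> {a..b} - N \<Longrightarrow> y \<in> {a..b} \<Longrightarrow> \<bar>y - x\<bar> < d x \<Longrightarrow> \<bar>F y - F x - h x * (y - x)\<bar> \<le> e' * \<bar>y - x\<bar>"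
      by metis
    define \<gamma> where "\<gamma> x = (if x \<in> N then G else if x \<in> {a..b} then ball x (d x) else UNIV)" for x
    have "gauge \<gamma>"
      using G d(1) unfolding gauge_def by (auto simp: \<gamma>_def)
    have "norm ((\<Sum>(x, k)\<in>p. measure lborel k *\<^sub>R h0 x) - (F b - F a)) < e"
      if p: "p tagged_division_of {a..b}" "\<gamma> fine p" for p
    proof -
      define \<Delta> where "\<Delta> k = F (Sup k) - F (Inf k)" for k
      have fin: "finite p" using p(1) by auto
      have int: "\<exists>u v. k = {u..v} \<and> u \<le> x \<and> x \<le> v \<and> a \<le> u \<and> v \<le> b" if "(x, k) \<in> p" for x k
      proof -
        obtain u v where k: "k = cbox u v" using tagged_division_ofD(4)[OF p(1) \<open>(x, k) \<in> p\<close>] by blast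
        moreover have "x \<in> k" "k \<subseteq> {a..b}" using tagged_division_ofD(2,3)[OF p(1) that] by auto
        ultimately show ?thesis by (intro exI[of _ u] exI[of _ v]) auto
      qed
      define q where "q = {(x, k) \<in> p. x \<in> N}"
      have "q \<subseteq> p" by (auto simp: q_def)
      have "F b - F a = (\<Sum>(x, k)\<in>p. \<Delta> k)"
        using additive_tagged_division_1[OF \<open>a \<le> b\<close> p(1), of F] by (simp add: \<Delta>_def)
      then have "(\<Sum>(x, k)\<in>p. measure lborel k *\<^sub>R h0 x) - (F b - F a) = (\<Sum>(x, k)\<in>p. measure lborel k * h0 x - \<Delta> k)"
        by (simp add: sum_subtractf case_prod_unfold)
      also have "\<dots> = (\<Sum>(x, k)\<in>p - q. measure lborel k * h0 x - \<Delta> k) + (\<Sum>(x, k)\<in>q. measure lborel k * h0 x - \<Delta> k)"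
        using sum.subset_diff[OF \<open>q \<subseteq> p\<close> fin] by simp
      finally have eq: "norm ((\<Sum>(x, k)\<in>p. measure lborel k *\<^sub>R h0 x) - (F b - F a)) \<le>
          \<bar>\<Sum>(x, k)\<in>p - q. measure lborel k * h0 x - \<Delta> k\<bar> + \<bar>\<Sum>(x, k)\<in>q. measure lborel k * h0 x - \<Delta> k\<bar>"
        by simp
      have "\<bar>\<Sum>(x, k)\<in>p - q. measure lborel k * h0 x - \<Delta> k\<bar> \<le> (\<Sum>(x, k)\<in>p - q. e' * measure lborel k)"
      proof (rule sum_abs[THEN order_trans], rule sum_mono, clarify)
        fix x k assume xk: "(x, k) \<in> p" "(x, k) \<notin> q"
        then have "x \<notin> N" by (auto simp: q_def)
        obtain u v where k: "k = {u..v}" "u \<le> x" "x \<le> v" "a \<le> u" "v \<le> b" using int[OF xk(1)] by blast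
        have x: "x \<in> {a..b} - N" using k \<open>x \<notin> N\<close> by auto
        have "k \<subseteq> \<gamma> x" using p(2) xk(1) by (auto simp: fine_def)
        then have "k \<subseteq> ball x (d x)" using x by (simp add: \<gamma>_def)
        moreover have "u \<in> k" "v \<in> k" using k by auto
        ultimately have "u \<in> ball x (d x)" "v \<in> ball x (d x)" by blast+
        then have "\<bar>F u - F x - h x * (u - x)\<bar> \<le> e' * \<bar>u - x\<bar>" "\<bar>F v - F x - h x * (v - x)\<bar> \<le> e' * \<bar>v - x\<bar>"
          using k d(2)[OF x, of u] d(2)[OF x, of v] by (auto simp: dist_real_def)
        \<comment> \<open>The straddle estimate: the tag lies between u and v, so the errors at the
          two ends add up to a multiple of v - u.\<close>
        then have "\<bar>(F u - F x - h x * (u - x)) - (F v - F x - h x * (v - x))\<bar> \<le> e' * (x - u) + e' * (v - x)"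
          using k by simp
        then show "\<bar>measure lborel k * h0 x - \<Delta> k\<bar> \<le> e' * measure lborel k"
          using k \<open>x \<notin> N\<close> by (simp add: \<Delta>_def h0_def algebra_simps)
      qed
      also have "\<dots> \<le> (\<Sum>(x, k)\<in>p. e' * measure lborel k)"
        using fin \<open>0 < e'\<close> by (intro sum_mono2) auto
      also have "\<dots> = e' * (b - a)"
        using additive_content_tagged_division[of p a b] p(1) \<open>a \<le> b\<close>
        by (simp add: sum_distrib_left[symmetric] case_prod_unfold)
      finally have out: "\<bar>\<Sum>(x, k)\<in>p - q. measure lborel k * h0 x - \<Delta> k\<bar> \<le> e' * (b - a)" .
      have tq: "q tagged_partial_division_of {a..b}"
        using p(1) \<open>q \<subseteq> p\<close> by (meson tagged_division_of_def tagged_partial_division_subset)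
      have dq: "snd ` q division_of \<Union>(snd ` q)" by (rule partial_division_of_tagged_division[OF tq])
      have "\<bar>\<Sum>(x, k)\<in>q. measure lborel k * h0 x - \<Delta> k\<bar> \<le> (\<Sum>(x, k)\<in>q. \<bar>\<Delta> k\<bar>)"
        by (rule sum_abs[THEN order_trans], rule sum_mono) (auto simp: q_def h0_def)
      \<comment> \<open>Passing from tagged intervals to intervals requires a summand that vanishes
        on every degenerate box, including the empty one, where \<open>Inf\<close> and
        \<open>Sup\<close> carry no information.\<close>
      also have "\<dots> = (\<Sum>(x, k)\<in>q. if k = {} then 0 else \<bar>\<Delta> k\<bar>)"
        using int \<open>q \<subseteq> p\<close> by (intro sum.cong) fastforce+
      also have "\<dots> = (\<Sum>k\<in>snd ` q. if k = {} then 0 else \<bar>\<Delta> k\<bar>)"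
      proof (rule sum.over_tagged_division_lemma[OF tagged_partial_division_of_Union_self[OF tq]])
        fix u v :: real assume "box u v = {}"
        then have "v \<le> u" by simp
        then show "(if cbox u v = {} then 0 else \<bar>\<Delta> (cbox u v)\<bar>) = 0"
          by (cases "u = v") (auto simp: \<Delta>_def)
      qed
      also have "\<dots> = (\<Sum>k\<in>snd ` q. \<bar>\<Delta> k\<bar>)"
        using int \<open>q \<subseteq> p\<close> by (intro sum.cong) fastforce+
      also have "\<dots> < e / 2"
        unfolding \<Delta>_def
      proof (rule ac_modulusD[OF \<delta>(2) dq])
        have "k \<subseteq> G" if "k \<in> snd ` q" for k
        proof -
          obtain x where "(x, k) \<in> p" "x \<in> N" using \<open>k \<in> snd ` q\<close> by (auto simp: q_def)
          then show ?thesis using p(2) by (fastforce simp: fine_def \<gamma>_def)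
        qed
        then have "\<Union>(snd ` q) \<subseteq> G" by blast
        then have "measure lebesgue (\<Union>(snd ` q)) \<le> measure lebesgue G"
          using measure_division_real(1)[OF dq] G(3) by (intro measure_mono_fmeasurable) (auto simp: fmeasurableD)
        then show "(\<Sum>k\<in>snd ` q. Sup k - Inf k) < \<delta>" using G(4) measure_division_real(2)[OF dq] by simp
        show "\<Union>(snd ` q) \<subseteq> {a..b}" using int \<open>q \<subseteq> p\<close> by fastforce
      qed
      finally show ?thesis using eq out \<open>e' * (b - a) < e / 2\<close> by linarith
    qed
    with \<open>gauge \<gamma>\<close> show "\<exists>\<gamma>. gauge \<gamma> \<and> (\<forall>\<D>. \<D> tagged_division_of {a..b} \<and> \<gamma> fine \<D> \<longrightarrow>
        norm ((\<Sum>(x, k)\<in>\<D>. measure lborel k *\<^sub>R h0 x) - (F b - F a)) < e)"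
      by (intro exI[of _ \<gamma>]) simp
  qed
  then show ?thesis
    by (rule has_integral_spike[OF N, rotated]) (auto simp: h0_def)
qed

text \<open>Where the derivative fails, arbitrarily short intervals have an error above r times
  their length, for some r = 1 / (n + 1). Tagged by such points, these intervals fall under
  Henstock's lemma, which bounds the sum of their errors by r \<epsilon> and hence their total
  length by \<epsilon>.\<close>

theorem integral_has_derivative_ae:
  fixes g :: "real \<Rightarrow> real"
  assumes g: "g integrable_on {a..b}"
  shows "negligible {x \<in> {a<..<b}. \<not> ((\<lambda>u. integral {a..u} g) has_real_derivative g x) (at x)}"
    (is "negligible ?S")
proof -
  define G where "G u = integral {a..u} g" for u
  define bad where "bad r x u v \<longleftrightarrow> r * (v - u) < \<bar>G v - G u - g x * (v - u)\<bar>" for r x u v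
  define S where "S r = {x \<in> {a<..<b}. finely_covered (bad r x) x}" for r
  have Gint: "G v - G u = integral {u..v} g" if "a \<le> u" "u \<le> v" "v \<le> b" for u v
  proof -
    have "g integrable_on {a..v}" using that by (auto intro: integrable_on_subinterval[OF g])
    then have "integral {a..u} g + integral {u..v} g = integral {a..v} g"
      using that by (intro Henstock_Kurzweil_Integration.integral_combine) auto
    then show ?thesis by (simp add: G_def)
  qed
  have "negligible (S r)" if "0 < r" for r
  proof (rule negligible_if_finely_covered[of "{a<..<b}"])
    show "{a<..<b} \<in> lmeasurable" by (simp add: bounded_set_imp_lmeasurable)
  next
    fix \<epsilon> :: real assume "0 < \<epsilon>"
    then have "0 < r * \<epsilon>" using \<open>0 < r\<close> by simp
    have "g integrable_on cbox a b" using g by simp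
    then have "\<exists>\<gamma>. gauge \<gamma> \<and> (\<forall>p. p tagged_partial_division_of cbox a b \<longrightarrow> \<gamma> fine p \<longrightarrow>
        (\<Sum>(x, k)\<in>p. norm (measure lborel k *\<^sub>R g x - integral k g)) < r * \<epsilon>)"
      by (rule Henstock_lemma[OF _ \<open>0 < r * \<epsilon>\<close>]) (intro exI conjI allI impI)
    then obtain \<gamma> where \<gamma>: "gauge \<gamma>" "\<forall>p. p tagged_partial_division_of cbox a b \<longrightarrow> \<gamma> fine p \<longrightarrow>
        (\<Sum>(x, k)\<in>p. norm (measure lborel k *\<^sub>R g x - integral k g)) < r * \<epsilon>"
      by (elim exE conjE) (rule that)
    \<comment> \<open>The tag is part of the relation, because the error refers to the value of g at
      the tag and the gauge must be respected there.\<close>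
    define R where "R u v \<longleftrightarrow> (\<exists>x\<in>{u..v}. {u..v} \<subseteq> \<gamma> x \<and> bad r x u v)" for u v
    have "finely_covered R x" if "x \<in> S r" for x
      unfolding finely_covered_def
    proof (intro allI impI)
      fix d :: real assume "0 < d"
      have "open (\<gamma> x)" "x \<in> \<gamma> x" using \<gamma>(1) by (auto simp: gauge_def)
      then obtain e where e: "0 < e" "cball x e \<subseteq> \<gamma> x" using open_contains_cball by blast
      have "finely_covered (bad r x) x" using \<open>x \<in> S r\<close> by (simp add: S_def)
      moreover have "0 < min d e" using \<open>0 < d\<close> e(1) by simp
      ultimately obtain u v where uv: "bad r x u v" "u \<le> x" "x \<le> v" "u < v" "v - u < min d e"
        unfolding finely_covered_def by blast
      then have "{u..v} \<subseteq> cball x e" by (auto simp: dist_real_def)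
      with e uv show "\<exists>u v. R u v \<and> u \<le> x \<and> x \<le> v \<and> u < v \<and> v - u < d"
        unfolding R_def by (intro exI[of _ u] exI[of _ v]) (auto intro!: bexI[of _ x])
    qed
    moreover have "(\<Sum>k\<in>D. Sup k - Inf k) \<le> \<epsilon>"
      if D: "D division_of \<Union>D" "\<Union>D \<subseteq> {a<..<b}" "\<forall>k\<in>D. \<exists>u v. k = {u..v} \<and> u < v \<and> R u v" for D
    proof -
      have "\<exists>x. x \<in> k \<and> k \<subseteq> \<gamma> x \<and> bad r x (Inf k) (Sup k)" if "k \<in> D" for k
        using D(3) that unfolding R_def by fastforce
      then obtain t where t: "\<And>k. k \<in> D \<Longrightarrow> t k \<in> k" "\<And>k. k \<in> D \<Longrightarrow> k \<subseteq> \<gamma> (t k)"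
        "\<And>k. k \<in> D \<Longrightarrow> bad r (t k) (Inf k) (Sup k)"
        by metis
      define p where "p = (\<lambda>k. (t k, k)) ` D"
      have "p tagged_partial_division_of cbox a b"
        unfolding tagged_partial_division_of_def
      proof (intro conjI allI impI)
        show "finite p" using D(1) by (auto simp: p_def)
        fix x k assume "(x, k) \<in> p"
        then have k: "k \<in> D" "x = t k" by (auto simp: p_def)
        then show "x \<in> k" using t by auto
        show "k \<subseteq> cbox a b" using k(1) D(2) by fastforce
        show "\<exists>a b. k = cbox a b" using k(1) division_ofD(4)[OF D(1)] by blast
      next
        fix x1 k1 x2 k2 assume "(x1, k1) \<in> p \<and> (x2, k2) \<in> p \<and> (x1, k1) \<noteq> (x2, k2)"
        then show "interior k1 \<inter> interior k2 = {}"
          using division_ofD(5)[OF D(1)] by (auto simp: p_def)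
      qed
      moreover have "\<gamma> fine p" using t(2) by (auto simp: p_def fine_def)
      ultimately have "(\<Sum>(x, k)\<in>p. norm (measure lborel k *\<^sub>R g x - integral k g)) < r * \<epsilon>" by (rule \<gamma>(2)[rule_format])
      then have lt: "(\<Sum>k\<in>D. \<bar>measure lborel k * g (t k) - integral k g\<bar>) < r * \<epsilon>"
        by (simp add: p_def sum.reindex inj_on_def)
      have "r * (\<Sum>k\<in>D. Sup k - Inf k) \<le> (\<Sum>k\<in>D. \<bar>measure lborel k * g (t k) - integral k g\<bar>)"
        unfolding sum_distrib_left
      proof (rule sum_mono)
        fix k assume "k \<in> D"
        then obtain u v where k: "k = {u..v}" "u < v" using D(3) by blast
        have "k \<subseteq> {a<..<b}" using D(2) \<open>k \<in> D\<close> by blast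
        moreover have "u \<in> k" "v \<in> k" using k by auto
        ultimately have "u \<in> {a<..<b}" "v \<in> {a<..<b}" by blast+
        then have "a \<le> u" "v \<le> b" by auto
        then show "r * (Sup k - Inf k) \<le> \<bar>measure lborel k * g (t k) - integral k g\<bar>"
          using t(3)[OF \<open>k \<in> D\<close>] Gint[of u v] k by (simp add: bad_def abs_minus_commute mult.commute)
      qed
      with lt have "r * (\<Sum>k\<in>D. Sup k - Inf k) < r * \<epsilon>" by linarith
      then show ?thesis using \<open>0 < r\<close> by simp
    qed
    ultimately show "\<exists>R. (\<forall>x\<in>S r. finely_covered R x) \<and>
      (\<forall>D. D division_of \<Union>D \<longrightarrow> \<Union>D \<subseteq> {a<..<b} \<longrightarrow> (\<forall>k\<in>D. \<exists>u v. k = {u..v} \<and> u < v \<and> R u v) \<longrightarrow>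
        (\<Sum>k\<in>D. Sup k - Inf k) \<le> \<epsilon>)" by blast
  qed (auto simp: S_def)
  then have "negligible (\<Union>n::nat. S (1 / (real n + 1)))"
    by (intro negligible_countable_Union) auto
  then show ?thesis
  proof (rule negligible_subset, goal_cases)
    case 1
    show ?case
    proof (intro subsetI, rule ccontr)
      fix x assume x: "x \<in> ?S" "x \<notin> (\<Union>n::nat. S (1 / (real n + 1)))"
      have "(G has_derivative (*) (g x)) (at x)"
        unfolding has_derivative_at_alt
      proof (intro conjI allI impI bounded_linear_mult_right)
        fix e :: real assume "0 < e"
        then obtain n where "inverse (real (Suc n)) < e" using reals_Archimedean by blast
        then have n: "1 / (real n + 1) < e" by (simp add: inverse_eq_divide add.commute)
        then have "\<not> finely_covered (bad (1 / (real n + 1)) x) x" using x by (auto simp: S_def)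
        then obtain d where d: "0 < d"
          "\<And>u v. u \<le> x \<Longrightarrow> x \<le> v \<Longrightarrow> u < v \<Longrightarrow> v - u < d \<Longrightarrow> \<bar>G v - G u - g x * (v - u)\<bar> \<le> 1 / (real n + 1) * (v - u)"
          unfolding finely_covered_def bad_def by (meson not_less)
        have "norm (G y - G x - g x * (y - x)) \<le> e * norm (y - x)" if y: "norm (y - x) < d" for y
        proof -
          have "\<bar>G y - G x - g x * (y - x)\<bar> \<le> 1 / (real n + 1) * \<bar>y - x\<bar>"
          proof (cases x y rule: linorder_cases)
            case less then show ?thesis using d(2)[of x y] y by simp
          next
            case greater
            have "G y - G x - g x * (y - x) = - (G x - G y - g x * (x - y))" by (simp add: algebra_simps)
            then show ?thesis using d(2)[of y x] y greater by simp
          qed simp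
          also have "\<dots> \<le> e * \<bar>y - x\<bar>" using n by (intro mult_right_mono) auto
          finally show ?thesis by simp
        qed
        with d(1) show "\<exists>d>0. \<forall>y. norm (y - x) < d \<longrightarrow> norm (G y - G x - g x * (y - x)) \<le> e * norm (y - x)" by blast
      qed
      then show False using x(1) by (simp add: has_field_derivative_def G_def[abs_def])
    qed
  qed
qed

section \<open>Square-integrable functions on an interval\<close>

definition sq_integrable :: "real \<Rightarrow> (real \<Rightarrow> real) \<Rightarrow> bool" where
  "sq_integrable l g \<longleftrightarrow> g \<in> borel_measurable (lebesgue_on {0..l}) \<and>
     integrable (lebesgue_on {0..l}) (\<lambda>x. (g x)\<^sup>2)"

lemma L2_space_iff: "f \<in> L2_space E len \<longleftrightarrow> (\<forall>e\<in>E. sq_integrable (len e) (f e))"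
  by (simp add: L2_space_def sq_integrable_def)

lemma sq_integrable_dominated:
  assumes "sq_integrable l g" "h \<in> borel_measurable (lebesgue_on {0..l})"
    "\<And>x. x \<in> {0..l} \<Longrightarrow> \<bar>h x\<bar> \<le> C * \<bar>g x\<bar>"
  shows "sq_integrable l h"
proof -
  have "integrable (lebesgue_on {0..l}) (\<lambda>x. C\<^sup>2 * (g x)\<^sup>2)"
    using assms(1) by (simp add: sq_integrable_def)
  then have "integrable (lebesgue_on {0..l}) (\<lambda>x. (h x)\<^sup>2)"
  proof (rule Bochner_Integration.integrable_bound)
    show "(\<lambda>x. (h x)\<^sup>2) \<in> borel_measurable (lebesgue_on {0..l})" using assms(2) by measurable
    have "(h x)\<^sup>2 \<le> C\<^sup>2 * (g x)\<^sup>2" if "x \<in> {0..l}" for x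
      using power_mono[OF assms(3)[OF that] abs_ge_zero, of 2] by (simp add: power_mult_distrib)
    then show "AE x in lebesgue_on {0..l}. norm ((h x)\<^sup>2) \<le> norm (C\<^sup>2 * (g x)\<^sup>2)"
      by (intro AE_I2) simp
  qed
  with assms(2) show ?thesis by (simp add: sq_integrable_def)
qed

lemma sq_integrable_add:
  assumes "sq_integrable l g" "sq_integrable l h"
  shows "sq_integrable l (\<lambda>x. g x + h x)"
proof -
  have "integrable (lebesgue_on {0..l}) (\<lambda>x. 2 * (g x)\<^sup>2 + 2 * (h x)\<^sup>2)"
    using assms by (simp add: sq_integrable_def)
  moreover have "(\<lambda>x. (g x + h x)\<^sup>2) \<in> borel_measurable (lebesgue_on {0..l})"
    using assms by (auto simp: sq_integrable_def)
  moreover have "(u + v)\<^sup>2 \<le> 2 * u\<^sup>2 + 2 * v\<^sup>2" for u v :: real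
    using sum_squares_bound[of u v] by (simp add: power2_sum)
  ultimately have "integrable (lebesgue_on {0..l}) (\<lambda>x. (g x + h x)\<^sup>2)"
    by (elim Bochner_Integration.integrable_bound) auto
  with assms show ?thesis by (auto simp: sq_integrable_def)
qed

lemma sq_integrable_continuous:
  assumes "continuous_on {0..l} h"
  shows "sq_integrable l h"
proof -
  have "continuous_on {0..l} (\<lambda>x. (h x)\<^sup>2)" using assms by (intro continuous_intros)
  then have "set_integrable lebesgue {0..l} (\<lambda>x. (h x)\<^sup>2)"
    using absolutely_integrable_continuous_real by blast
  then have "integrable (lebesgue_on {0..l}) (\<lambda>x. (h x)\<^sup>2)"
    by (simp add: integrable_restrict_space set_integrable_def)
  moreover have "h \<in> borel_measurable (lebesgue_on {0..l})"
    using assms by (intro continuous_imp_measurable_on_sets_lebesgue) auto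
  ultimately show ?thesis by (simp add: sq_integrable_def)
qed

lemma sq_integrable_mult_continuous:
  assumes g: "sq_integrable l g" and w: "continuous_on {0..l} w"
  shows "sq_integrable l (\<lambda>x. w x * g x)"
proof -
  have "bounded (w ` {0..l})" using w by (intro compact_imp_bounded compact_continuous_image) auto
  then obtain C where C: "\<forall>x\<in>{0..l}. \<bar>w x\<bar> \<le> C" by (auto simp: bounded_iff)
  have [measurable]: "w \<in> borel_measurable (lebesgue_on {0..l})" "g \<in> borel_measurable (lebesgue_on {0..l})"
    using w g by (auto simp: sq_integrable_def intro: continuous_imp_measurable_on_sets_lebesgue)
  show ?thesis
    by (rule sq_integrable_dominated[OF g, of _ C]) (auto simp: abs_mult intro!: mult_right_mono bspec[OF C])
qed

lemma sq_integrable_cmult: "sq_integrable l g \<Longrightarrow> sq_integrable l (\<lambda>x. C * g x)"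
  by (rule sq_integrable_mult_continuous) (auto intro: continuous_intros)

lemma lebesgue_on_integrable_imp_has_integral:
  fixes h :: "real \<Rightarrow> real"
  assumes "integrable (lebesgue_on {0..l}) h"
  shows "(h has_integral (\<integral>x. h x \<partial>lebesgue_on {0..l})) {0..l}"
  using assms has_integral_integral_lebesgue_on by fastforce

lemma sq_integrable_imp_integrable_on:
  assumes "sq_integrable l g"
  shows "(\<lambda>x. (g x)\<^sup>2) integrable_on {0..l}" "g integrable_on {0..l}"
proof -
  show sq: "(\<lambda>x. (g x)\<^sup>2) integrable_on {0..l}"
    using assms lebesgue_on_integrable_imp_has_integral unfolding sq_integrable_def integrable_on_def by blast
  show "g integrable_on {0..l}"
  proof (rule measurable_bounded_by_integrable_imp_integrable)
    show "(\<lambda>x. 1 + (g x)\<^sup>2) integrable_on {0..l}"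
      using integrable_add[OF integrable_const_ivl[of 1 0 l] sq] by simp
    have "\<bar>y\<bar> \<le> 1 + y\<^sup>2" for y :: real
      using sum_squares_bound[of 1 "\<bar>y\<bar>"] by simp
    then show "norm (g x) \<le> 1 + (g x)\<^sup>2" for x by simp
  qed (use assms in \<open>auto simp: sq_integrable_def\<close>)
qed

text \<open>Cauchy-Schwarz, obtained by integrating the square of g minus its mean I / x over
  [0, x]. It is the source of all \<open>L2_norm\<close> bounds for the resolvent.\<close>

lemma integral_bound_L2:
  assumes g: "sq_integrable l g" and x: "x \<in> {0..l}"
  shows "\<bar>integral {0..x} g\<bar> \<le> sqrt l * sqrt (\<integral>x. (g x)\<^sup>2 \<partial>lebesgue_on {0..l})"
proof (cases "x = 0")
  case True
  with x show ?thesis by simp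
next
  case False
  with x have "0 < x" by auto
  define I where "I = integral {0..x} g"
  have g2: "(\<lambda>x. (g x)\<^sup>2) integrable_on {0..l}" "g integrable_on {0..l}"
    using sq_integrable_imp_integrable_on[OF g] by auto
  have g2x: "(\<lambda>x. (g x)\<^sup>2) integrable_on {0..x}" "g integrable_on {0..x}"
    using g2 x by (auto elim!: integrable_on_subinterval)
  have "((\<lambda>t. (g t)\<^sup>2 - 2 * (I / x) * g t + (I / x)\<^sup>2) has_integral
      (integral {0..x} (\<lambda>t. (g t)\<^sup>2) - 2 * (I / x) * I + (I / x)\<^sup>2 * (x - 0))) {0..x}"
    unfolding I_def using g2x \<open>0 < x\<close> has_integral_const_real[of "(I / x)\<^sup>2" 0 x]
    by (intro has_integral_add has_integral_diff has_integral_mult_right integrable_integral)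
      (auto simp: I_def mult.commute)
  then have "0 \<le> integral {0..x} (\<lambda>t. (g t)\<^sup>2) - 2 * (I / x) * I + (I / x)\<^sup>2 * (x - 0)"
  proof (rule has_integral_nonneg)
    show "0 \<le> (g t)\<^sup>2 - 2 * (I / x) * g t + (I / x)\<^sup>2" for t
      using zero_le_power2[of "g t - I / x"] by (simp add: power2_diff algebra_simps)
  qed
  then have "I\<^sup>2 \<le> x * integral {0..x} (\<lambda>t. (g t)\<^sup>2)"
    using \<open>0 < x\<close> by (simp add: field_simps power2_eq_square)
  also have "\<dots> \<le> l * integral {0..l} (\<lambda>t. (g t)\<^sup>2)"
    using x g2 g2x by (intro mult_mono integral_subset_le integral_nonneg) auto
  also have "integral {0..l} (\<lambda>t. (g t)\<^sup>2) = (\<integral>x. (g x)\<^sup>2 \<partial>lebesgue_on {0..l})"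
    using g lebesgue_on_integrable_imp_has_integral unfolding sq_integrable_def by blast
  finally have "sqrt (I\<^sup>2) \<le> sqrt (l * (\<integral>x. (g x)\<^sup>2 \<partial>lebesgue_on {0..l}))" by (rule real_sqrt_le_mono)
  then show ?thesis by (simp add: I_def real_sqrt_mult)
qed

lemma AE_lebesgue_on_iff_negligible:
  assumes "S \<in> sets lebesgue"
  shows "(AE x in lebesgue_on S. P x) \<longleftrightarrow> negligible {x \<in> S. \<not> P x}"
proof -
  have "(AE x in lebesgue_on S. P x) \<longleftrightarrow> (AE x in lebesgue. x \<in> S \<longrightarrow> P x)"
    using assms by (simp add: AE_restrict_space_iff)
  also have "\<dots> \<longleftrightarrow> (\<exists>N\<in>null_sets lebesgue. {x \<in> S. \<not> P x} \<subseteq> N)"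
    by (auto simp: eventually_ae_filter)
  also have "\<dots> \<longleftrightarrow> negligible {x \<in> S. \<not> P x}"
    by (meson negligible_iff_null_sets negligible_subset subset_refl)
  finally show ?thesis .
qed

section \<open>The equation \<open>-f'' - z f = g\<close> on an interval\<close>

text \<open>With \<open>ssol\<close>, the fundamental system of -f'' = z f for the initial data (1,
  0) and (0, 1). The cases by the sign of z keep it real, since every real z has to be tested for
  the spectrum.\<close>

definition csol :: "real \<Rightarrow> real \<Rightarrow> real" where
  "csol z x = (if z > 0 then cos (sqrt z * x) else if z < 0 then cosh (sqrt (- z) * x) else 1)"

definition ssol :: "real \<Rightarrow> real \<Rightarrow> real" where
  "ssol z x = (if z > 0 then sin (sqrt z * x) / sqrt z else if z < 0 then sinh (sqrt (- z) * x) / sqrt (- z) else x)"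

lemma csol_0 [simp]: "csol z 0 = 1" and ssol_0 [simp]: "ssol z 0 = 0"
  by (auto simp: csol_def ssol_def)

text \<open>The left-hand side is the Wronskian of the fundamental system. It inverts variation of
  constants and later replaces the Pythagorean identity in the elimination of the slopes.\<close>

lemma csol_ssol_square: "(csol z x)\<^sup>2 + z * (ssol z x)\<^sup>2 = 1"
  by (auto simp: csol_def ssol_def power_divide cosh_square_eq)

lemma csol_has_derivative: "(csol z has_real_derivative - z * ssol z x) (at x)"
proof (cases z "0 :: real" rule: linorder_cases)
  case less
  then have "csol z = (\<lambda>x. cosh (sqrt (- z) * x))" by (auto simp: csol_def)
  moreover have "- z * ssol z x = sinh (sqrt (- z) * x) * (- z / sqrt (- z))"
    using less by (simp add: ssol_def)
  moreover have "- z / sqrt (- z) = sqrt (- z)" using less by (intro real_div_sqrt) simp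
  moreover have "((\<lambda>x. cosh (sqrt (- z) * x)) has_real_derivative sinh (sqrt (- z) * x) * sqrt (- z)) (at x)"
    by (rule derivative_eq_intros refl)+ simp
  ultimately show ?thesis by metis
next
  case equal
  then show ?thesis by (simp add: csol_def[abs_def])
next
  case greater
  then have "csol z = (\<lambda>x. cos (sqrt z * x))" by (auto simp: csol_def)
  moreover have "- z * ssol z x = - sin (sqrt z * x) * (z / sqrt z)"
    using greater by (simp add: ssol_def)
  moreover have "z / sqrt z = sqrt z" using greater by (intro real_div_sqrt) simp
  moreover have "((\<lambda>x. cos (sqrt z * x)) has_real_derivative - sin (sqrt z * x) * sqrt z) (at x)"
    by (rule derivative_eq_intros refl)+ simp
  ultimately show ?thesis by metis
qed

lemma ssol_has_derivative: "(ssol z has_real_derivative csol z x) (at x)"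
proof (cases z "0 :: real" rule: linorder_cases)
  case less
  then have "ssol z = (\<lambda>x. sinh (sqrt (- z) * x) / sqrt (- z))" by (auto simp: ssol_def)
  moreover have "((\<lambda>x. sinh (sqrt (- z) * x) / sqrt (- z)) has_real_derivative csol z x) (at x)"
    using less by (auto intro!: derivative_eq_intros simp: csol_def mult.assoc)
  ultimately show ?thesis by simp
next
  case equal
  then show ?thesis by (simp add: csol_def ssol_def[abs_def])
next
  case greater
  then have "ssol z = (\<lambda>x. sin (sqrt z * x) / sqrt z)" by (auto simp: ssol_def)
  moreover have "((\<lambda>x. sin (sqrt z * x) / sqrt z) has_real_derivative csol z x) (at x)"
    using greater by (auto intro!: derivative_eq_intros simp: csol_def mult.assoc)
  ultimately show ?thesis by simp
qed

lemma csol_continuous: "continuous_on S (csol z)" and ssol_continuous: "continuous_on S (ssol z)"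
  by (rule continuous_at_imp_continuous_on, blast intro: DERIV_isCont csol_has_derivative ssol_has_derivative)+

lemma csol_abs_continuous: "abs_continuous_on a b (csol z)"
  by (rule abs_continuous_on_C1[OF csol_has_derivative]) (intro continuous_intros ssol_continuous)

lemma ssol_abs_continuous: "abs_continuous_on a b (ssol z)"
  by (rule abs_continuous_on_C1[OF ssol_has_derivative csol_continuous])

lemma abs_continuous_on_const: "abs_continuous_on a b (\<lambda>_. C)"
  by (rule abs_continuous_on_C1[of _ "\<lambda>_. 0"]) auto

lemma abs_continuous_on_subinterval:
  assumes "abs_continuous_on a b F" "a \<le> a'" "b' \<le> b"
  shows "abs_continuous_on a' b' F"
proof -
  have "{a'..b'} \<subseteq> {a..b}" using assms by auto
  then have "ac_modulus a b F \<epsilon> \<delta> \<Longrightarrow> ac_modulus a' b' F \<epsilon> \<delta>" for \<epsilon> \<delta>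
    unfolding ac_modulus_def by (meson subset_trans)
  then show ?thesis using assms(1) unfolding abs_continuous_on_iff by blast
qed

definition cint :: "real \<Rightarrow> (real \<Rightarrow> real) \<Rightarrow> real \<Rightarrow> real" where
  "cint z g x = integral {0..x} (\<lambda>t. csol z t * g t)"

definition sint :: "real \<Rightarrow> (real \<Rightarrow> real) \<Rightarrow> real \<Rightarrow> real" where
  "sint z g x = integral {0..x} (\<lambda>t. ssol z t * g t)"

text \<open>Variation of constants.\<close>

definition edge_sol :: "real \<Rightarrow> real \<Rightarrow> real \<Rightarrow> (real \<Rightarrow> real) \<Rightarrow> real \<Rightarrow> real" where
  "edge_sol z A B g x = (A + sint z g x) * csol z x + (B - cint z g x) * ssol z x"

text \<open>The formal derivative of \<open>edge_sol\<close>: the terms that come from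
  differentiating \<open>cint\<close> and \<open>sint\<close> are ssol g csol and - csol g ssol,
  which cancel.\<close>

definition edge_sol_deriv :: "real \<Rightarrow> real \<Rightarrow> real \<Rightarrow> (real \<Rightarrow> real) \<Rightarrow> real \<Rightarrow> real" where
  "edge_sol_deriv z A B g x = - z * ssol z x * (A + sint z g x) + csol z x * (B - cint z g x)"

lemma interval_vector_derivative:
  fixes f :: "real \<Rightarrow> real"
  assumes "0 < l" "x \<in> {0..l}" "(f has_real_derivative D) (at x within {0..l})"
  shows "vector_derivative f (at x within {0..l}) = D"
  using vector_derivative_within_cbox[of 0 l x f D] assms
  by (simp add: has_real_derivative_iff_has_vector_derivative)

text \<open>\<open>a\<close> and \<open>b\<close> in the proof are the coordinates of (f, f') with
  respect to the fundamental system. They would be constant for g = 0; in general they are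
  absolutely continuous with derivatives ssol g and - csol g almost everywhere, so they can be
  integrated, and the Wronskian recovers f and f'.\<close>

theorem edge_sol_unique:
  assumes "0 < l" and f: "f differentiable_on {0..l}" "abs_continuous_on 0 l f"
    and f'_def: "\<And>x. f' x = vector_derivative f (at x within {0..l})"
    and f': "abs_continuous_on 0 l f'"
    and eq: "AE x in lebesgue_on {0..l}. - vector_derivative f' (at x within {0..l}) - z * f x = g x"
    and x: "x \<in> {0..l}"
  shows "f x = edge_sol z (f 0) (f' 0) g x \<and> f' x = edge_sol_deriv z (f 0) (f' 0) g x"
proof -
  \<comment> \<open>The endpoints are included because almost everywhere differentiability is
    available only on the open interval.\<close>
  define N where "N = {x \<in> {0<..<l}. \<not> (\<exists>L. (f' has_real_derivative L) (at x))} \<union> {0, l} \<union>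
    {x \<in> {0..l}. \<not> (- vector_derivative f' (at x within {0..l}) - z * f x = g x)}"
  have N: "negligible N"
    unfolding N_def using abs_continuous_on_differentiable_ae[OF f'] eq
    by (intro negligible_Un) (auto simp: AE_lebesgue_on_iff_negligible)
  have df: "(f has_real_derivative f' t) (at t within {0..l})" if "t \<in> {0..l}" for t
    using f(1) that unfolding differentiable_on_def f'_def
    by (simp add: has_real_derivative_iff_has_vector_derivative vector_derivative_works)
  have df': "(f' has_real_derivative - z * f t - g t) (at t within {0..l})" if t: "t \<in> {0..l} - N" for t
  proof -
    obtain L where "(f' has_real_derivative L) (at t)" using t by (auto simp: N_def)
    then have L: "(f' has_real_derivative L) (at t within {0..l})" by (rule has_field_derivative_at_within)
    then have "vector_derivative f' (at t within {0..l}) = L"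
      using t \<open>0 < l\<close> by (intro interval_vector_derivative) auto
    then have "L = - z * f t - g t" using t by (auto simp: N_def)
    with L show ?thesis by simp
  qed
  have sub: "{0..x} \<subseteq> {0..l}" using x by auto
  define a where "a t = f t * csol z t - f' t * ssol z t" for t
  define b where "b t = z * (f t * ssol z t) + f' t * csol z t" for t
  have "((\<lambda>t. ssol z t * g t) has_integral a x - a 0) {0..x}"
  proof (rule abs_continuous_on_has_integral[OF _ _ N])
    show "abs_continuous_on 0 x a"
      unfolding a_def[abs_def]
      by (rule abs_continuous_on_subinterval[of 0 l]) (intro abs_continuous_on_diff abs_continuous_on_mult f f'
          csol_abs_continuous ssol_abs_continuous, use x in simp_all)
    fix t assume t: "t \<in> {0..x} - N"
    have "(a has_real_derivative ssol z t * g t) (at t within {0..l})"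
    proof -
      have t': "t \<in> {0..l} - N" "t \<in> {0..l}" using t sub by auto
      have "(a has_real_derivative (f' t * csol z t + (- z * ssol z t) * f t) - ((- z * f t - g t) * ssol z t + csol z t * f' t)) (at t within {0..l})"
        unfolding a_def[abs_def]
        by (intro DERIV_diff DERIV_mult df[OF t'(2)] df'[OF t'(1)]
            has_field_derivative_at_within[OF csol_has_derivative]
            has_field_derivative_at_within[OF ssol_has_derivative])
      moreover have "(f' t * csol z t + (- z * ssol z t) * f t) - ((- z * f t - g t) * ssol z t + csol z t * f' t) = ssol z t * g t" by (simp add: algebra_simps)
      ultimately show ?thesis by simp
    qed
    then show "(a has_real_derivative ssol z t * g t) (at t within {0..x})"
      by (rule DERIV_subset[OF _ sub])
  qed (use x in auto)
  then have a: "a x = f 0 + sint z g x"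
    unfolding sint_def by (simp add: integral_unique a_def)
  have "((\<lambda>t. - (csol z t * g t)) has_integral b x - b 0) {0..x}"
  proof (rule abs_continuous_on_has_integral[OF _ _ N])
    show "abs_continuous_on 0 x b"
      unfolding b_def[abs_def]
      by (rule abs_continuous_on_subinterval[of 0 l]) (intro abs_continuous_on_add abs_continuous_on_mult f f'
          csol_abs_continuous ssol_abs_continuous abs_continuous_on_const, use x in simp_all)
    fix t assume t: "t \<in> {0..x} - N"
    have "(b has_real_derivative - (csol z t * g t)) (at t within {0..l})"
    proof -
      have t': "t \<in> {0..l} - N" "t \<in> {0..l}" using t sub by auto
      have "(b has_real_derivative z * (f' t * ssol z t + csol z t * f t) + ((- z * f t - g t) * csol z t + (- z * ssol z t) * f' t)) (at t within {0..l})"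
        unfolding b_def[abs_def]
        by (intro DERIV_add DERIV_cmult DERIV_mult df[OF t'(2)] df'[OF t'(1)]
            has_field_derivative_at_within[OF csol_has_derivative]
            has_field_derivative_at_within[OF ssol_has_derivative])
      moreover have "z * (f' t * ssol z t + csol z t * f t) + ((- z * f t - g t) * csol z t + (- z * ssol z t) * f' t) = - (csol z t * g t)" by (simp add: algebra_simps)
      ultimately show ?thesis by simp
    qed
    then show "(b has_real_derivative - (csol z t * g t)) (at t within {0..x})"
      by (rule DERIV_subset[OF _ sub])
  qed (use x in auto)
  then have "- cint z g x = b x - b 0"
    unfolding cint_def integral_neg[symmetric] by (rule integral_unique)
  then have b: "b x = f' 0 - cint z g x" by (simp add: b_def)
  have "f x = f x * ((csol z x)\<^sup>2 + z * (ssol z x)\<^sup>2)" by (simp add: csol_ssol_square)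
  also have "\<dots> = a x * csol z x + b x * ssol z x"
    unfolding a_def b_def by (simp add: algebra_simps power2_eq_square)
  finally have 1: "f x = a x * csol z x + b x * ssol z x" .
  have "f' x = f' x * ((csol z x)\<^sup>2 + z * (ssol z x)\<^sup>2)" by (simp add: csol_ssol_square)
  also have "\<dots> = - z * ssol z x * a x + csol z x * b x"
    unfolding a_def b_def by (simp add: algebra_simps power2_eq_square)
  finally have 2: "f' x = - z * ssol z x * a x + csol z x * b x" .
  from 1 2 a b show ?thesis by (simp add: edge_sol_def edge_sol_deriv_def)
qed

lemma indefinite_integral_L2:
  assumes "sq_integrable l h"
  shows "abs_continuous_on 0 l (\<lambda>x. integral {0..x} h)"
proof (rule abs_continuous_on_indefinite_integral)
  note h = sq_integrable_imp_integrable_on[OF assms]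
  show "(\<lambda>x. (h x)\<^sup>2) integrable_on {0..l}" by (rule h)
  fix u v :: real assume uv: "0 \<le> u" "u \<le> v" "v \<le> l"
  then have "h integrable_on {0..v}" "h integrable_on {u..v}"
    using h(2) by (auto elim!: integrable_on_subinterval)
  then show "(h has_integral integral {0..v} h - integral {0..u} h) {u..v}"
    using Henstock_Kurzweil_Integration.integral_combine[of 0 u v h] uv
    by (simp add: has_integral_integrable_integral)
qed

text \<open>\<open>cint\<close> and \<open>sint\<close> are differentiable only almost everywhere,
  yet \<open>edge_sol\<close> is differentiable at every point: being absolutely continuous, it is
  the integral of \<open>edge_sol_deriv\<close>, which is continuous. For the second derivative only
  an almost everywhere statement remains.\<close>

theorem edge_sol_works:
  assumes "0 < l" and g: "sq_integrable l g"
  shows "abs_continuous_on 0 l (edge_sol z A B g)" "abs_continuous_on 0 l (edge_sol_deriv z A B g)"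
    "\<And>x. x \<in> {0..l} \<Longrightarrow> (edge_sol z A B g has_real_derivative edge_sol_deriv z A B g x) (at x within {0..l})"
    "negligible {x \<in> {0..l}.
       \<not> (edge_sol_deriv z A B g has_real_derivative - z * edge_sol z A B g x - g x) (at x within {0..l})}"
proof -
  have sg: "sq_integrable l (\<lambda>t. csol z t * g t)" "sq_integrable l (\<lambda>t. ssol z t * g t)"
    by (intro sq_integrable_mult_continuous g csol_continuous ssol_continuous)+
  have ac: "abs_continuous_on 0 l (cint z g)" "abs_continuous_on 0 l (sint z g)"
    unfolding cint_def[abs_def] sint_def[abs_def] by (intro indefinite_integral_L2 sg)+
  show F: "abs_continuous_on 0 l (edge_sol z A B g)"
    unfolding edge_sol_def[abs_def]
    by (intro abs_continuous_on_add abs_continuous_on_mult abs_continuous_on_diff ac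
        csol_abs_continuous ssol_abs_continuous abs_continuous_on_const)
  show F': "abs_continuous_on 0 l (edge_sol_deriv z A B g)"
    unfolding edge_sol_deriv_def[abs_def]
    by (intro abs_continuous_on_add abs_continuous_on_mult abs_continuous_on_diff ac
        csol_abs_continuous ssol_abs_continuous abs_continuous_on_const)
  define N where "N = {x \<in> {0<..<l}. \<not> ((cint z g) has_real_derivative csol z x * g x) (at x)} \<union>
    {x \<in> {0<..<l}. \<not> ((sint z g) has_real_derivative ssol z x * g x) (at x)} \<union> {0, l}"
  have N: "negligible N"
    unfolding N_def cint_def[abs_def] sint_def[abs_def]
    by (intro negligible_Un integral_has_derivative_ae sq_integrable_imp_integrable_on sg) auto
  have dP: "(cint z g has_real_derivative csol z x * g x) (at x)"
    and dQ: "(sint z g has_real_derivative ssol z x * g x) (at x)" if "x \<in> {0..l} - N" for x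
    using that by (auto simp: N_def)
  have d: "(edge_sol z A B g has_real_derivative edge_sol_deriv z A B g x) (at x)" if "x \<in> {0..l} - N" for x
  proof -
    have "(edge_sol z A B g has_real_derivative
        ((0 + ssol z x * g x) * csol z x + (- z * ssol z x) * (A + sint z g x)) +
        ((0 - csol z x * g x) * ssol z x + csol z x * (B - cint z g x))) (at x)"
      unfolding edge_sol_def[abs_def]
      by (intro DERIV_add DERIV_diff DERIV_mult DERIV_const dP[OF that] dQ[OF that]
          csol_has_derivative ssol_has_derivative)
    moreover have "((0 + ssol z x * g x) * csol z x + (- z * ssol z x) * (A + sint z g x)) +
        ((0 - csol z x * g x) * ssol z x + csol z x * (B - cint z g x)) = edge_sol_deriv z A B g x"
      by (simp add: edge_sol_deriv_def algebra_simps)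
    ultimately show ?thesis by simp
  qed
  have cont: "continuous_on {0..l} (edge_sol_deriv z A B g)"
    by (rule abs_continuous_on_imp_continuous_on[OF F'])
  have int: "integral {0..u} (edge_sol_deriv z A B g) = edge_sol z A B g u - edge_sol z A B g 0" if "u \<in> {0..l}" for u
    using that by (intro integral_unique abs_continuous_on_has_integral[OF _ _ N] abs_continuous_on_subinterval[OF F])
      (auto intro!: has_field_derivative_at_within d)
  show "(edge_sol z A B g has_real_derivative edge_sol_deriv z A B g x) (at x within {0..l})" if x: "x \<in> {0..l}" for x
  proof -
    have "((\<lambda>u. integral {0..u} (edge_sol_deriv z A B g) + edge_sol z A B g 0) has_real_derivative
        edge_sol_deriv z A B g x) (at x within {0..l})"
      using integral_has_vector_derivative[OF cont x]
      by (auto simp: has_real_derivative_iff_has_vector_derivative intro!: derivative_eq_intros)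
    then show ?thesis
      by (rule has_field_derivative_transform_within[OF _ zero_less_one x]) (simp add: int)
  qed
  show "negligible {x \<in> {0..l}.
       \<not> (edge_sol_deriv z A B g has_real_derivative - z * edge_sol z A B g x - g x) (at x within {0..l})}"
  proof (rule negligible_subset[OF N], clarify, rule ccontr)
    fix x assume "x \<in> {0..l}" "x \<notin> N"
      and no: "\<not> (edge_sol_deriv z A B g has_real_derivative - z * edge_sol z A B g x - g x) (at x within {0..l})"
    then have x: "x \<in> {0..l} - N" by auto
    have "g x * (csol z x)\<^sup>2 + z * (g x * (ssol z x)\<^sup>2) = g x * ((csol z x)\<^sup>2 + z * (ssol z x)\<^sup>2)"
      by (simp add: algebra_simps)
    then have *: "g x * (csol z x)\<^sup>2 + z * (g x * (ssol z x)\<^sup>2) = g x" by (simp add: csol_ssol_square)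
    have "(edge_sol_deriv z A B g has_real_derivative
        ((- z * csol z x) * (A + sint z g x) + (0 + ssol z x * g x) * (- z * ssol z x)) +
        ((- z * ssol z x) * (B - cint z g x) + (0 - csol z x * g x) * csol z x)) (at x)"
      unfolding edge_sol_deriv_def[abs_def]
      by (intro DERIV_add DERIV_diff DERIV_mult DERIV_cmult DERIV_const dP[OF x] dQ[OF x]
          csol_has_derivative ssol_has_derivative)
    moreover have "((- z * csol z x) * (A + sint z g x) + (0 + ssol z x * g x) * (- z * ssol z x)) +
        ((- z * ssol z x) * (B - cint z g x) + (0 - csol z x * g x) * csol z x) =
        - z * edge_sol z A B g x - (g x * (csol z x)\<^sup>2 + z * (g x * (ssol z x)\<^sup>2))"
      by (simp add: edge_sol_def algebra_simps power2_eq_square)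
    ultimately have "(edge_sol_deriv z A B g has_real_derivative - z * edge_sol z A B g x
        - (g x * (csol z x)\<^sup>2 + z * (g x * (ssol z x)\<^sup>2))) (at x)"
      by simp
    then show False using no unfolding * by (auto dest: has_field_derivative_at_within)
  qed
qed

text \<open>Needed because the second derivative of a constructed solution is known only up to a
  null set, so that its measurability has to be transferred as well.\<close>

lemma sq_integrable_spike:
  assumes g: "sq_integrable l g" and eq: "AE x in lebesgue_on {0..l}. h x = g x"
  shows "sq_integrable l h"
proof -
  define N where "N = {x \<in> {0..l}. \<not> h x = g x}"
  have N: "negligible N" using eq by (simp add: AE_lebesgue_on_iff_negligible N_def)
  note g' = sq_integrable_imp_integrable_on[OF g]
  have "h integrable_on {0..l}" by (rule integrable_spike[OF g'(2) N]) (auto simp: N_def)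
  moreover have "(\<lambda>x. (h x)\<^sup>2) integrable_on {0..l}"
    by (rule integrable_spike[OF g'(1) N]) (auto simp: N_def)
  then have "(\<lambda>x. (h x)\<^sup>2) absolutely_integrable_on {0..l}"
    by (rule nonnegative_absolutely_integrable_1) simp
  ultimately show ?thesis
    by (simp add: sq_integrable_def integrable_imp_measurable integrable_restrict_space set_integrable_def)
qed

text \<open>The constant depends on z and l but not on g, as boundedness of the inverse
  requires.\<close>

lemma cint_sint_bound:
  obtains M where "0 \<le> M" "\<And>g x. sq_integrable l g \<Longrightarrow> x \<in> {0..l} \<Longrightarrow>
    \<bar>cint z g x\<bar> \<le> M * sqrt (\<integral>x. (g x)\<^sup>2 \<partial>lebesgue_on {0..l}) \<and>
    \<bar>sint z g x\<bar> \<le> M * sqrt (\<integral>x. (g x)\<^sup>2 \<partial>lebesgue_on {0..l})"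
proof -
  have *: "\<exists>M\<ge>0. \<forall>g x. sq_integrable l g \<longrightarrow> x \<in> {0..l} \<longrightarrow>
      \<bar>integral {0..x} (\<lambda>t. w t * g t)\<bar> \<le> M * sqrt (\<integral>x. (g x)\<^sup>2 \<partial>lebesgue_on {0..l})"
    if w: "continuous_on {0..l} w" for w
  proof -
    have "bounded (w ` {0..l})" using w by (intro compact_imp_bounded compact_continuous_image) auto
    then obtain C where "0 < C" and C: "\<forall>x\<in>{0..l}. \<bar>w x\<bar> \<le> C" by (auto simp: bounded_pos)
    show ?thesis
    proof (intro exI[of _ "sqrt (max l 0) * C"] conjI allI impI)
      show "0 \<le> sqrt (max l 0) * C" using \<open>0 < C\<close> by simp
      fix g x assume g: "sq_integrable l g" and x: "x \<in> {0..l}"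
      have wg: "sq_integrable l (\<lambda>t. w t * g t)" by (rule sq_integrable_mult_continuous[OF g w])
      have "\<bar>integral {0..x} (\<lambda>t. w t * g t)\<bar> \<le> sqrt l * sqrt (\<integral>t. (w t * g t)\<^sup>2 \<partial>lebesgue_on {0..l})"
        by (rule integral_bound_L2[OF wg x])
      also have "\<dots> \<le> sqrt l * sqrt (\<integral>t. C\<^sup>2 * (g t)\<^sup>2 \<partial>lebesgue_on {0..l})"
      proof (intro mult_left_mono real_sqrt_le_mono integral_mono)
        show "integrable (lebesgue_on {0..l}) (\<lambda>t. (w t * g t)\<^sup>2)" "integrable (lebesgue_on {0..l}) (\<lambda>t. C\<^sup>2 * (g t)\<^sup>2)"
          using g wg by (auto simp: sq_integrable_def)
        fix t assume "t \<in> space (lebesgue_on {0..l})"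
        then have "\<bar>w t\<bar> \<le> C" using C by simp
        then have "(w t)\<^sup>2 \<le> C\<^sup>2" using power_mono[of "\<bar>w t\<bar>" C 2] by simp
        then show "(w t * g t)\<^sup>2 \<le> C\<^sup>2 * (g t)\<^sup>2" by (simp add: power_mult_distrib mult_right_mono)
      qed (use x in auto)
      also have "\<dots> = sqrt (max l 0) * C * sqrt (\<integral>x. (g x)\<^sup>2 \<partial>lebesgue_on {0..l})"
        using \<open>0 < C\<close> x by (simp add: real_sqrt_mult max_def)
      finally show "\<bar>integral {0..x} (\<lambda>t. w t * g t)\<bar> \<le> \<dots>" .
    qed
  qed
  obtain M1 where M1: "0 \<le> M1" "\<forall>g x. sq_integrable l g \<longrightarrow> x \<in> {0..l} \<longrightarrow>
      \<bar>cint z g x\<bar> \<le> M1 * sqrt (\<integral>x. (g x)\<^sup>2 \<partial>lebesgue_on {0..l})"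
    using *[OF csol_continuous[of _ z]] unfolding cint_def by blast
  obtain M2 where M2: "0 \<le> M2" "\<forall>g x. sq_integrable l g \<longrightarrow> x \<in> {0..l} \<longrightarrow>
      \<bar>sint z g x\<bar> \<le> M2 * sqrt (\<integral>x. (g x)\<^sup>2 \<partial>lebesgue_on {0..l})"
    using *[OF ssol_continuous[of _ z]] unfolding sint_def by blast
  show ?thesis
  proof (rule that[of "max M1 M2"])
    show "0 \<le> max M1 M2" using M1(1) by simp
    fix g x assume gx: "sq_integrable l g" "x \<in> {0..l}"
    define n where "n = sqrt (\<integral>x. (g x)\<^sup>2 \<partial>lebesgue_on {0..l})"
    have "0 \<le> n" by (simp add: n_def)
    then have "M1 * n \<le> max M1 M2 * n" "M2 * n \<le> max M1 M2 * n" by (auto intro: mult_right_mono)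
    moreover have "\<bar>cint z g x\<bar> \<le> M1 * n" "\<bar>sint z g x\<bar> \<le> M2 * n"
      using M1(2) M2(2) gx by (auto simp: n_def)
    ultimately show "\<bar>cint z g x\<bar> \<le> max M1 M2 * sqrt (\<integral>x. (g x)\<^sup>2 \<partial>lebesgue_on {0..l}) \<and>
        \<bar>sint z g x\<bar> \<le> max M1 M2 * sqrt (\<integral>x. (g x)\<^sup>2 \<partial>lebesgue_on {0..l})"
      unfolding n_def by linarith
  qed
qed

section \<open>Reduction of the resolvent equation to vertex values and initial slopes\<close>

locale equilateral_graph =
  fixes E :: "('v::finite \<times> 'v) set" and len :: "'v \<times> 'v \<Rightarrow> real" and l :: real
  assumes metric_graph: "metric_graph E len" and edges_nonempty: "E \<noteq> {}"
    and equilateral: "equilateral E len l"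
begin

lemma len_eq: "e \<in> E \<Longrightarrow> len e = l"
  using equilateral by (simp add: equilateral_def)

lemma l_pos: "0 < l"
  using metric_graph edges_nonempty len_eq by (fastforce simp: metric_graph_def)

lemma no_loop: "e \<in> E \<Longrightarrow> fst e \<noteq> snd e"
  using metric_graph by (cases e) (auto simp: metric_graph_def)

lemma not_reversed: "(u, v) \<in> E \<Longrightarrow> (v, u) \<notin> E"
  using metric_graph by (auto simp: metric_graph_def)

lemma connected: "(u, v) \<in> (E \<union> E\<inverse>)\<^sup>*"
  using metric_graph by (auto simp: metric_graph_def)

text \<open>An edge without loops gives a second vertex, and a path towards it has a first edge.
  This makes all degrees positive and lets every vertex value be read off along some edge.\<close>

lemma incident_edges_nonempty: "incident_edges E v \<noteq> {}"
proof -
  obtain a b where ab: "(a, b) \<in> E" using edges_nonempty by auto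
  then have "a \<noteq> b" using no_loop by fastforce
  then obtain w where "w \<noteq> v" by metis
  then have "(v, w) \<in> (E \<union> E\<inverse>)\<^sup>*" "v \<noteq> w" using connected by auto
  then obtain y where "(v, y) \<in> E \<union> E\<inverse>" by (metis converse_rtranclE)
  then show ?thesis by (fastforce simp: incident_edges_def)
qed

text \<open>
  \<open>\<phi>\<close> holds the vertex values and \<open>B $ e\<close> the derivative at the initial end of \<open>e\<close>. The first
  component collects the Kirchhoff sums, the second the mismatch at the terminal end of each edge;
  on non-edges it is the identity, so that the map is an endomorphism.
\<close>

definition coupling :: "real \<Rightarrow> (real^'v) \<times> (real^('v \<times> 'v)) \<Rightarrow> (real^'v) \<times> (real^('v \<times> 'v))" where
  "coupling z = (\<lambda>(\<phi>, B).
     (\<chi> w. \<Sum>e\<in>E. (if fst e = w then B $ e else 0)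
            - (if snd e = w then csol z l * B $ e - z * ssol z l * \<phi> $ fst e else 0),
      \<chi> e. if e \<in> E then csol z l * \<phi> $ fst e + ssol z l * B $ e - \<phi> $ snd e else B $ e))"

text \<open>The contributions of g to \<open>edge_sol\<close> and \<open>edge_sol_deriv\<close> at
  the terminal ends, moved to the right-hand side. Initial ends contribute nothing, since
  \<open>cint\<close> and \<open>sint\<close> vanish at 0.\<close>

definition load :: "real \<Rightarrow> 'v edge_fun \<Rightarrow> (real^'v) \<times> (real^('v \<times> 'v))" where
  "load z g =
     (\<chi> w. \<Sum>e\<in>E. if snd e = w then - z * ssol z l * sint z (g e) l - csol z l * cint z (g e) l else 0,
      \<chi> e. if e \<in> E then ssol z l * cint z (g e) l - csol z l * sint z (g e) l else 0)"

definition graph_sol :: "real \<Rightarrow> 'v edge_fun \<Rightarrow> (real^'v) \<times> (real^('v \<times> 'v)) \<Rightarrow> 'v edge_fun" where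
  "graph_sol z g p = (\<lambda>e x. if e \<in> E \<and> x \<in> {0..l} then edge_sol z (fst p $ fst e) (snd p $ e) (g e) x else 0)"

lemma linear_coupling: "linear (coupling z)"
proof (rule linearI)
  show "coupling z (p + q) = coupling z p + coupling z q" for p q
    by (cases p; cases q)
      (auto simp: coupling_def vec_eq_iff algebra_simps sum.distrib[symmetric] sum_subtractf[symmetric]
        intro!: sum.cong)
  show "coupling z (r *\<^sub>R p) = r *\<^sub>R coupling z p" for r p
    by (cases p) (auto simp: coupling_def vec_eq_iff algebra_simps sum_distrib_left intro!: sum.cong)
qed

lemma edge_sol_0: "edge_sol z A B g 0 = A" and edge_sol_deriv_0: "edge_sol_deriv z A B g 0 = B"
  by (auto simp: edge_sol_def edge_sol_deriv_def cint_def sint_def)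

text \<open>Absence of loops makes the two ways of being incident exclusive.\<close>

lemma sum_incident_edges:
  fixes h k :: "'v \<times> 'v \<Rightarrow> real"
  shows "(\<Sum>e\<in>incident_edges E v. if fst e = v then h e else - k e) =
     (\<Sum>e\<in>E. (if fst e = v then h e else 0) - (if snd e = v then k e else 0))"
proof -
  have "(\<Sum>e\<in>incident_edges E v. if fst e = v then h e else - k e) =
      (\<Sum>e\<in>E. if e \<in> incident_edges E v then (if fst e = v then h e else - k e) else 0)"
    by (rule sum.mono_neutral_cong_left) (auto simp: incident_edges_def)
  also have "\<dots> = (\<Sum>e\<in>E. (if fst e = v then h e else 0) - (if snd e = v then k e else 0))"
    using no_loop by (intro sum.cong) (auto simp: incident_edges_def)
  finally show ?thesis .
qed

text \<open>Only the end values and end slopes of f enter, so the same equivalence serves a given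
  element of the domain and a function assembled from a solution of the linear system.\<close>

lemma vertex_conditions_iff:
  assumes F: "\<And>e. e \<in> E \<Longrightarrow> f e 0 = fst p $ fst e"
    "\<And>e. e \<in> E \<Longrightarrow> f e l = edge_sol z (fst p $ fst e) (snd p $ e) (g e) l"
    "\<And>e. e \<in> E \<Longrightarrow> edge_deriv len f e 0 = snd p $ e"
    "\<And>e. e \<in> E \<Longrightarrow> edge_deriv len f e l = edge_sol_deriv z (fst p $ fst e) (snd p $ e) (g e) l"
    and off: "\<And>e. e \<notin> E \<Longrightarrow> snd p $ e = 0"
  shows "(\<forall>v. (\<forall>e\<in>incident_edges E v. vertex_value len f v e = fst p $ v) \<and>
      (\<Sum>e\<in>incident_edges E v. outgoing_deriv len f v e) = 0) \<longleftrightarrow> coupling z p = load z g"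
proof -
  have "(\<forall>v. \<forall>e\<in>incident_edges E v. vertex_value len f v e = fst p $ v) \<longleftrightarrow> (\<forall>e\<in>E. f e l = fst p $ snd e)"
    using no_loop by (auto simp: incident_edges_def vertex_value_def F(1) len_eq)
  also have "\<dots> \<longleftrightarrow> (\<forall>e. snd (coupling z p) $ e = snd (load z g) $ e)"
  proof -
    have "f e l = fst p $ snd e \<longleftrightarrow> snd (coupling z p) $ e = snd (load z g) $ e" if "e \<in> E" for e
    proof -
      have "snd (coupling z p) $ e - snd (load z g) $ e = f e l - fst p $ snd e"
        unfolding F(2)[OF that] using that
        by (simp add: coupling_def load_def edge_sol_def case_prod_unfold algebra_simps)
      then show ?thesis by linarith
    qed
    moreover have "snd (coupling z p) $ e = snd (load z g) $ e" if "e \<notin> E" for e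
      using that off[OF that] by (simp add: coupling_def load_def case_prod_unfold)
    ultimately show ?thesis by blast
  qed
  also have "\<dots> \<longleftrightarrow> snd (coupling z p) = snd (load z g)" by (simp add: vec_eq_iff)
  finally have 1: "(\<forall>v. \<forall>e\<in>incident_edges E v. vertex_value len f v e = fst p $ v) \<longleftrightarrow>
      snd (coupling z p) = snd (load z g)" .
  have "(\<Sum>e\<in>incident_edges E v. outgoing_deriv len f v e) = fst (coupling z p) $ v - fst (load z g) $ v" for v
  proof -
    have "(\<Sum>e\<in>incident_edges E v. outgoing_deriv len f v e) =
        (\<Sum>e\<in>incident_edges E v. if fst e = v then edge_deriv len f e 0 else - edge_deriv len f e l)"
      by (rule sum.cong) (auto simp: incident_edges_def outgoing_deriv_def len_eq)
    also have "\<dots> = (\<Sum>e\<in>E. (if fst e = v then edge_deriv len f e 0 else 0) -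
        (if snd e = v then edge_deriv len f e l else 0))"
      by (rule sum_incident_edges)
    also have "\<dots> = fst (coupling z p) $ v - fst (load z g) $ v"
      by (cases p) (auto simp: coupling_def load_def sum_subtractf[symmetric] F edge_sol_deriv_def algebra_simps
          intro!: sum.cong)
    finally show ?thesis .
  qed
  then have 2: "(\<forall>v. (\<Sum>e\<in>incident_edges E v. outgoing_deriv len f v e) = 0) \<longleftrightarrow>
      fst (coupling z p) = fst (load z g)"
    by (auto simp: vec_eq_iff)
  show ?thesis using 1 2 by (auto simp: prod_eq_iff)
qed

lemma resolvent_equation_imp:
  assumes f: "f \<in> standard_domain E len" and eq: "ae_equal E len (laplace_minus len z f) g"
  shows "\<exists>p. coupling z p = load z g \<and> f = graph_sol z g p"
proof -
  have max: "f \<in> maximal_domain E len" using f by (simp add: standard_domain_def)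
  \<comment> \<open>Continuity at the vertex makes the choice of the incident edge
    immaterial.\<close>
  define p where "p = ((\<chi> v. vertex_value len f v (SOME e. e \<in> incident_edges E v)) :: real^'v,
    (\<chi> e. if e \<in> E then edge_deriv len f e 0 else 0) :: real^('v \<times> 'v))"
  have val: "vertex_value len f v e = fst p $ v" if "e \<in> incident_edges E v" for v e
  proof -
    have "(SOME e. e \<in> incident_edges E v) \<in> incident_edges E v" using that by (rule someI)
    then have "vertex_value len f v e = vertex_value len f v (SOME e. e \<in> incident_edges E v)"
      using f that unfolding standard_domain_def by blast
    then show ?thesis by (simp add: p_def)
  qed
  have p0: "f e 0 = fst p $ fst e" if "e \<in> E" for e
    using val[of e "fst e"] that by (simp add: incident_edges_def vertex_value_def)
  have sol: "f e x = edge_sol z (fst p $ fst e) (snd p $ e) (g e) x \<and>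
      edge_deriv len f e x = edge_sol_deriv z (fst p $ fst e) (snd p $ e) (g e) x"
    if e: "e \<in> E" and x: "x \<in> {0..l}" for e x
  proof -
    have "f e x = edge_sol z (f e 0) (edge_deriv len f e 0) (g e) x \<and>
      edge_deriv len f e x = edge_sol_deriv z (f e 0) (edge_deriv len f e 0) (g e) x"
    proof (rule edge_sol_unique[OF l_pos _ _ _ _ _ x])
      show "f e differentiable_on {0..l}" "abs_continuous_on 0 l (f e)" "abs_continuous_on 0 l (edge_deriv len f e)"
        using max e by (auto simp: maximal_domain_def len_eq)
      show "edge_deriv len f e x = vector_derivative (f e) (at x within {0..l})" for x
        by (simp add: edge_deriv_def len_eq e)
      show "AE x in lebesgue_on {0..l}. - vector_derivative (edge_deriv len f e) (at x within {0..l}) - z * f e x = g e x"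
      proof -
        have "AE x in lebesgue_on {0..len e}. laplace_minus len z f e x = g e x"
          using eq e unfolding ae_equal_def by blast
        then show ?thesis
          unfolding len_eq[OF e] by (simp add: laplace_minus_def laplace_def edge_deriv_def[of len "edge_deriv len f"] len_eq e)
      qed
    qed
    then show ?thesis using p0 e by (simp add: p_def)
  qed
  have "coupling z p = load z g"
  proof (rule vertex_conditions_iff[THEN iffD1])
    show "\<forall>v. (\<forall>e\<in>incident_edges E v. vertex_value len f v e = fst p $ v) \<and>
        (\<Sum>e\<in>incident_edges E v. outgoing_deriv len f v e) = 0"
      using val f unfolding standard_domain_def by blast
    fix e assume e: "e \<in> E"
    show "f e 0 = fst p $ fst e" by (rule p0[OF e])
    show "edge_deriv len f e 0 = snd p $ e" using e by (simp add: p_def)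
    have "l \<in> {0..l}" using l_pos by simp
    from sol[OF e this] show "f e l = edge_sol z (fst p $ fst e) (snd p $ e) (g e) l"
      "edge_deriv len f e l = edge_sol_deriv z (fst p $ fst e) (snd p $ e) (g e) l" by blast+
  qed (simp add: p_def)
  moreover have "f = graph_sol z g p"
  proof (intro ext)
    fix e x show "f e x = graph_sol z g p e x"
    proof (cases "e \<in> E \<and> x \<in> {0..l}")
      case True
      then show ?thesis using sol by (simp add: graph_sol_def)
    next
      case False
      moreover have "\<forall>e x. e \<notin> E \<or> x \<notin> {0..len e} \<longrightarrow> f e x = 0"
        using max unfolding maximal_domain_def by blast
      ultimately have "f e x = 0" using len_eq by metis
      with False show ?thesis by (auto simp: graph_sol_def)
    qed
  qed
  ultimately show ?thesis by blast
qed

lemma graph_sol_solves: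
  assumes g: "g \<in> L2_space E len" and p: "coupling z p = load z g"
  shows "graph_sol z g p \<in> standard_domain E len" "ae_equal E len (laplace_minus len z (graph_sol z g p)) g"
proof -
  define f where "f = graph_sol z g p"
  define F where "F e = edge_sol z (fst p $ fst e) (snd p $ e) (g e)" for e
  define F' where "F' e = edge_sol_deriv z (fst p $ fst e) (snd p $ e) (g e)" for e
  have g': "sq_integrable l (g e)" if "e \<in> E" for e using g that by (auto simp: L2_space_iff len_eq)
  have acF: "abs_continuous_on 0 l (F e)" "abs_continuous_on 0 l (F' e)"
    and dF: "x \<in> {0..l} \<Longrightarrow> (F e has_real_derivative F' e x) (at x within {0..l})"
    and dF': "negligible {x \<in> {0..l}. \<not> (F' e has_real_derivative - z * F e x - g e x) (at x within {0..l})}"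
    if "e \<in> E" for e x
    unfolding F_def F'_def using edge_sol_works[OF l_pos g'[OF that]] by blast+
  have fF: "f e x = F e x" if "e \<in> E" "x \<in> {0..l}" for e x using that by (simp add: f_def graph_sol_def F_def)
  have df: "(f e has_real_derivative F' e x) (at x within {0..l})" if "e \<in> E" "x \<in> {0..l}" for e x
    by (rule has_field_derivative_transform_within[OF dF[OF that] zero_less_one that(2)])
      (use that in \<open>simp add: fF\<close>)
  have f': "edge_deriv len f e x = F' e x" if "e \<in> E" "x \<in> {0..l}" for e x
    using interval_vector_derivative[OF l_pos that(2) df[OF that]] that by (simp add: edge_deriv_def len_eq)
  have f'': "AE x in lebesgue_on {0..l}. edge_deriv len (edge_deriv len f) e x = - z * f e x - g e x" if e: "e \<in> E" for e
  proof (subst AE_lebesgue_on_iff_negligible)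
    show "negligible {x \<in> {0..l}. edge_deriv len (edge_deriv len f) e x \<noteq> - z * f e x - g e x}"
  proof (rule negligible_subset[OF dF'[OF e]], rule subsetI, rule ccontr)
    fix x
    assume "x \<in> {x \<in> {0..l}. edge_deriv len (edge_deriv len f) e x \<noteq> - z * f e x - g e x}"
      and "x \<notin> {x \<in> {0..l}. \<not> (F' e has_real_derivative - z * F e x - g e x) (at x within {0..l})}"
    then have x: "x \<in> {0..l}" "(F' e has_real_derivative - z * F e x - g e x) (at x within {0..l})"
      and ne: "edge_deriv len (edge_deriv len f) e x \<noteq> - z * f e x - g e x" by auto
    have "(edge_deriv len f e has_real_derivative - z * F e x - g e x) (at x within {0..l})"
      by (rule has_field_derivative_transform_within[OF x(2) zero_less_one x(1)]) (use e in \<open>simp add: f'\<close>)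
    then have "vector_derivative (edge_deriv len f e) (at x within {0..l}) = - z * F e x - g e x"
      by (rule interval_vector_derivative[OF l_pos x(1)])
    then show False using ne e x(1) by (simp add: edge_deriv_def[of len "edge_deriv len f"] len_eq fF)
    qed
  qed simp
  have acf: "abs_continuous_on 0 l (f e)" "abs_continuous_on 0 l (edge_deriv len f e)" if e: "e \<in> E" for e
  proof -
    show "abs_continuous_on 0 l (f e)"
      by (rule abs_continuous_on_cong[OF _ acF(1)[OF e]]) (simp add: fF e)
    show "abs_continuous_on 0 l (edge_deriv len f e)"
      by (rule abs_continuous_on_cong[OF _ acF(2)[OF e]]) (simp add: f' e)
  qed
  have sqf: "sq_integrable l (f e)" if "e \<in> E" for e
    using acf(1)[OF that] by (intro sq_integrable_continuous abs_continuous_on_imp_continuous_on)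
  have sqf'': "sq_integrable l (edge_deriv len (edge_deriv len f) e)" if "e \<in> E" for e
  proof (rule sq_integrable_spike[OF _ f''[OF that]])
    show "sq_integrable l (\<lambda>x. - z * f e x - g e x)"
      using sq_integrable_add[OF sq_integrable_cmult[OF sqf[OF that], of "- z"] sq_integrable_cmult[OF g'[OF that], of "- 1"]]
      by simp
  qed
  have max: "f \<in> maximal_domain E len"
    unfolding maximal_domain_def
  proof (intro CollectI conjI ballI allI impI)
    show "f \<in> L2_space E len" "edge_deriv len (edge_deriv len f) \<in> L2_space E len"
      using sqf sqf'' by (auto simp: L2_space_iff len_eq)
    show "f e x = 0" if "e \<notin> E \<or> x \<notin> {0..len e}" for e x
      using that by (auto simp: f_def graph_sol_def len_eq)
    fix e assume e: "e \<in> E"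
    show "abs_continuous_on 0 (len e) (f e)" "abs_continuous_on 0 (len e) (edge_deriv len f e)"
      using acf e by (simp_all add: len_eq)
    show "f e differentiable_on {0..len e}"
      using df[OF e] unfolding len_eq[OF e] differentiable_on_def
      by (metis has_real_derivative_iff_has_vector_derivative differentiableI_vector)
  qed
  have off: "snd p $ e = 0" if "e \<notin> E" for e
    using that arg_cong[OF p, of "\<lambda>q. snd q $ e"] by (cases p) (simp add: coupling_def load_def)
  have ends: "0 \<in> {0..l}" "l \<in> {0..l}" using l_pos by auto
  have "\<forall>v. (\<forall>e\<in>incident_edges E v. vertex_value len f v e = fst p $ v) \<and>
      (\<Sum>e\<in>incident_edges E v. outgoing_deriv len f v e) = 0"
  proof (rule vertex_conditions_iff[THEN iffD2, OF _ _ _ _ _ p])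
    fix e assume e: "e \<in> E"
    show "f e 0 = fst p $ fst e" using fF[OF e ends(1)] by (simp add: F_def edge_sol_0)
    show "edge_deriv len f e 0 = snd p $ e" using f'[OF e ends(1)] by (simp add: F'_def edge_sol_deriv_0)
    show "f e l = edge_sol z (fst p $ fst e) (snd p $ e) (g e) l" using fF[OF e ends(2)] by (simp add: F_def)
    show "edge_deriv len f e l = edge_sol_deriv z (fst p $ fst e) (snd p $ e) (g e) l"
      using f'[OF e ends(2)] by (simp add: F'_def)
  qed (rule off)
  then show "f \<in> standard_domain E len"
    using max unfolding standard_domain_def by simp
  show "ae_equal E len (laplace_minus len z f) g"
    unfolding ae_equal_def
  proof
    fix e assume e: "e \<in> E"
    show "AE x in lebesgue_on {0..len e}. laplace_minus len z f e x = g e x"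
      using f''[OF e] unfolding len_eq[OF e]
      by (rule AE_mp) (auto simp: laplace_minus_def laplace_def)
  qed
qed

text \<open>Slopes are recovered as derivatives at 0. A vertex value is recovered at the start of an
  edge or, with the help of the coupling equation, at its end.\<close>

lemma graph_sol_inj:
  assumes "coupling z p = load z g" "coupling z q = load z g" "graph_sol z g p = graph_sol z g q"
    and g: "g \<in> L2_space E len"
  shows "p = q"
proof -
  have deriv: "edge_deriv len (graph_sol z g p) e 0 = snd p $ e" if e: "e \<in> E" for e p
  proof -
    have 0: "0 \<in> {0..l}" using l_pos by simp
    have "sq_integrable l (g e)" using g e by (auto simp: L2_space_iff len_eq)
    then have "(edge_sol z (fst p $ fst e) (snd p $ e) (g e) has_real_derivative snd p $ e) (at 0 within {0..l})"
      using edge_sol_works(3)[OF l_pos _ 0] by (metis edge_sol_deriv_0)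
    then have "(graph_sol z g p e has_real_derivative snd p $ e) (at 0 within {0..l})"
      by (rule has_field_derivative_transform_within[OF _ zero_less_one 0]) (simp add: graph_sol_def e)
    then show ?thesis
      using interval_vector_derivative[OF l_pos 0] by (simp add: edge_deriv_def len_eq e)
  qed
  have off: "snd p $ e = 0" if "e \<notin> E" "coupling z p = load z g" for e p
    using that(1) arg_cong[OF that(2), of "\<lambda>q. snd q $ e"] by (cases p) (simp add: coupling_def load_def)
  have start: "fst p $ fst e = graph_sol z g p e 0" if "e \<in> E" for e p
    using that l_pos by (simp add: graph_sol_def edge_sol_0)
  have stop: "fst p $ snd e = graph_sol z g p e l" if "e \<in> E" "coupling z p = load z g" for e p
    using that(1) l_pos arg_cong[OF that(2), of "\<lambda>q. snd q $ e"]
    by (cases p) (simp add: coupling_def load_def graph_sol_def edge_sol_def algebra_simps)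
  have "fst p $ v = fst q $ v" for v
  proof -
    obtain e where "e \<in> E" "fst e = v \<or> snd e = v"
      using incident_edges_nonempty[of v] by (auto simp: incident_edges_def)
    then show ?thesis using start[of e p] start[of e q] stop[of e p] stop[of e q] assms by metis
  qed
  moreover have "snd p $ e = snd q $ e" for e
    using deriv[of e p] deriv[of e q] off[of e p] off[of e q] assms by metis
  ultimately show ?thesis by (simp add: prod_eq_iff vec_eq_iff)
qed

lemma load_0 [simp]: "load z (\<lambda>e x. 0) = 0"
  by (auto simp: load_def cint_def sint_def vec_eq_iff zero_prod_def intro!: sum.neutral)

lemma zero_in_L2: "(\<lambda>e x. 0) \<in> L2_space E len"
  by (simp add: L2_space_def)

section \<open>Norm bounds for the inverse\<close>

lemma edge_L2_norm_le:
  assumes "e \<in> E"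
  shows "sqrt (\<integral>x. (g e x)\<^sup>2 \<partial>lebesgue_on {0..l}) \<le> L2_norm E len g"
proof -
  have "(\<integral>x. (g e x)\<^sup>2 \<partial>lebesgue_on {0..len e}) \<le> (\<Sum>e\<in>E. \<integral>x. (g e x)\<^sup>2 \<partial>lebesgue_on {0..len e})"
    using assms by (intro member_le_sum) auto
  then show ?thesis unfolding L2_norm_def using assms by (simp add: len_eq)
qed

lemma L2_norm_le_sup:
  assumes "f \<in> L2_space E len" "\<And>e x. e \<in> E \<Longrightarrow> x \<in> {0..l} \<Longrightarrow> \<bar>f e x\<bar> \<le> C" "0 \<le> C"
  shows "L2_norm E len f \<le> sqrt (card E * l) * C"
proof -
  have "(\<Sum>e\<in>E. \<integral>x. (f e x)\<^sup>2 \<partial>lebesgue_on {0..len e}) \<le> (\<Sum>e\<in>E. l * C\<^sup>2)"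
  proof (rule sum_mono)
    fix e assume e: "e \<in> E"
    have "(\<integral>x. (f e x)\<^sup>2 \<partial>lebesgue_on {0..l}) \<le> (\<integral>x. C\<^sup>2 \<partial>lebesgue_on {0..l})"
    proof (rule integral_mono)
      show "integrable (lebesgue_on {0..l}) (\<lambda>x. (f e x)\<^sup>2)"
        using assms(1) e by (auto simp: L2_space_iff sq_integrable_def len_eq)
      show "integrable (lebesgue_on {0..l}) (\<lambda>x. C\<^sup>2)"
        using sq_integrable_continuous[of l "\<lambda>_. C"] by (simp add: sq_integrable_def)
      fix x assume "x \<in> space (lebesgue_on {0..l})"
      then show "(f e x)\<^sup>2 \<le> C\<^sup>2" using assms(2)[OF e, of x] power_mono[of "\<bar>f e x\<bar>" C 2] by simp
    qed
    also have "\<dots> = l * C\<^sup>2" using l_pos by (simp add: measure_restrict_space)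
    finally show "(\<integral>x. (f e x)\<^sup>2 \<partial>lebesgue_on {0..len e}) \<le> l * C\<^sup>2" by (simp add: len_eq e)
  qed
  then have "L2_norm E len f \<le> sqrt (card E * l * C\<^sup>2)"
    unfolding L2_norm_def by (intro real_sqrt_le_mono) simp
  then show ?thesis using assms(3) by (simp add: real_sqrt_mult)
qed

lemma load_bound:
  obtains K where "0 \<le> K" "\<And>g. g \<in> L2_space E len \<Longrightarrow> norm (load z g) \<le> K * L2_norm E len g"
proof -
  obtain M where M: "0 \<le> M" "\<And>g x. sq_integrable l g \<Longrightarrow> x \<in> {0..l} \<Longrightarrow>
    \<bar>cint z g x\<bar> \<le> M * sqrt (\<integral>x. (g x)\<^sup>2 \<partial>lebesgue_on {0..l}) \<and>
    \<bar>sint z g x\<bar> \<le> M * sqrt (\<integral>x. (g x)\<^sup>2 \<partial>lebesgue_on {0..l})"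
    using cint_sint_bound[of l z] by metis
  define W where "W = \<bar>csol z l\<bar> + \<bar>ssol z l\<bar> + \<bar>z * ssol z l\<bar>"
  define K where "K = (\<Sum>w\<in>(UNIV :: 'v set). \<Sum>e\<in>E. 2 * W * M) + (\<Sum>e\<in>(UNIV :: ('v \<times> 'v) set). 2 * W * M)"
  have "0 \<le> W" by (simp add: W_def)
  show ?thesis
  proof (rule that[of K])
    show "0 \<le> K" using \<open>0 \<le> W\<close> M(1) by (auto simp: K_def intro!: add_nonneg_nonneg sum_nonneg)
    fix g assume g: "g \<in> L2_space E len"
    define n where "n = L2_norm E len g"
    have "0 \<le> n" by (simp add: n_def L2_norm_def sum_nonneg)
    have PQ: "\<bar>cint z (g e) l\<bar> \<le> M * n" "\<bar>sint z (g e) l\<bar> \<le> M * n" if e: "e \<in> E" for e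
    proof -
      have "sq_integrable l (g e)" using g e by (auto simp: L2_space_iff len_eq)
      moreover have "M * sqrt (\<integral>x. (g e x)\<^sup>2 \<partial>lebesgue_on {0..l}) \<le> M * n"
        unfolding n_def using M(1) edge_L2_norm_le[OF e] by (intro mult_left_mono)
      ultimately show "\<bar>cint z (g e) l\<bar> \<le> M * n" "\<bar>sint z (g e) l\<bar> \<le> M * n"
        using M(2)[of "g e" l] l_pos by auto
    qed
    have comb: "\<bar>a * P - b * Q\<bar> \<le> 2 * W * M * n"
      if "\<bar>a\<bar> \<le> W" "\<bar>b\<bar> \<le> W" "\<bar>P\<bar> \<le> M * n" "\<bar>Q\<bar> \<le> M * n" for a b P Q
    proof -
      have "\<bar>a * P\<bar> \<le> W * (M * n)" "\<bar>b * Q\<bar> \<le> W * (M * n)"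
        using that \<open>0 \<le> W\<close> by (auto simp: abs_mult intro!: mult_mono)
      then show ?thesis by (simp add: mult.assoc)
    qed
    have W: "\<bar>csol z l\<bar> \<le> W" "\<bar>ssol z l\<bar> \<le> W" "\<bar>- z * ssol z l\<bar> \<le> W" by (auto simp: W_def)
    have nn: "0 \<le> 2 * W * M * n" using \<open>0 \<le> W\<close> M(1) \<open>0 \<le> n\<close> by simp
    have "norm (fst (load z g)) \<le> (\<Sum>w\<in>UNIV. \<bar>fst (load z g) $ w\<bar>)" by (rule norm_le_l1_cart)
    also have "\<dots> \<le> (\<Sum>w\<in>(UNIV :: 'v set). \<Sum>e\<in>E. 2 * W * M * n)"
    proof (rule sum_mono)
      fix w
      have "\<bar>fst (load z g) $ w\<bar> \<le> (\<Sum>e\<in>E. \<bar>if snd e = w then - z * ssol z l * sint z (g e) l - csol z l * cint z (g e) l else 0\<bar>)"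
        by (simp add: load_def sum_abs)
      also have "\<dots> \<le> (\<Sum>e\<in>E. 2 * W * M * n)"
        using nn comb[OF W(3,1) PQ(2,1)] by (intro sum_mono) auto
      finally show "\<bar>fst (load z g) $ w\<bar> \<le> (\<Sum>e\<in>E. 2 * W * M * n)" .
    qed
    finally have 1: "norm (fst (load z g)) \<le> (\<Sum>w\<in>(UNIV :: 'v set). \<Sum>e\<in>E. 2 * W * M * n)" .
    have "norm (snd (load z g)) \<le> (\<Sum>e\<in>UNIV. \<bar>snd (load z g) $ e\<bar>)" by (rule norm_le_l1_cart)
    also have "\<dots> \<le> (\<Sum>e\<in>(UNIV :: ('v \<times> 'v) set). 2 * W * M * n)"
      using nn W PQ by (intro sum_mono) (auto simp: load_def intro!: comb)
    finally have 2: "norm (snd (load z g)) \<le> (\<Sum>e\<in>(UNIV :: ('v \<times> 'v) set). 2 * W * M * n)" .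
    have "norm (load z g) \<le> norm (fst (load z g)) + norm (snd (load z g))"
      using norm_Pair_le[of "fst (load z g)" "snd (load z g)"] by simp
    also have "\<dots> \<le> K * n" using 1 2 by (simp add: K_def algebra_simps)
    finally show "norm (load z g) \<le> K * L2_norm E len g" by (simp add: n_def)
  qed
qed

lemma graph_sol_bound:
  obtains K where "0 \<le> K" "\<And>g p e x. g \<in> L2_space E len \<Longrightarrow> e \<in> E \<Longrightarrow> x \<in> {0..l} \<Longrightarrow>
    \<bar>graph_sol z g p e x\<bar> \<le> K * (norm p + L2_norm E len g)"
proof -
  obtain M where M: "0 \<le> M" "\<And>g x. sq_integrable l g \<Longrightarrow> x \<in> {0..l} \<Longrightarrow>
    \<bar>cint z g x\<bar> \<le> M * sqrt (\<integral>x. (g x)\<^sup>2 \<partial>lebesgue_on {0..l}) \<and>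
    \<bar>sint z g x\<bar> \<le> M * sqrt (\<integral>x. (g x)\<^sup>2 \<partial>lebesgue_on {0..l})"
    using cint_sint_bound[of l z] by metis
  have "bounded (csol z ` {0..l} \<union> ssol z ` {0..l})"
    by (auto intro!: compact_imp_bounded compact_continuous_image csol_continuous ssol_continuous)
  then obtain W where "0 < W" and W: "\<And>x. x \<in> {0..l} \<Longrightarrow> \<bar>csol z x\<bar> \<le> W \<and> \<bar>ssol z x\<bar> \<le> W"
    by (auto simp: bounded_pos)
  show ?thesis
  proof (rule that[of "2 * W * (1 + M)"])
    show "0 \<le> 2 * W * (1 + M)" using M(1) \<open>0 < W\<close> by simp
    fix g p e x assume g: "g \<in> L2_space E len" and e: "e \<in> E" and x: "x \<in> {0..l}"
    define n where "n = L2_norm E len g"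
    have "0 \<le> n" by (simp add: n_def L2_norm_def sum_nonneg)
    have "sq_integrable l (g e)" using g e by (auto simp: L2_space_iff len_eq)
    moreover have "M * sqrt (\<integral>x. (g e x)\<^sup>2 \<partial>lebesgue_on {0..l}) \<le> M * n"
      unfolding n_def using M(1) edge_L2_norm_le[OF e] by (intro mult_left_mono)
    ultimately have PQ: "\<bar>cint z (g e) x\<bar> \<le> M * n" "\<bar>sint z (g e) x\<bar> \<le> M * n"
      using M(2)[of "g e" x] x by auto
    have "\<bar>fst p $ fst e\<bar> \<le> norm p" "\<bar>snd p $ e\<bar> \<le> norm p"
      using order_trans[OF component_le_norm_cart[of "fst p" "fst e"] norm_fst_le[of "fst p" "snd p"]]
        order_trans[OF component_le_norm_cart[of "snd p" e] norm_snd_le[of "snd p" "fst p"]] by auto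
    moreover define R where "R = norm p + M * n"
    ultimately have *: "\<bar>fst p $ fst e + sint z (g e) x\<bar> \<le> R" "\<bar>snd p $ e - cint z (g e) x\<bar> \<le> R"
      using PQ by (auto simp: R_def)
    have "\<bar>edge_sol z (fst p $ fst e) (snd p $ e) (g e) x\<bar> \<le>
        \<bar>(fst p $ fst e + sint z (g e) x) * csol z x\<bar> + \<bar>(snd p $ e - cint z (g e) x) * ssol z x\<bar>"
      unfolding edge_sol_def by (rule abs_triangle_ineq)
    also have "\<dots> \<le> R * W + R * W"
      using * W[OF x] \<open>0 < W\<close> unfolding abs_mult by (intro add_mono mult_mono) auto
    also have "\<dots> = 2 * W * R" by simp
    also have "\<dots> \<le> 2 * W * ((1 + M) * (norm p + n))"
      using \<open>0 < W\<close> M(1) \<open>0 \<le> n\<close> by (intro mult_left_mono) (auto simp: R_def algebra_simps)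
    finally show "\<bar>graph_sol z g p e x\<bar> \<le> 2 * W * (1 + M) * (norm p + L2_norm E len g)"
      using e x by (simp add: graph_sol_def n_def mult.assoc)
  qed
qed

text \<open>An injective endomorphism in finite dimension is onto and bounded below. The former
  gives existence for every g, injectivity gives uniqueness, and the lower bound turns
  \<open>load_bound\<close> and \<open>graph_sol_bound\<close> into an estimate of the
  inverse.\<close>

lemma resolvent_set_if_coupling_inj:
  assumes inj: "inj (coupling z)"
  shows "z \<in> resolvent_set E len"
proof -
  have surj: "surj (coupling z)" by (rule linear_injective_imp_surjective[OF linear_coupling inj]) simp
  have "\<exists>!f. f \<in> standard_domain E len \<and> ae_equal E len (laplace_minus len z f) g" if g: "g \<in> L2_space E len" for g
  proof -
    obtain p where p: "coupling z p = load z g" using surj by (metis surjD)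
    show ?thesis
    proof (rule ex1I[of _ "graph_sol z g p"])
      show "graph_sol z g p \<in> standard_domain E len \<and> ae_equal E len (laplace_minus len z (graph_sol z g p)) g"
        using graph_sol_solves[OF g p] by blast
      fix f assume "f \<in> standard_domain E len \<and> ae_equal E len (laplace_minus len z f) g"
      then obtain q where "coupling z q = load z g" "f = graph_sol z g q" using resolvent_equation_imp by blast
      with p inj show "f = graph_sol z g p" by (metis injD)
    qed
  qed
  moreover have "\<exists>C. \<forall>f\<in>standard_domain E len. L2_norm E len f \<le> C * L2_norm E len (laplace_minus len z f)"
  proof -
    obtain b where b: "0 < b" "\<And>p. b * norm p \<le> norm (coupling z p)"
      using linear_inj_bounded_below_pos[OF linear_coupling inj] by blast
    obtain K where K: "0 \<le> K" "\<And>g. g \<in> L2_space E len \<Longrightarrow> norm (load z g) \<le> K * L2_norm E len g"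
      using load_bound by blast
    obtain K' where K': "0 \<le> K'" "\<And>g p e x. g \<in> L2_space E len \<Longrightarrow> e \<in> E \<Longrightarrow> x \<in> {0..l} \<Longrightarrow>
        \<bar>graph_sol z g p e x\<bar> \<le> K' * (norm p + L2_norm E len g)"
      using graph_sol_bound by metis
    show ?thesis
    proof (intro exI ballI)
      fix f assume f: "f \<in> standard_domain E len"
      define g where "g = laplace_minus len z f"
      define n where "n = L2_norm E len g"
      have "0 \<le> n" by (simp add: n_def L2_norm_def sum_nonneg)
      have L2: "f \<in> L2_space E len" "edge_deriv len (edge_deriv len f) \<in> L2_space E len"
        using f by (auto simp: standard_domain_def maximal_domain_def)
      have g: "g \<in> L2_space E len"
        unfolding L2_space_iff
      proof
        fix e assume "e \<in> E"
        then have "sq_integrable (len e) (\<lambda>x. - 1 * edge_deriv len (edge_deriv len f) e x + - z * f e x)"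
          using L2 by (intro sq_integrable_add sq_integrable_cmult) (auto simp: L2_space_iff)
        then show "sq_integrable (len e) (g e)" by (simp add: g_def laplace_minus_def laplace_def)
      qed
      have "ae_equal E len (laplace_minus len z f) g" by (simp add: g_def ae_equal_def)
      then obtain p where p: "coupling z p = load z g" "f = graph_sol z g p"
        using resolvent_equation_imp[OF f] by blast
      have "b * norm p \<le> K * n" using b(2)[of p] K(2)[OF g] p(1) by (simp add: n_def)
      then have np: "norm p \<le> K / b * n" using b(1) by (simp add: field_simps)
      have "\<bar>f e x\<bar> \<le> K' * (K / b * n + n)" if "e \<in> E" "x \<in> {0..l}" for e x
      proof -
        have "\<bar>f e x\<bar> \<le> K' * (norm p + n)" unfolding p(2) n_def using K'(2) g that by blast
        also have "\<dots> \<le> K' * (K / b * n + n)" using K'(1) np by (intro mult_left_mono) auto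
        finally show ?thesis .
      qed
      then have "L2_norm E len f \<le> sqrt (card E * l) * (K' * (K / b * n + n))"
        using K' K b \<open>0 \<le> n\<close> by (intro L2_norm_le_sup L2) auto
      also have "\<dots> = sqrt (card E * l) * (K' * (K / b + 1)) * n" by (simp add: algebra_simps)
      finally show "L2_norm E len f \<le> sqrt (card E * l) * (K' * (K / b + 1)) * L2_norm E len (laplace_minus len z f)"
        by (simp add: n_def g_def)
    qed
  qed
  ultimately show ?thesis unfolding resolvent_set_def by blast
qed

text \<open>A nonzero kernel vector yields a second solution for the right-hand side 0, so
  uniqueness fails. Hence the spectrum consists of eigenvalues only.\<close>

theorem laplace_spectrum_iff: "z \<in> laplace_spectrum E len \<longleftrightarrow> (\<exists>p. p \<noteq> 0 \<and> coupling z p = 0)"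
proof
  assume "z \<in> laplace_spectrum E len"
  then have "\<not> inj (coupling z)" using resolvent_set_if_coupling_inj by (auto simp: laplace_spectrum_def)
  then show "\<exists>p. p \<noteq> 0 \<and> coupling z p = 0"
    using linear_injective_0[OF linear_coupling] by metis
next
  assume "\<exists>p. p \<noteq> 0 \<and> coupling z p = 0"
  then obtain p where p: "p \<noteq> 0" "coupling z p = load z (\<lambda>e x. 0)" by auto
  have 0: "coupling z 0 = load z (\<lambda>e x. 0)" using linear_0[OF linear_coupling] by simp
  have "graph_sol z (\<lambda>e x. 0) p \<noteq> graph_sol z (\<lambda>e x. 0) 0"
    using graph_sol_inj[OF p(2) 0 _ zero_in_L2] p(1) by blast
  then have "\<not> (\<exists>!f. f \<in> standard_domain E len \<and> ae_equal E len (laplace_minus len z f) (\<lambda>e x. 0))"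
    using graph_sol_solves[OF zero_in_L2 p(2)] graph_sol_solves[OF zero_in_L2 0] by blast
  then show "z \<in> laplace_spectrum E len"
    using zero_in_L2 by (auto simp: laplace_spectrum_def resolvent_set_def)
qed

lemma eigenspace_eq: "eigenspace E len z = graph_sol z (\<lambda>e x. 0) ` {p. coupling z p = 0}"
proof -
  have *: "ae_equal E len (laplace len f) (\<lambda>e x. z * f e x) \<longleftrightarrow>
      ae_equal E len (laplace_minus len z f) (\<lambda>e x. 0)" for f
    by (simp add: ae_equal_def laplace_minus_def)
  show ?thesis
    unfolding eigenspace_def *
    using resolvent_equation_imp[of _ z "\<lambda>e x. 0"] graph_sol_solves[OF zero_in_L2, of z]
    by (auto simp: image_iff)
qed

lemma subspace_coupling_kernel: "subspace {p. coupling z p = 0}"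
  by (rule linear_subspace_kernel[OF linear_coupling])

text \<open>For g = 0 the solution depends linearly on the vertex values and slopes, and
  \<open>graph_sol\<close> is injective on the kernel.\<close>

theorem laplace_multiplicity_eq: "laplace_multiplicity E len z = dim {p. coupling z p = 0}"
proof -
  let ?scale = "\<lambda>c (f :: 'v edge_fun) e x. c * f e x"
  let ?G = "graph_sol z (\<lambda>e x. 0) :: (real^'v) \<times> (real^('v \<times> 'v)) \<Rightarrow> _"
  have "inj_on ?G {p. coupling z p = 0}"
  proof (rule inj_onI)
    fix p q assume "p \<in> {p. coupling z p = 0}" "q \<in> {p. coupling z p = 0}" "?G p = ?G q"
    then show "p = q" using graph_sol_inj[of z p "\<lambda>e x. 0" q] zero_in_L2 by simp
  qed
  then have inj: "inj_on ?G (span {p. coupling z p = 0})"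
    by (subst span_eq_iff[THEN iffD2, OF subspace_coupling_kernel])
  interpret edge_funs: vector_space ?scale
    by unfold_locales (auto simp: fun_eq_iff algebra_simps)
  \<comment> \<open>The target is a vector space only by way of \<open>?scale\<close>, so the
    dimension of the image is taken from the locale with a finite-dimensional source.\<close>
  interpret pair: finite_dimensional_vector_space_pair_1 scaleR Basis ?scale
    by unfold_locales
  have "Vector_Spaces.linear scaleR ?scale ?G"
    by unfold_locales
      (auto simp: graph_sol_def edge_sol_def cint_def sint_def fun_eq_iff algebra_simps)
  then show ?thesis
    unfolding laplace_multiplicity_def eigenspace_eq using inj by (rule pair.dim_image_eq)
qed

end

section \<open>Eigenvectors of the transition matrix\<close>

text \<open>f is injective on the orthogonal complement of its kernel and already attains its whole
  range there.\<close>

lemma dim_kernel_range: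
  fixes f :: "'a::euclidean_space \<Rightarrow> 'b::euclidean_space"
  assumes "linear f"
  shows "dim {x. f x = 0} + dim (range f) = DIM('a)"
proof -
  define K where "K = {x. f x = 0}"
  define P where "P = {y. \<forall>x\<in>K. orthogonal x y}"
  have K: "subspace K" unfolding K_def by (rule linear_subspace_kernel[OF assms])
  have P: "subspace P" unfolding P_def by (rule subspace_orthogonal_to_vectors)
  have dims: "dim P + dim K = DIM('a)"
    using dim_subspace_orthogonal_to_vectors[OF K subspace_UNIV] by (simp add: P_def)
  have inj: "inj_on f P"
    unfolding linear_inj_on_iff_eq_0[OF assms P]
    by (auto simp: P_def K_def orthogonal_self)
  have "range f = f ` P"
  proof
    show "range f \<subseteq> f ` P"
    proof
      fix y assume "y \<in> range f"
      then obtain x where x: "y = f x" by auto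
      obtain u v where uv: "u \<in> span K" "\<And>w. w \<in> span K \<Longrightarrow> orthogonal v w" "x = u + v"
        using orthogonal_subspace_decomp_exists[of K x] by metis
      have "u \<in> K" using uv(1) span_eq_iff[THEN iffD2, OF K] by blast
      then have "f x = f v" using uv(3) linear_add[OF assms] by (simp add: K_def)
      moreover have "v \<in> P" using uv(2) span_base by (auto simp: P_def orthogonal_commute)
      ultimately show "y \<in> f ` P" using x by auto
    qed
  qed auto
  moreover have "dim (f ` P) = dim P"
    by (rule dim_image_eq[OF assms]) (subst span_eq_iff[THEN iffD2, OF P], rule inj)
  ultimately show ?thesis using dims by (simp add: K_def)
qed

lemma invertible_Diag:
  fixes d :: "real^'n::finite"
  assumes "\<And>i. d $ i \<noteq> 0"
  shows "invertible (Diag d)"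
  unfolding invertible_def
  using assms
  by (intro exI[of _ "Diag (\<chi> i. 1 / d $ i)"])
    (auto simp: Diag_def matrix_matrix_mult_def mat_def vec_eq_iff if_distrib[of "\<lambda>x. x * _"] cong: if_cong)

lemma matrix_inv_right:
  fixes A :: "'a::semiring_1^'n^'n"
  assumes "invertible A"
  shows "A ** matrix_inv A = mat 1"
  using someI_ex[OF assms[unfolded invertible_def]] unfolding matrix_inv_def by blast

lemma Diag_mult_vec: "(Diag d *v x) $ i = d $ i * x $ i"
  by (simp add: Diag_def matrix_vector_mult_def if_distrib[of "\<lambda>x. x * _"] cong: if_cong)

context equilateral_graph
begin

text \<open>Written over oriented edges to match the Kirchhoff sums of
  \<open>coupling\<close>.\<close>

definition neighbour_sum :: "real^'v \<Rightarrow> 'v \<Rightarrow> real" where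
  "neighbour_sum \<phi> w = (\<Sum>e\<in>E. (if fst e = w then \<phi> $ snd e else 0) + (if snd e = w then \<phi> $ fst e else 0))"

definition degree :: "'v \<Rightarrow> real" where
  "degree w = (\<Sum>e\<in>E. (if fst e = w then 1 else 0) + (if snd e = w then 1 else 0))"

lemma adjacency_mult: "(adjacency_matrix E *v \<phi>) $ w = neighbour_sum \<phi> w"
proof -
  have "(adjacency_matrix E *v \<phi>) $ w =
      (\<Sum>j\<in>UNIV. (if (w, j) \<in> E then \<phi> $ j else 0) + (if (j, w) \<in> E then \<phi> $ j else 0))"
    unfolding adjacency_matrix_def matrix_vector_mult_def
    \<comment> \<open>Two vertices are joined in at most one orientation, so no neighbour is counted
      twice.\<close>
    using not_reversed by (auto intro!: sum.cong)
  also have "\<dots> = (\<Sum>j\<in>{j. (w, j) \<in> E}. \<phi> $ j) + (\<Sum>j\<in>{j. (j, w) \<in> E}. \<phi> $ j)"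
    by (simp add: sum.distrib sum.If_cases)
  also have "(\<Sum>j\<in>{j. (w, j) \<in> E}. \<phi> $ j) = (\<Sum>e\<in>{e \<in> E. fst e = w}. \<phi> $ snd e)"
    by (rule sum.reindex_bij_witness[of _ snd "\<lambda>j. (w, j)"]) auto
  also have "(\<Sum>j\<in>{j. (j, w) \<in> E}. \<phi> $ j) = (\<Sum>e\<in>{e \<in> E. snd e = w}. \<phi> $ fst e)"
    by (rule sum.reindex_bij_witness[of _ fst "\<lambda>j. (j, w)"]) auto
  finally show ?thesis
    by (simp add: neighbour_sum_def sum.distrib sum.If_cases Int_def)
qed

lemma degree_pos: "0 < degree w"
proof -
  obtain e where "e \<in> E" "fst e = w \<or> snd e = w"
    using incident_edges_nonempty[of w] by (auto simp: incident_edges_def)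
  then show ?thesis unfolding degree_def by (intro sum_pos2[of E e]) auto
qed

lemma transition_mult: "(transition_matrix E *v \<phi>) $ w = neighbour_sum \<phi> w / degree w"
proof -
  define d where "d = adjacency_matrix E *v (\<chi> i. 1)"
  have d: "d $ i = degree i" for i
    by (simp add: d_def adjacency_mult neighbour_sum_def degree_def cong: if_cong)
  have "d $ i \<noteq> 0" for i using degree_pos[of i] d by simp
  then have "invertible (Diag d)" by (rule invertible_Diag)
  then have "Diag d *v (transition_matrix E *v \<phi>) = adjacency_matrix E *v \<phi>"
    unfolding transition_matrix_def d_def[symmetric]
    by (simp add: matrix_vector_mul_assoc matrix_mul_assoc matrix_inv_right)
  then have "degree w * (transition_matrix E *v \<phi>) $ w = neighbour_sum \<phi> w"
    by (metis Diag_mult_vec adjacency_mult d)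
  then show ?thesis using degree_pos[of w] by (simp add: field_simps)
qed

lemma transition_eigenvector_iff:
  "transition_matrix E *v \<phi> = c *\<^sub>R \<phi> \<longleftrightarrow> (\<forall>w. neighbour_sum \<phi> w = c * degree w * \<phi> $ w)"
proof -
  have "neighbour_sum \<phi> w / degree w = c * \<phi> $ w \<longleftrightarrow> neighbour_sum \<phi> w = c * degree w * \<phi> $ w" for w
    using degree_pos[of w] by (simp add: field_simps)
  then show ?thesis by (simp add: vec_eq_iff transition_mult)
qed

text \<open>Double counting of incidences. It serves the energy identity and the adjointness between
  the signed coboundary and the flow condition.\<close>

lemma sum_vertices_edges:
  fixes h k :: "'v \<times> 'v \<Rightarrow> 'v \<Rightarrow> real"
  shows "(\<Sum>w\<in>UNIV. \<Sum>e\<in>E. (if fst e = w then h e w else 0) + (if snd e = w then k e w else 0)) =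
     (\<Sum>e\<in>E. h e (fst e) + k e (snd e))"
  by (subst sum.swap) (simp add: sum.distrib)

text \<open>For \<epsilon> = 1 the constant vectors, by connectedness; for \<epsilon> = -1 the
  vectors that change sign along every edge.\<close>

definition alternating :: "real \<Rightarrow> (real^'v) set" where
  "alternating \<epsilon> = {\<phi>. \<forall>e\<in>E. \<phi> $ fst e = \<epsilon> * \<phi> $ snd e}"

lemma subspace_alternating: "subspace (alternating \<epsilon>)"
  by (auto simp: subspace_def alternating_def algebra_simps)

text \<open>The left-hand side is a signed Dirichlet energy. Its nonnegativity bounds the
  eigenvalues, and its vanishing for c = \<epsilon> identifies the eigenvectors at the two extreme
  values.\<close>

lemma transition_eigenvector_energy:
  assumes eig: "transition_matrix E *v \<phi> = c *\<^sub>R \<phi>" and "\<epsilon>\<^sup>2 = 1"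
  shows "(\<Sum>e\<in>E. (\<phi> $ fst e - \<epsilon> * \<phi> $ snd e)\<^sup>2) = (1 - \<epsilon> * c) * (\<Sum>w\<in>UNIV. degree w * (\<phi> $ w)\<^sup>2)"
proof -
  have "(\<Sum>w\<in>UNIV. degree w * (\<phi> $ w)\<^sup>2) =
      (\<Sum>w\<in>UNIV. \<Sum>e\<in>E. (if fst e = w then (\<phi> $ w)\<^sup>2 else 0) + (if snd e = w then (\<phi> $ w)\<^sup>2 else 0))"
    unfolding degree_def sum_distrib_right by (intro sum.cong refl) (auto simp: algebra_simps)
  then have deg: "(\<Sum>w\<in>UNIV. degree w * (\<phi> $ w)\<^sup>2) = (\<Sum>e\<in>E. (\<phi> $ fst e)\<^sup>2 + (\<phi> $ snd e)\<^sup>2)"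
    by (simp add: sum_vertices_edges)
  have "c * (\<Sum>w\<in>UNIV. degree w * (\<phi> $ w)\<^sup>2) = (\<Sum>w\<in>UNIV. \<phi> $ w * neighbour_sum \<phi> w)"
    using eig unfolding transition_eigenvector_iff sum_distrib_left
    by (intro sum.cong) (auto simp: power2_eq_square)
  also have "\<dots> = (\<Sum>w\<in>UNIV. \<Sum>e\<in>E. (if fst e = w then \<phi> $ w * \<phi> $ snd e else 0) + (if snd e = w then \<phi> $ w * \<phi> $ fst e else 0))"
    unfolding neighbour_sum_def sum_distrib_left by (intro sum.cong refl) (auto simp: algebra_simps)
  also have "\<dots> = (\<Sum>e\<in>E. \<phi> $ fst e * \<phi> $ snd e + \<phi> $ snd e * \<phi> $ fst e)"
    by (rule sum_vertices_edges)
  finally have nb: "c * (\<Sum>w\<in>UNIV. degree w * (\<phi> $ w)\<^sup>2) = (\<Sum>e\<in>E. \<phi> $ fst e * \<phi> $ snd e + \<phi> $ snd e * \<phi> $ fst e)" .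
  have "(1 - \<epsilon> * c) * (\<Sum>w\<in>UNIV. degree w * (\<phi> $ w)\<^sup>2) =
      (\<Sum>w\<in>UNIV. degree w * (\<phi> $ w)\<^sup>2) - \<epsilon> * (c * (\<Sum>w\<in>UNIV. degree w * (\<phi> $ w)\<^sup>2))"
    by (simp add: left_diff_distrib mult.assoc)
  also have "\<dots> = (\<Sum>e\<in>E. (\<phi> $ fst e)\<^sup>2 + (\<phi> $ snd e)\<^sup>2 - \<epsilon> * (\<phi> $ fst e * \<phi> $ snd e + \<phi> $ snd e * \<phi> $ fst e))"
    unfolding nb unfolding deg by (simp add: sum_subtractf sum_distrib_left)
  also have "\<dots> = (\<Sum>e\<in>E. (\<phi> $ fst e - \<epsilon> * \<phi> $ snd e)\<^sup>2)"
    using assms(2) by (intro sum.cong) (auto simp: power2_diff power_mult_distrib)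
  finally show ?thesis ..
qed

lemma transition_eigenspace_alternating:
  assumes "\<epsilon>\<^sup>2 = 1"
  shows "{\<phi>. transition_matrix E *v \<phi> = \<epsilon> *\<^sub>R \<phi>} = alternating \<epsilon>"
proof (intro set_eqI iffI; simp)
  fix \<phi> assume "transition_matrix E *v \<phi> = \<epsilon> *\<^sub>R \<phi>"
  from transition_eigenvector_energy[OF this assms] have "(\<Sum>e\<in>E. (\<phi> $ fst e - \<epsilon> * \<phi> $ snd e)\<^sup>2) = 0"
    using assms by (simp add: power2_eq_square)
  then have "\<forall>e\<in>E. (\<phi> $ fst e - \<epsilon> * \<phi> $ snd e)\<^sup>2 = 0" by (subst (asm) sum_nonneg_eq_0_iff) auto
  then show "\<phi> \<in> alternating \<epsilon>" by (simp add: alternating_def)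
next
  fix \<phi> assume \<phi>: "\<phi> \<in> alternating \<epsilon>"
  have *: "\<phi> $ fst e = \<epsilon> * \<phi> $ snd e" "\<phi> $ snd e = \<epsilon> * \<phi> $ fst e" if "e \<in> E" for e
  proof -
    show 1: "\<phi> $ fst e = \<epsilon> * \<phi> $ snd e" using \<phi> that by (simp add: alternating_def)
    have "\<epsilon> * \<phi> $ fst e = \<epsilon>\<^sup>2 * \<phi> $ snd e" by (simp add: 1 power2_eq_square)
    then show "\<phi> $ snd e = \<epsilon> * \<phi> $ fst e" using assms by simp
  qed
  show "transition_matrix E *v \<phi> = \<epsilon> *\<^sub>R \<phi>"
    unfolding transition_eigenvector_iff
  proof
    fix w
    have "neighbour_sum \<phi> w = (\<Sum>e\<in>E. \<epsilon> * ((if fst e = w then 1 else 0) + (if snd e = w then 1 else 0)) * \<phi> $ w)"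
      unfolding neighbour_sum_def by (intro sum.cong) (auto simp: * algebra_simps)
    then show "neighbour_sum \<phi> w = \<epsilon> * degree w * \<phi> $ w"
      by (simp add: degree_def sum_distrib_left sum_distrib_right)
  qed
qed

text \<open>For c > 1 the energy would be negative unless the degree-weighted norm vanishes, and all
  degrees are positive. Applied with a value of cosh, this excludes negative z.\<close>

lemma transition_eigenvalue_le_1:
  assumes "transition_matrix E *v \<phi> = c *\<^sub>R \<phi>" "1 < c"
  shows "\<phi> = 0"
proof -
  have "0 \<le> (\<Sum>e\<in>E. (\<phi> $ fst e - 1 * \<phi> $ snd e)\<^sup>2)" by (simp add: sum_nonneg)
  then have "0 \<le> (1 - c) * (\<Sum>w\<in>UNIV. degree w * (\<phi> $ w)\<^sup>2)"
    using transition_eigenvector_energy[OF assms(1), of 1] by simp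
  then have "(\<Sum>w\<in>UNIV. degree w * (\<phi> $ w)\<^sup>2) \<le> 0"
    using assms(2) by (simp add: zero_le_mult_iff)
  moreover have nn: "0 \<le> degree w * (\<phi> $ w)\<^sup>2" for w using degree_pos[of w] by simp
  ultimately have "(\<Sum>w\<in>UNIV. degree w * (\<phi> $ w)\<^sup>2) = 0" by (simp add: order_antisym sum_nonneg)
  then have "degree w * (\<phi> $ w)\<^sup>2 = 0" for w using nn by (subst (asm) sum_nonneg_eq_0_iff) auto
  then show ?thesis using degree_pos by (simp add: vec_eq_iff) (metis less_irrefl)
qed

lemma constant_if_constant_on_edges:
  assumes "\<And>e. e \<in> E \<Longrightarrow> h (fst e) = h (snd e)"
  shows "h u = h v"
  using connected[of u v]
proof (induction rule: rtrancl_induct)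
  case (step y w)
  then have "h y = h w" using assms[of "(y, w)"] assms[of "(w, y)"] by auto
  with step.IH show ?case by simp
qed simp

text \<open>The factor \<epsilon> cancels in the quotient of two such vectors, which is therefore
  constant along edges and, by connectedness, everywhere.\<close>

lemma dim_alternating:
  assumes "\<psi> \<in> alternating \<epsilon>" "\<And>w. \<psi> $ w \<noteq> 0" "\<epsilon> \<noteq> 0"
  shows "dim (alternating \<epsilon>) = 1"
proof -
  have "alternating \<epsilon> = span {\<psi>}"
  proof
    show "span {\<psi>} \<subseteq> alternating \<epsilon>" using assms(1) subspace_alternating by (simp add: span_minimal)
    show "alternating \<epsilon> \<subseteq> span {\<psi>}"
    proof
      fix \<phi> assume \<phi>: "\<phi> \<in> alternating \<epsilon>"
      have "\<phi> $ fst e / \<psi> $ fst e = \<phi> $ snd e / \<psi> $ snd e" if "e \<in> E" for e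
        using that \<phi> assms(1,3) by (simp add: alternating_def)
      then have const: "\<phi> $ u / \<psi> $ u = \<phi> $ v / \<psi> $ v" for u v
        by (rule constant_if_constant_on_edges[of "\<lambda>w. \<phi> $ w / \<psi> $ w"])
      fix v0 :: 'v
      define r where "r = \<phi> $ v0 / \<psi> $ v0"
      have "\<phi> $ w = r * \<psi> $ w" for w
        using const[of w v0] assms(2)[of w] unfolding r_def[symmetric] by (simp add: divide_eq_eq)
      then have "\<phi> = r *\<^sub>R \<psi>" by (simp add: vec_eq_iff)
      then show "\<phi> \<in> span {\<psi>}" unfolding span_singleton by (rule range_eqI)
    qed
  qed
  moreover have "\<psi> \<noteq> 0" using assms(2) by auto
  ultimately show ?thesis by simp
qed

lemma dim_alternating_1: "dim (alternating 1) = 1"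
  by (rule dim_alternating[of "\<chi> w. 1"]) (auto simp: alternating_def)

lemma dim_alternating_bipartite:
  assumes "bipartite E"
  shows "dim (alternating (- 1)) = 1"
proof -
  obtain A B where AB: "A \<union> B = UNIV" "A \<inter> B = {}" "\<forall>(u, v)\<in>E. u \<in> A \<and> v \<in> B \<or> u \<in> B \<and> v \<in> A"
    using assms unfolding bipartite_def by auto
  have "(\<chi> w. if w \<in> A then 1 :: real else - 1) \<in> alternating (- 1)"
    unfolding alternating_def
  proof (intro CollectI ballI)
    fix e assume "e \<in> E"
    then have "fst e \<in> A \<and> snd e \<in> B \<or> fst e \<in> B \<and> snd e \<in> A" using AB(3) by (cases e) auto
    moreover have "w \<notin> A" if "w \<in> B" for w using that AB(2) by auto
    ultimately show "(\<chi> w. if w \<in> A then 1 :: real else - 1) $ fst e = - 1 * ((\<chi> w. if w \<in> A then 1 else - 1) $ snd e)"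
      by auto
  qed
  then show ?thesis by (rule dim_alternating) auto
qed

text \<open>A nonzero vector of this kind has constant modulus, hence no zero entry, and its signs
  form a bipartition.\<close>

lemma alternating_non_bipartite:
  assumes "\<not> bipartite E"
  shows "alternating (- 1) = {0}"
proof -
  have "\<phi> = 0" if \<phi>: "\<phi> \<in> alternating (- 1)" for \<phi>
  proof (rule ccontr)
    assume "\<phi> \<noteq> 0"
    then obtain v where "\<phi> $ v \<noteq> 0" by (auto simp: vec_eq_iff)
    have alt: "\<phi> $ fst e = - \<phi> $ snd e" if "e \<in> E" for e using \<phi> that by (simp add: alternating_def)
    have "\<bar>\<phi> $ w\<bar> = \<bar>\<phi> $ v\<bar>" for w
      by (rule constant_if_constant_on_edges[of "\<lambda>w. \<bar>\<phi> $ w\<bar>"]) (simp add: alt)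
    with \<open>\<phi> $ v \<noteq> 0\<close> have nz: "\<phi> $ w \<noteq> 0" for w by (metis abs_eq_0)
    have "bipartite E"
      unfolding bipartite_def
    proof (intro exI conjI)
      show "{w. 0 < \<phi> $ w} \<union> {w. \<phi> $ w < 0} = UNIV" using nz by (auto simp: neq_iff)
      show "\<forall>(a, b)\<in>E. a \<in> {w. 0 < \<phi> $ w} \<and> b \<in> {w. \<phi> $ w < 0} \<or> a \<in> {w. \<phi> $ w < 0} \<and> b \<in> {w. 0 < \<phi> $ w}"
      proof clarify
        fix a b assume "(a, b) \<in> E" and no: "\<not> (a \<in> {w. \<phi> $ w < 0} \<and> b \<in> {w. 0 < \<phi> $ w})"
        then have "\<phi> $ a = - \<phi> $ b" using alt[of "(a, b)"] by simp
        then show "a \<in> {w. 0 < \<phi> $ w} \<and> b \<in> {w. \<phi> $ w < 0}" using no nz[of a] by auto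
      qed
    qed auto
    with assms show False by blast
  qed
  then show ?thesis using subspace_0[OF subspace_alternating] by auto
qed

section \<open>The kernel of the coupling map\<close>

lemma coupling_eq_0_iff:
  "coupling z (\<phi>, B) = 0 \<longleftrightarrow>
     (\<forall>e. e \<notin> E \<longrightarrow> B $ e = 0) \<and>
     (\<forall>e\<in>E. csol z l * \<phi> $ fst e + ssol z l * B $ e = \<phi> $ snd e) \<and>
     (\<forall>w. (\<Sum>e\<in>E. (if fst e = w then B $ e else 0)
            - (if snd e = w then csol z l * B $ e - z * ssol z l * \<phi> $ fst e else 0)) = 0)"
  unfolding coupling_def zero_prod_def by (auto simp: vec_eq_iff)

lemma coupling_kernel_regular:
  assumes s: "ssol z l \<noteq> 0"
  shows "{p. coupling z p = 0} =
    (\<lambda>\<phi>. (\<phi>, \<chi> e. if e \<in> E then (\<phi> $ snd e - csol z l * \<phi> $ fst e) / ssol z l else 0)) `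
      {\<phi>. transition_matrix E *v \<phi> = csol z l *\<^sub>R \<phi>}"
proof -
  define c where "c = csol z l"
  define s where "s = ssol z l"
  have "s \<noteq> 0" using assms by (simp add: s_def)
  have cs: "c * c + z * s * s = 1" using csol_ssol_square[of z l] by (simp add: c_def s_def power2_eq_square mult.assoc)
  define L :: "real^'v \<Rightarrow> real^('v \<times> 'v)" where "L \<phi> = (\<chi> e. if e \<in> E then (\<phi> $ snd e - c * \<phi> $ fst e) / s else 0)" for \<phi>
  \<comment> \<open>Multiplication by s clears the denominator of the slopes. At a terminal end the
    Wronskian identity leaves \<phi>(u) - c \<phi>(v), the mirror image of the initial end, so the
    orientation of the edge disappears.\<close>
  have kirchhoff: "s * (\<Sum>e\<in>E. (if fst e = w then L \<phi> $ e else 0) - (if snd e = w then c * L \<phi> $ e - z * s * \<phi> $ fst e else 0))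
      = neighbour_sum \<phi> w - c * degree w * \<phi> $ w" for \<phi> w
  proof -
    have "s * (c * ((\<phi> $ v - c * \<phi> $ u) / s) - z * s * \<phi> $ u) = c * \<phi> $ v - (c * c + z * s * s) * \<phi> $ u" for u v
      using \<open>s \<noteq> 0\<close> by (simp add: field_simps)
    then have e2: "s * (c * ((\<phi> $ v - c * \<phi> $ u) / s) - z * s * \<phi> $ u) = c * \<phi> $ v - \<phi> $ u" for u v
      by (simp add: cs)
    have e3: "s * (z * s * \<phi> $ u - c * (\<phi> $ v - c * \<phi> $ u) / s) = \<phi> $ u - c * \<phi> $ v" for u v
      using e2[of v u] by (simp add: right_diff_distrib)
    have "s * (\<Sum>e\<in>E. (if fst e = w then L \<phi> $ e else 0) - (if snd e = w then c * L \<phi> $ e - z * s * \<phi> $ fst e else 0))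
      = (\<Sum>e\<in>E. ((if fst e = w then \<phi> $ snd e else 0) + (if snd e = w then \<phi> $ fst e else 0)) -
          c * ((if fst e = w then 1 else 0) + (if snd e = w then 1 else 0)) * \<phi> $ w)"
      unfolding sum_distrib_left
    proof (rule sum.cong[OF refl])
      fix e assume e: "e \<in> E"
      then have "L \<phi> $ e = (\<phi> $ snd e - c * \<phi> $ fst e) / s" by (simp add: L_def)
      then show "s * ((if fst e = w then L \<phi> $ e else 0) - (if snd e = w then c * L \<phi> $ e - z * s * \<phi> $ fst e else 0)) =
          ((if fst e = w then \<phi> $ snd e else 0) + (if snd e = w then \<phi> $ fst e else 0)) -
          c * ((if fst e = w then 1 else 0) + (if snd e = w then 1 else 0)) * \<phi> $ w"
        using no_loop[OF e] \<open>s \<noteq> 0\<close> e3[of "fst e" "snd e"] by auto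
    qed
    then show ?thesis
      by (simp add: sum_subtractf neighbour_sum_def degree_def sum_distrib_left sum_distrib_right)
  qed
  have cancel: "x = 0 \<longleftrightarrow> y = b" if "s * x = y - b" for x y b
    using that \<open>s \<noteq> 0\<close> by auto
  have "coupling z (\<phi>, B) = 0 \<longleftrightarrow> B = L \<phi> \<and> transition_matrix E *v \<phi> = c *\<^sub>R \<phi>" for \<phi> B
  proof -
    have "(\<forall>e. e \<notin> E \<longrightarrow> B $ e = 0) \<and> (\<forall>e\<in>E. c * \<phi> $ fst e + s * B $ e = \<phi> $ snd e) \<longleftrightarrow> B = L \<phi>"
      using \<open>s \<noteq> 0\<close> by (auto simp: L_def vec_eq_iff field_simps)
    moreover have "(\<Sum>e\<in>E. (if fst e = w then L \<phi> $ e else 0) - (if snd e = w then c * L \<phi> $ e - z * s * \<phi> $ fst e else 0)) = 0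
        \<longleftrightarrow> neighbour_sum \<phi> w = c * degree w * \<phi> $ w" for w
      by (rule cancel[OF kirchhoff])
    ultimately show ?thesis
      unfolding coupling_eq_0_iff transition_eigenvector_iff c_def[symmetric] s_def[symmetric] by blast
  qed
  then show ?thesis unfolding c_def[symmetric] s_def[symmetric] L_def[symmetric] by auto
qed

lemma dim_coupling_kernel_regular:
  assumes "ssol z l \<noteq> 0"
  shows "dim {p. coupling z p = 0} = dim {\<phi>. transition_matrix E *v \<phi> = csol z l *\<^sub>R \<phi>}"
  unfolding coupling_kernel_regular[OF assms]
proof (rule dim_image_eq)
  show "linear (\<lambda>\<phi> :: real^'v. (\<phi>, \<chi> e. if e \<in> E then (\<phi> $ snd e - csol z l * \<phi> $ fst e) / ssol z l else 0))"
    by (rule linearI) (auto simp: vec_eq_iff algebra_simps add_divide_distrib diff_divide_distrib)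
qed (auto intro: inj_onI)

text \<open>The flow space is the orthogonal complement, inside \<open>\<real>\<^sup>E\<close>, of the range of the signed coboundary map.\<close>

definition flows :: "real \<Rightarrow> (real^('v \<times> 'v)) set" where
  "flows \<epsilon> = {B. (\<forall>e. e \<notin> E \<longrightarrow> B $ e = 0) \<and>
     (\<forall>w. (\<Sum>e\<in>E. (if fst e = w then B $ e else 0) - (if snd e = w then \<epsilon> * B $ e else 0)) = 0)}"

lemma subspace_flows: "subspace (flows \<epsilon>)"
proof -
  define G :: "real^('v \<times> 'v) \<Rightarrow> (real^'v) \<times> (real^('v \<times> 'v))" where "G B =
     (\<chi> w. \<Sum>e\<in>E. (if fst e = w then B $ e else 0) - (if snd e = w then \<epsilon> * B $ e else 0),
      \<chi> e. if e \<in> E then 0 else B $ e)" for B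
  have "linear G"
  proof (rule linearI)
    show "G (x + y) = G x + G y" for x y
      by (auto simp: G_def vec_eq_iff algebra_simps sum.distrib[symmetric] sum_subtractf[symmetric] intro!: sum.cong)
    show "G (r *\<^sub>R x) = r *\<^sub>R G x" for r x
      by (auto simp: G_def vec_eq_iff algebra_simps sum_distrib_left intro!: sum.cong)
  qed
  then have "subspace {B. G B = 0}" by (rule linear_subspace_kernel)
  moreover have "flows \<epsilon> = {B. G B = 0}"
    by (auto simp: flows_def G_def vec_eq_iff zero_prod_def)
  ultimately show ?thesis by simp
qed

text \<open>The map \<open>D\<close> in the proof is the signed coboundary: its kernel is
  \<open>alternating \<epsilon>\<close>, and the flows are the complement of its range inside a
  space of dimension N. For \<epsilon> = 1 this is the cycle space, of dimension N - n + 1.\<close>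

lemma dim_flows: "int (dim (flows \<epsilon>)) = int (card E) - int CARD('v) + int (dim (alternating \<epsilon>))"
proof -
  define V where "V = {B :: real^('v \<times> 'v). \<forall>e. e \<notin> E \<longrightarrow> B $ e = 0}"
  define D :: "real^'v \<Rightarrow> real^('v \<times> 'v)" where "D \<phi> = (\<chi> e. if e \<in> E then \<phi> $ fst e - \<epsilon> * \<phi> $ snd e else 0)" for \<phi>
  have lin: "linear D" by (rule linearI) (auto simp: D_def vec_eq_iff algebra_simps)
  have V: "subspace V" by (auto simp: V_def subspace_def)
  have "dim V = card E"
    unfolding V_def using dim_substandard_cart[of E, where 'a=real] by (simp add: dim_vec_eq)
  have inner: "D \<phi> \<bullet> B = (\<Sum>w\<in>UNIV. \<phi> $ w * (\<Sum>e\<in>E. (if fst e = w then B $ e else 0) - (if snd e = w then \<epsilon> * B $ e else 0)))" for \<phi> B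
  proof -
    have "D \<phi> \<bullet> B = (\<Sum>e\<in>UNIV. if e \<in> E then (\<phi> $ fst e - \<epsilon> * \<phi> $ snd e) * B $ e else 0)"
      by (auto simp: inner_vec_def D_def intro!: sum.cong)
    also have "\<dots> = (\<Sum>e\<in>E. \<phi> $ fst e * B $ e + (- (\<phi> $ snd e * (\<epsilon> * B $ e))))"
      by (simp add: sum.If_cases) (auto intro!: sum.cong simp: algebra_simps)
    also have "\<dots> = (\<Sum>w\<in>UNIV. \<Sum>e\<in>E. (if fst e = w then \<phi> $ w * B $ e else 0) + (if snd e = w then - (\<phi> $ w * (\<epsilon> * B $ e)) else 0))"
      by (rule sum_vertices_edges[symmetric])
    also have "\<dots> = (\<Sum>w\<in>UNIV. \<phi> $ w * (\<Sum>e\<in>E. (if fst e = w then B $ e else 0) - (if snd e = w then \<epsilon> * B $ e else 0)))"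
      unfolding sum_distrib_left by (intro sum.cong refl) (auto simp: algebra_simps)
    finally show ?thesis .
  qed
  have "flows \<epsilon> = {B \<in> V. \<forall>x\<in>range D. orthogonal x B}"
  proof (intro set_eqI iffI)
    fix B assume "B \<in> flows \<epsilon>"
    then show "B \<in> {B \<in> V. \<forall>x\<in>range D. orthogonal x B}"
      by (auto simp: flows_def V_def orthogonal_def inner)
  next
    fix B assume B: "B \<in> {B \<in> V. \<forall>x\<in>range D. orthogonal x B}"
    have "(\<Sum>e\<in>E. (if fst e = w then B $ e else 0) - (if snd e = w then \<epsilon> * B $ e else 0)) = 0" for w
    proof -
      \<comment> \<open>Testing against the coboundary of a vertex indicator isolates the flow
        condition at that vertex.\<close>
      have "D (axis w 1) \<bullet> B = 0" using B by (auto simp: orthogonal_def)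
      then show ?thesis unfolding inner by (simp add: axis_def if_distrib[of "\<lambda>x. x * _"] cong: if_cong)
    qed
    then show "B \<in> flows \<epsilon>" using B by (auto simp: flows_def V_def)
  qed
  moreover have "dim {B \<in> V. \<forall>x\<in>range D. orthogonal x B} + dim (range D) = dim V"
    by (intro dim_subspace_orthogonal_to_vectors V linear_subspace_image[OF lin subspace_UNIV])
      (auto simp: D_def V_def)
  ultimately have "dim (flows \<epsilon>) + dim (range D) = card E"
    using \<open>dim V = card E\<close> by simp
  moreover have "{\<phi>. D \<phi> = 0} = alternating \<epsilon>"
    by (auto simp: D_def alternating_def vec_eq_iff)
  then have "dim (alternating \<epsilon>) + dim (range D) = CARD('v)"
    using dim_kernel_range[OF lin] by simp
  ultimately show ?thesis by linarith
qed

text \<open>With \<open>ssol z l = 0\<close> the mismatch equations involve only \<phi> and the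
  Kirchhoff sums only B, so the system decouples. As \<epsilon> is its own inverse, the orientation
  of an edge does not affect the condition on \<phi>.\<close>

lemma coupling_kernel_singular:
  assumes "ssol z l = 0" "csol z l = \<epsilon>" "\<epsilon>\<^sup>2 = 1"
  shows "{p. coupling z p = 0} = alternating \<epsilon> \<times> flows \<epsilon>"
proof -
  have "\<epsilon> = 1 \<or> \<epsilon> = - 1" using assms(3) by (simp add: power2_eq_1_iff)
  then have "\<epsilon> * \<phi> $ u = \<phi> $ v \<longleftrightarrow> \<phi> $ u = \<epsilon> * \<phi> $ v" for \<phi> :: "real^'v" and u v by auto
  then have "(\<forall>e\<in>E. \<epsilon> * \<phi> $ fst e + 0 * B $ e = \<phi> $ snd e) \<longleftrightarrow> \<phi> \<in> alternating \<epsilon>"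
    for \<phi> and B :: "real^('v \<times> 'v)"
    unfolding alternating_def by simp
  then have "coupling z (\<phi>, B) = 0 \<longleftrightarrow> \<phi> \<in> alternating \<epsilon> \<and> B \<in> flows \<epsilon>" for \<phi> B
    unfolding coupling_eq_0_iff flows_def assms(1,2) mult_zero_right mult_zero_left diff_0_right by blast
  then show ?thesis by auto
qed

text \<open>The factor 2 arises because \<open>alternating \<epsilon>\<close> counts once as a
  factor of the kernel and once inside \<open>dim_flows\<close>.\<close>

lemma dim_coupling_kernel_singular:
  assumes "ssol z l = 0" "csol z l = \<epsilon>" "\<epsilon>\<^sup>2 = 1"
  shows "int (dim {p. coupling z p = 0}) = int (card E) - int CARD('v) + 2 * int (dim (alternating \<epsilon>))"
  unfolding coupling_kernel_singular[OF assms]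
  using dim_Times[OF subspace_alternating subspace_flows, of \<epsilon> \<epsilon>] dim_flows[of \<epsilon>] by simp

lemma spectrum_iff_dim: "z \<in> laplace_spectrum E len \<longleftrightarrow> dim {p. coupling z p = 0} \<noteq> 0"
  unfolding laplace_spectrum_iff by auto

lemma eigenvalue_iff_dim: "c \<in> eigenvalues (transition_matrix E) \<longleftrightarrow>
    dim {\<phi>. transition_matrix E *v \<phi> = c *\<^sub>R \<phi>} \<noteq> 0"
  unfolding eigenvalues_def by auto

section \<open>Spectrum and multiplicities\<close>

lemma csol_nonneg: "0 \<le> z \<Longrightarrow> csol z l = cos (sqrt z * l)"
  by (auto simp: csol_def)

text \<open>At z = 0 the sine vanishes but \<open>ssol 0 l = l\<close> does not; this is why the
  multiplicity at 0 is 1 and not N - n + 2.\<close>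

lemma ssol_eq_0_iff: "0 \<le> z \<Longrightarrow> ssol z l = 0 \<longleftrightarrow> 0 < z \<and> sin (sqrt z * l) = 0"
  using l_pos by (auto simp: ssol_def)

lemma negative_not_in_spectrum:
  assumes "z < 0"
  shows "z \<notin> laplace_spectrum E len"
proof -
  have pos: "0 < sqrt (- z) * l" using assms l_pos by simp
  then have "sinh (sqrt (- z) * l) \<noteq> 0" "1 < cosh (sqrt (- z) * l)"
    using cosh_real_strict_mono[of 0 "sqrt (- z) * l"] by auto
  then have s: "ssol z l \<noteq> 0" and c: "1 < csol z l"
    using assms by (auto simp: ssol_def csol_def)
  have "{\<phi>. transition_matrix E *v \<phi> = csol z l *\<^sub>R \<phi>} \<subseteq> {0}"
    using transition_eigenvalue_le_1[OF _ c] by auto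
  then show ?thesis
    unfolding spectrum_iff_dim dim_coupling_kernel_regular[OF s] by simp
qed

lemma eigenvalue_iff_alternating:
  assumes "\<epsilon>\<^sup>2 = 1"
  shows "\<epsilon> \<in> eigenvalues (transition_matrix E) \<longleftrightarrow> dim (alternating \<epsilon>) \<noteq> 0"
  unfolding eigenvalue_iff_dim transition_eigenspace_alternating[OF assms] ..

lemma dim_alternating_minus_1: "dim (alternating (- 1)) = (if bipartite E then 1 else 0)"
  by (simp add: dim_alternating_bipartite alternating_non_bipartite)

lemma multiplicity_0: "dim {p. coupling 0 p = 0} = 1"
  using dim_coupling_kernel_regular[of 0] transition_eigenspace_alternating[of 1] l_pos dim_alternating_1
  by (simp add: ssol_def csol_def)

lemma dim_coupling_kernel_cos:
  assumes "0 < z" "cos (sqrt z * l) = \<epsilon>" "\<epsilon>\<^sup>2 = 1"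
  shows "int (dim {p. coupling z p = 0}) = int (card E) - int CARD('v) + 2 * int (dim (alternating \<epsilon>))"
proof (rule dim_coupling_kernel_singular)
  have "sin (sqrt z * l) = 0" using sin_cos_squared_add[of "sqrt z * l"] assms(2,3) by simp
  then show "ssol z l = 0" using assms(1) ssol_eq_0_iff by simp
  show "csol z l = \<epsilon>" using assms(1,2) csol_nonneg by simp
qed (rule assms)

lemma positive_in_spectrum_iff:
  assumes "0 < z"
  shows "z \<in> laplace_spectrum E len \<longleftrightarrow>
    cos (sqrt z * l) \<in> eigenvalues (transition_matrix E) \<or>
    cos (sqrt z * l) = - 1 \<and> (card E \<noteq> CARD('v) \<or> bipartite E)"
proof (cases "sin (sqrt z * l) = 0")
  case False
  then have "cos (sqrt z * l) \<noteq> - 1" using sin_squared_eq[of "sqrt z * l"] by auto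
  moreover have "ssol z l \<noteq> 0" using False assms ssol_eq_0_iff by simp
  ultimately show ?thesis
    using assms by (simp add: spectrum_iff_dim eigenvalue_iff_dim dim_coupling_kernel_regular csol_nonneg)
next
  case True
  then have "(cos (sqrt z * l))\<^sup>2 = 1" using sin_cos_squared_add[of "sqrt z * l"] by simp
  then consider "cos (sqrt z * l) = 1" | "cos (sqrt z * l) = - 1" by (auto simp: power2_eq_1_iff)
  then show ?thesis
  proof cases
    case 1
    have "dim {p. coupling z p = 0} \<noteq> 0"
      using dim_coupling_kernel_cos[OF assms 1 one_power2] dim_flows[of 1] unfolding dim_alternating_1 by linarith
    then show ?thesis
      using 1 eigenvalue_iff_alternating[of 1] by (simp add: spectrum_iff_dim dim_alternating_1 del: dim_eq_0)
  next
    case 2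
    \<comment> \<open>A flow space has nonnegative dimension, so N - n + 1 is nonnegative in the
      bipartite case and the kernel dimension N - n + 2 is positive. Otherwise the kernel has
      dimension N - n, which vanishes exactly for N = n.\<close>
    have "dim {p. coupling z p = 0} \<noteq> 0 \<longleftrightarrow> card E \<noteq> CARD('v) \<or> bipartite E"
      using dim_coupling_kernel_cos[OF assms 2] dim_flows[of "- 1"] unfolding dim_alternating_minus_1
      by (cases "bipartite E") (simp_all del: dim_eq_0, linarith+)
    then show ?thesis
      using 2 eigenvalue_iff_alternating[of "- 1"]
      by (auto simp: spectrum_iff_dim dim_alternating_minus_1 simp del: dim_eq_0)
  qed
qed

lemma spectrum_iff:
  "z \<in> laplace_spectrum E len \<longleftrightarrow> z = 0 \<or> 0 < z \<and>
    (cos (sqrt z * l) \<in> eigenvalues (transition_matrix E) \<or>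
     cos (sqrt z * l) = - 1 \<and> (card E \<noteq> CARD('v) \<or> bipartite E))"
proof (cases z "0 :: real" rule: linorder_cases)
  case less then show ?thesis using negative_not_in_spectrum by simp
next
  case equal then show ?thesis by (simp add: spectrum_iff_dim multiplicity_0)
next
  case greater then show ?thesis using positive_in_spectrum_iff by simp
qed

end

text \<open>The spectrum is described in two cases because the multiplicity N - n can be 0: a
  connected non-bipartite graph with N = n has exactly one cycle, of odd length, and then the points
  with cosine -1 are not eigenvalues. An edge is required since on a single point 0 would be no
  eigenvalue. The multiplicities are stated for z \<ge> 0 because \<open>sqrt\<close> takes negative
  values at negative arguments.\<close>

theorem theorem3p2:
  fixes E :: "('v::finite \<times> 'v) set" and len :: "'v \<times> 'v \<Rightarrow> real" and l :: real
  assumes "metric_graph E len" and "E \<noteq> {}" and "equilateral E len l"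
  defines "Z \<equiv> transition_matrix E"
    and "n \<equiv> int CARD('v)" and "N \<equiv> int (card E)"
  shows "(N \<noteq> n \<or> bipartite E \<longrightarrow>
           laplace_spectrum E len =
             {0} \<union> {z. z > 0 \<and> cos (sqrt z * l) \<in> eigenvalues Z}
                 \<union> {z. z > 0 \<and> cos (sqrt z * l) = -1}) \<and>
         (N = n \<and> \<not> bipartite E \<longrightarrow>
           laplace_spectrum E len =
             {0} \<union> {z. z > 0 \<and> cos (sqrt z * l) \<in> eigenvalues Z}) \<and>
         (\<forall>z\<ge>0.
           (z = 0 \<longrightarrow> laplace_multiplicity E len z = 1) \<and>
           (sin (sqrt z * l) \<noteq> 0 \<longrightarrow>
             laplace_multiplicity E len z = dim (matrix_kernel (Z - cos (sqrt z * l) *\<^sub>R mat 1))) \<and>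
           (cos (sqrt z * l) = 1 \<and> z > 0 \<longrightarrow> int (laplace_multiplicity E len z) = N - n + 2) \<and>
           (cos (sqrt z * l) = -1 \<and> bipartite E \<longrightarrow>
             int (laplace_multiplicity E len z) = N - n + 2) \<and>
           (cos (sqrt z * l) = -1 \<and> \<not> bipartite E \<longrightarrow>
             int (laplace_multiplicity E len z) = N - n))"
proof -
  interpret equilateral_graph E len l
    using assms(1-3) by unfold_locales
  have regular: "laplace_multiplicity E len z = dim (matrix_kernel (Z - cos (sqrt z * l) *\<^sub>R mat 1))"
    if "0 \<le> z" "sin (sqrt z * l) \<noteq> 0" for z
  proof -
    have "matrix_kernel (Z - cos (sqrt z * l) *\<^sub>R mat 1) = {\<phi>. Z *v \<phi> = cos (sqrt z * l) *\<^sub>R \<phi>}"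
      by (simp add: matrix_kernel_def matrix_vector_mult_diff_rdistrib scaleR_matrix_vector_assoc[symmetric])
    moreover have "ssol z l \<noteq> 0" using that ssol_eq_0_iff by simp
    ultimately show ?thesis
      using that by (simp add: laplace_multiplicity_eq dim_coupling_kernel_regular csol_nonneg Z_def)
  qed
  have pos: "0 < z" if "0 \<le> z" "cos (sqrt z * l) = - 1" for z
    using that by (cases "z = 0") auto
  have "laplace_spectrum E len = {0} \<union> {z. z > 0 \<and> cos (sqrt z * l) \<in> eigenvalues Z}
                 \<union> {z. z > 0 \<and> cos (sqrt z * l) = -1}" if "N \<noteq> n \<or> bipartite E"
    using that by (auto simp: spectrum_iff Z_def N_def n_def)
  moreover have "laplace_spectrum E len = {0} \<union> {z. z > 0 \<and> cos (sqrt z * l) \<in> eigenvalues Z}"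
    if "N = n \<and> \<not> bipartite E"
    using that by (auto simp: spectrum_iff Z_def N_def n_def)
  moreover have "laplace_multiplicity E len 0 = 1"
    by (simp add: laplace_multiplicity_eq multiplicity_0)
  moreover have "int (laplace_multiplicity E len z) = N - n + 2" if "cos (sqrt z * l) = 1" "z > 0" for z
    using dim_coupling_kernel_cos[OF that(2,1)] by (simp add: laplace_multiplicity_eq dim_alternating_1 N_def n_def)
  moreover have "int (laplace_multiplicity E len z) = (if bipartite E then N - n + 2 else N - n)"
    if "0 \<le> z" "cos (sqrt z * l) = - 1" for z
    using dim_coupling_kernel_cos[OF pos[OF that] that(2)]
    by (simp add: laplace_multiplicity_eq dim_alternating_minus_1 N_def n_def)
  ultimately show ?thesis using regular by simp
qed

end
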